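(* Let $T,\Omega\subset\mathbb{R}^d$ be sets of finite measure and let $\epsilon$ be a positive real number. For $r>0$ let $P_{rT,\Omega}=D_{rT}B_\Omega D_{rT}$ on $L^2(\mathbb{R}^d)$, and let $\eta(\epsilon,rT,\Omega)$ stand for the maximum number of orthonormal functions $f\in L^2(\mathbb{R}^d)$ such that $$\left\Vert P_{rT,\Omega}f-f\right\Vert^2\le\epsilon .$$ Then, as $r\to\infty$, the following inequalities hold: $$\frac{|T|\,|\Omega|}{(2\pi)^d}(1+\epsilon)\;\le\;\lim_{r\to\infty}\frac{\eta(\epsilon,rT,\Omega)}{r^d}\;\le\;\frac{|T|\,|\Omega|}{(2\pi)^d}(1-2\epsilon)^{-1}.$$
   Context: $|\cdot|$ is Lebesgue measure on $\mathbb{R}^d$, $\chi_A$ is the characteristic function of a set $A$, and $\|\cdot\|$ is the norm of $L^2(\mathbb{R}^d)$. $rT=\{rt: t\in T\}$ is the dilate of $T$. The Fourier transform is $Ff(\xi)=(2\pi)^{-d/2}\int_{\mathbb{R}^d}f(t)e^{-i\xi t}\,dt$ for $f\in L^1(\mathbb{R}^d)\cap L^2(\mathbb{R}^d)$ (extended to $L^2(\mathbb{R}^d)$ as usual), where $\xi t$ denotes the inner product. For $A\subset\mathbb{R}^d$, $D_A$ is the orthogonal projection of $L^2(\mathbb{R}^d)$ onto the subspace of functions vanishing outside $A$, i.e. $D_Af=\chi_A f$. $B_\Omega$ is the orthogonal projection of $L^2(\mathbb{R}^d)$ onto the subspace of functions whose Fourier transform vanishes outside $\Omega$, i.e. $B_\Omega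 f=F^{-1}(\chi_\Omega Ff)$.
   Formalization: The upper bound is asserted only for ε < 1/2, since (1−2ε)^{-1} is undefined at ε = 1/2 and negative for ε > 1/2, contradicting the lower bound when |T||Ω| > 0; existence of the limit (possibly infinite) and the lower bound hold for all ε > 0. *)

theory Defs
  imports "HOL-Analysis.Analysis" "HOL-Library.Extended_Nat"
begin

text \<open>Elements of \<open>L\<^sup>2\<close> are represented by functions; equality in \<open>L\<^sup>2\<close> is equality almost everywhere.\<close>

definition L2 :: "('a::euclidean_space \<Rightarrow> complex) set" where
  "L2 = {f \<in> borel_measurable lebesgue. integrable lebesgue (\<lambda>x. (cmod (f x))\<^sup>2)}"

definition L2_inner :: "('a::euclidean_space \<Rightarrow> complex) \<Rightarrow> ('a \<Rightarrow> complex) \<Rightarrow> complex" where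
  "L2_inner f g = (LINT x|lebesgue. f x * cnj (g x))"

definition L2_norm :: "('a::euclidean_space \<Rightarrow> complex) \<Rightarrow> real" where
  "L2_norm f = sqrt (LINT x|lebesgue. (cmod (f x))\<^sup>2)"

definition fourier_integral :: "('a::euclidean_space \<Rightarrow> complex) \<Rightarrow> 'a \<Rightarrow> complex" where
  "fourier_integral f \<xi> =
     complex_of_real ((2 * pi) powr (- real DIM('a) / 2)) *
     (LINT t|lebesgue. f t * exp (- \<i> * complex_of_real (\<xi> \<bullet> t)))"

text \<open>The graph of the Fourier transform on \<open>L\<^sup>2\<close>, as the closure in \<open>L\<^sup>2 \<times> L\<^sup>2\<close> of the graph of
  the Fourier integral on \<open>L\<^sup>1 \<inter> L\<^sup>2\<close>.\<close>

definition fourier_graph :: "('a::euclidean_space \<Rightarrow> complex) \<Rightarrow> ('a \<Rightarrow> complex) \<Rightarrow> bool" where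
  "fourier_graph f g \<longleftrightarrow> f \<in> L2 \<and> g \<in> L2 \<and>
     (\<exists>h :: nat \<Rightarrow> 'a \<Rightarrow> complex.
        (\<forall>n. integrable lebesgue (h n) \<and> h n \<in> L2 \<and> fourier_integral (h n) \<in> L2) \<and>
        (\<lambda>n. L2_norm (\<lambda>x. h n x - f x)) \<longlonglongrightarrow> 0 \<and>
        (\<lambda>n. L2_norm (\<lambda>\<xi>. fourier_integral (h n) \<xi> - g \<xi>)) \<longlonglongrightarrow> 0)"

text \<open>On \<open>L\<^sup>2\<close>, Plancherel's theorem makes \<open>fourier_graph\<close> the graph of a bijection modulo equality
  almost everywhere, so each of the following two choices is only a choice of representative.\<close>

definition fourier :: "('a::euclidean_space \<Rightarrow> complex) \<Rightarrow> 'a \<Rightarrow> complex" where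
  "fourier f = (SOME g. fourier_graph f g)"

definition inv_fourier :: "('a::euclidean_space \<Rightarrow> complex) \<Rightarrow> 'a \<Rightarrow> complex" where
  "inv_fourier g = (SOME f. fourier_graph f g)"

definition time_proj :: "'a::euclidean_space set \<Rightarrow> ('a \<Rightarrow> complex) \<Rightarrow> 'a \<Rightarrow> complex" where
  "time_proj A f = (\<lambda>x. indicator A x * f x)"

definition band_proj :: "'a::euclidean_space set \<Rightarrow> ('a \<Rightarrow> complex) \<Rightarrow> 'a \<Rightarrow> complex" where
  "band_proj \<Omega> f = inv_fourier (\<lambda>\<xi>. indicator \<Omega> \<xi> * fourier f \<xi>)"

definition loc_op :: "'a::euclidean_space set \<Rightarrow> 'a set \<Rightarrow> ('a \<Rightarrow> complex) \<Rightarrow> 'a \<Rightarrow> complex" where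
  "loc_op A \<Omega> f = time_proj A (band_proj \<Omega> (time_proj A f))"

definition L2_orthonormal :: "nat \<Rightarrow> (nat \<Rightarrow> 'a::euclidean_space \<Rightarrow> complex) \<Rightarrow> bool" where
  "L2_orthonormal n f \<longleftrightarrow>
     (\<forall>i<n. f i \<in> L2) \<and> (\<forall>i<n. \<forall>j<n. L2_inner (f i) (f j) = (if i = j then 1 else 0))"

text \<open>The value is \<open>\<infinity>\<close> if there are arbitrarily large such orthonormal families; otherwise the
  supremum is a maximum.\<close>

definition eta :: "real \<Rightarrow> 'a::euclidean_space set \<Rightarrow> 'a set \<Rightarrow> enat" where
  "eta \<epsilon> A \<Omega> =
     Sup {enat n | n. \<exists>f. L2_orthonormal n f \<and>
                         (\<forall>i<n. (L2_norm (\<lambda>x. loc_op A \<Omega> (f i) x - f i x))\<^sup>2 \<le> \<epsilon>)}"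

end

theory Submission
  imports Defs "HOL-Probability.Characteristic_Functions"
begin

text \<open>
  The limit exists and equals \<open>N / (1 - \<epsilon>)\<close> with \<open>N = |T| |\<Omega>| / (2\<pi>)\<^sup>d\<close> for \<open>\<epsilon> < 1\<close>, and it is \<open>\<infinity>\<close>
  for \<open>\<epsilon> \<ge> 1\<close>. Let \<open>P = D B D\<close> be the localization operator for \<open>A = rT\<close> and \<open>\<Omega>\<close>. For a unit vector \<open>f\<close>,
  \<open>1 - \<parallel>P f - f\<parallel>\<^sup>2 = \<parallel>B D f\<parallel>\<^sup>2 + \<parallel>(1 - D) B D f\<parallel>\<^sup>2\<close>. By Bessel's inequality, the sum of the first terms
  over an orthonormal family is at most \<open>N r\<^sup>d\<close>, and the sum of the second terms is at most
  \<open>\<integral>|\<kappa>(v)|\<^sup>2 |A \<triangle> (A + v)| dv = o(r\<^sup>d)\<close> with the square-integrable kernel \<open>\<kappa>\<close> of \<open>B\<close>. This gives the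
  upper bound. Conversely, windowed exponentials on a time-frequency lattice provide about \<open>N r\<^sup>d\<close>
  orthonormal functions with \<open>P f \<approx> f\<close>. Adding about \<open>N r\<^sup>d \<epsilon> / (1 - \<epsilon>)\<close> further orthonormal functions makes
  the average of \<open>\<parallel>P f - f\<parallel>\<^sup>2\<close> at most \<open>\<epsilon>\<close>, and rotations inside the span bring every value down to it.
\<close>

hide_fact (open) Henstock_Kurzweil_Integration.integral_cong Henstock_Kurzweil_Integration.integral_cnj
  Henstock_Kurzweil_Integration.integrable_add Henstock_Kurzweil_Integration.integrable_diff
  Henstock_Kurzweil_Integration.integral_add Henstock_Kurzweil_Integration.integrable_bound

section \<open>Translations in Lebesgue measure\<close>

text \<open>The usual route reads the count off the eigenvalues of the compact operator P. Here no
  spectral theory enters: Bessel's inequality, applied pointwise in frequency and in time, plays the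
  part of the traces of P and of P - P squared, and an average defect serves as well as eigenvectors
  would. The constant comes from a budget: n functions with defect near 0 and k more with defect at
  most 1, as for every unit vector, average about \<epsilon> when k = (n + k) \<epsilon>, that is n
  + k = n / (1 - \<epsilon>). Another obstacle is that \<open>fourier\<close> and
  \<open>inv_fourier\<close> are choices from a closed graph. As A and \<Omega> have finite measure,
  both transforms inside P act on integrable functions and are given by integrals, so Plancherel's
  theorem for integrable functions in \<open>L2\<close> and a weak form of inversion suffice; both
  are derived from Gaussian integrals. The Fubini arguments are carried out for Borel sets and
  functions, so T and \<Omega> are finally replaced by Borel sets that differ from them by null
  sets.\<close>

lemma nn_integral_lborel_affine:
  fixes f :: "'a::euclidean_space \<Rightarrow> ennreal"
  assumes [measurable]: "f \<in> borel_measurable borel" and c: "c \<noteq> 0"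
  shows "(\<integral>\<^sup>+x. f x \<partial>lborel) = ennreal (\<bar>c\<bar> ^ DIM('a)) * (\<integral>\<^sup>+x. f (t + c *\<^sub>R x) \<partial>lborel)"
  by (subst lborel_affine[OF c, of t])
     (simp add: nn_integral_density nn_integral_distr nn_integral_cmult ennreal_power)

lemma lborel_integrable_affine:
  fixes f :: "'a::euclidean_space \<Rightarrow> 'b::{banach, second_countable_topology}"
  assumes f: "integrable lborel f" and c: "c \<noteq> 0"
  shows "integrable lborel (\<lambda>x. f (t + c *\<^sub>R x))"
proof -
  have [measurable]: "f \<in> borel_measurable borel" using f by auto
  have "(\<integral>\<^sup>+x. norm (f x) \<partial>lborel) < \<infinity>" using f by (simp add: integrable_iff_bounded)
  then show ?thesis
    using c by (subst (asm) nn_integral_lborel_affine[OF _ c, of _ t])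
      (auto simp: integrable_iff_bounded ennreal_mult_less_top ennreal_zero_less_mult_iff)
qed

text \<open>No integrability is assumed: if \<open>f\<close> is not integrable, neither is the
  substituted function, because the inverse substitution would carry integrability back, and both
  integrals have the default value 0.\<close>

lemma lborel_integral_affine:
  fixes f :: "'a::euclidean_space \<Rightarrow> 'b::{banach, second_countable_topology}"
  assumes c: "c \<noteq> 0"
  shows "(LINT x|lborel. f x) = (\<bar>c\<bar> ^ DIM('a)) *\<^sub>R (LINT x|lborel. f (t + c *\<^sub>R x))"
proof (cases "integrable lborel f")
  case True
  then have [measurable]: "f \<in> borel_measurable borel" by auto
  show ?thesis
    using c by (subst lborel_affine[OF c, of t])
      (simp add: ennreal_power integral_density integral_distr)
next
  case False
  have "\<not> integrable lborel (\<lambda>x. f (t + c *\<^sub>R x))"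
  proof
    assume "integrable lborel (\<lambda>x. f (t + c *\<^sub>R x))"
    from lborel_integrable_affine[OF this, of "1/c" "- t /\<^sub>R c"] False c show False
      by (simp add: algebra_simps)
  qed
  with False show ?thesis by (simp add: not_integrable_integral_eq)
qed

lemma lborel_integrable_translate:
  fixes f :: "'a::euclidean_space \<Rightarrow> 'b::{banach, second_countable_topology}"
  assumes "integrable lborel f"
  shows "integrable lborel (\<lambda>x. f (x + u))"
  using lborel_integrable_affine[OF assms, of 1 u] by (simp add: add.commute)

lemma lborel_integral_translate:
  fixes f :: "'a::euclidean_space \<Rightarrow> 'b::{banach, second_countable_topology}"
  shows "(LINT x|lborel. f (x + u)) = (LINT x|lborel. f x)"
  using lborel_integral_affine[of 1 f u] by (simp add: add.commute)

section \<open>Continuity of translations in the mean\<close>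

text \<open>The measure of the symmetric difference of \<open>A\<close> and its translate by
  \<open>- u\<close>, kept as an integral so that averaging over \<open>u\<close> is a direct use of
  Fubini.\<close>

definition shift_diff :: "'a::euclidean_space set \<Rightarrow> 'a \<Rightarrow> real" where
  "shift_diff A u = (LINT x|lborel. \<bar>indicator A (x + u) - indicator A x\<bar>)"

lemma shift_diff_nonneg: "0 \<le> shift_diff A u"
  by (simp add: shift_diff_def)

text \<open>Squeeze \<open>A\<close> between a compact \<open>K\<close> and an open \<open>U\<close>
  with a gap of measure below \<open>e/2\<close>. A sufficiently short shift cannot take a point of
  \<open>K\<close> out of \<open>U\<close>, so membership in \<open>A\<close> changes only if
  \<open>x\<close> or \<open>x + u\<close> lies in the gap.\<close>

lemma shift_diff_tendsto_0:
  fixes A :: "'a::euclidean_space set"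
  assumes A: "A \<in> sets borel" "emeasure lborel A < \<infinity>"
  shows "(shift_diff A \<longlongrightarrow> 0) (nhds 0)"
proof (rule tendstoI)
  fix e :: real assume e: "e > 0"
  have AL: "A \<in> lmeasurable" using A by (simp add: fmeasurable_def)
  obtain U where U: "open U" "A \<subseteq> U" "(U - A) \<in> lmeasurable" "emeasure lebesgue (U - A) < ennreal (e/8)"
    using sets_lebesgue_outer_open[of A "e/8"] AL e by (metis fmeasurableD zero_less_divide_iff zero_less_numeral)
  obtain C where C: "closed C" "C \<subseteq> A" "(A - C) \<in> lmeasurable" "emeasure lebesgue (A - C) < ennreal (e/8)"
    using sets_lebesgue_inner_closed[of A "e/8"] AL e by (metis fmeasurableD zero_less_divide_iff zero_less_numeral)
  have "C = A - (A - C)" using C by auto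
  then have CL: "C \<in> lmeasurable" using C AL by (metis fmeasurable.Diff)
  have CB: "C \<in> sets borel" using C by auto
  \<comment> \<open>Continuity from above: the parts of \<open>C\<close> outside growing balls
    decrease to the empty set.\<close>
  obtain K where K: "compact K" "K \<subseteq> C" "measure lebesgue (C - K) < e/8"
  proof -
    have "(\<lambda>n. measure lebesgue (C - cball 0 (real n))) \<longlonglongrightarrow> measure lebesgue (\<Inter>n. C - cball 0 (real n))"
    proof (rule Lim_measure_decseq)
      show "range (\<lambda>n. C - cball 0 (real n)) \<subseteq> sets lebesgue"
        using CL by (auto simp: fmeasurable_def)
      show "decseq (\<lambda>n. C - cball 0 (real n))"
        by (auto simp: decseq_def)
      show "emeasure lebesgue (C - cball 0 (real i)) \<noteq> \<infinity>" for i
        using CL by (metis fmeasurable.Diff fmeasurableD2 infinity_ennreal_def lmeasurable_cball fmeasurableD)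
    qed
    moreover have "(\<Inter>n. C - cball 0 (real n)) = {}"
      by (auto simp: ) (meson real_arch_simple)
    ultimately have "(\<lambda>n. measure lebesgue (C - cball 0 (real n))) \<longlonglongrightarrow> 0"
      by (simp only: measure_empty)
    then have "\<forall>\<^sub>F n in sequentially. measure lebesgue (C - cball 0 (real n)) < e/8"
      using e by (intro order_tendstoD) auto
    then obtain n where n: "measure lebesgue (C - cball 0 (real n)) < e/8"
      by (auto simp: eventually_sequentially)
    have "C - (C \<inter> cball 0 (real n)) = C - cball 0 (real n)" by auto
    with n C show ?thesis
      by (intro that[of "C \<inter> cball 0 (real n)"]) auto
  qed
  have KU: "K \<subseteq> U" using K C U by auto
  define D where "D = U - K"
  have UL: "U \<in> lmeasurable" using U AL
    by (metis Diff_partition fmeasurable.Un)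
  have KL: "K \<in> lmeasurable" using K by (simp add: lmeasurable_compact)
  have DL: "D \<in> lmeasurable" using UL KL by (auto simp: D_def fmeasurable.Diff)
  have "D = (U - A) \<union> (A - C) \<union> (C - K)" using K C U by (auto simp: D_def)
  then have "measure lebesgue D \<le> measure lebesgue (U - A) + measure lebesgue (A - C) + measure lebesgue (C - K)"
    using U C CL KL measure_Un_le[of "(U - A) \<union> (A - C)" lebesgue "C - K"] measure_Un_le[of "U - A" lebesgue "A - C"]
    by (auto dest: fmeasurableD)
  moreover have "measure lebesgue (U - A) < e/8" "measure lebesgue (A - C) < e/8"
    using U C e by (auto simp: emeasure_eq_measure2 ennreal_less_iff)
  ultimately have mD: "measure lebesgue D < e/2" using K e by linarith
  have DB: "D \<in> sets borel" using U K by (auto simp: D_def compact_imp_closed)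
  obtain d where d: "d > 0" "\<And>x y. x \<in> K \<Longrightarrow> dist x y < d \<Longrightarrow> y \<in> U"
  proof -
    obtain d where "d > 0" "(\<Union>x\<in>K. ball x d) \<subseteq> U"
      using compact_subset_open_imp_ball_epsilon_subset[OF \<open>compact K\<close> \<open>open U\<close> KU] by blast
    then show ?thesis by (intro that[of d]) (auto simp: subset_iff)
  qed
  have intD: "integrable lborel (indicator D :: 'a \<Rightarrow> real)"
    using DL DB by (auto simp: integrable_indicator_iff fmeasurable_def)
  have intA: "integrable lborel (indicator A :: 'a \<Rightarrow> real)"
    using A by (auto simp: integrable_indicator_iff)
  have bound: "shift_diff A u < e" if u: "norm u < d" for u
  proof -
    have "\<bar>indicator A (x + u) - indicator A x :: real\<bar> \<le> indicator D (x + u) + indicator D x" for x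
    proof -
      have "x + u \<in> K \<Longrightarrow> x \<in> U" "x \<in> K \<Longrightarrow> x + u \<in> U"
        using d(2)[of "x+u" x] d(2)[of x "x+u"] u by (auto simp: dist_norm)
      then show ?thesis using U C K by (auto simp: indicator_def D_def)
    qed
    then have "shift_diff A u \<le> (LINT x|lborel. indicator D (x + u) + indicator D x)"
      unfolding shift_diff_def using intD intA by (intro integral_mono integrable_add integrable_abs integrable_diff)
         (auto intro: lborel_integrable_translate)
    also have "\<dots> = 2 * measure lebesgue D"
      using intD lborel_integrable_translate[OF intD, of u] lborel_integral_translate[of "indicator D :: 'a \<Rightarrow> real" u] DB by simp
    also have "\<dots> < e" using mD by simp
    finally show ?thesis .
  qed
  show "\<forall>\<^sub>F u in nhds 0. dist (shift_diff A u) 0 < e"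
    unfolding eventually_nhds_metric using bound d(1) shift_diff_nonneg[of A]
    by (intro exI[of _ d]) (auto simp: dist_norm)
qed

text \<open>Density argument: indicators are covered by \<open>shift_diff\<close>. In the limit step
  the two outer errors are equal by translation invariance, so a single approximant within
  \<open>e/3\<close> suffices.\<close>

lemma L1_translation_continuous:
  fixes f :: "'a::euclidean_space \<Rightarrow> real"
  assumes "integrable lborel f"
  shows "((\<lambda>u. LINT x|lborel. \<bar>f (x + u) - f x\<bar>) \<longlongrightarrow> 0) (nhds 0)"
  using assms
proof (induction rule: integrable_induct)
  case (base A c)
  have "((\<lambda>u. \<bar>c\<bar> * shift_diff A u) \<longlongrightarrow> \<bar>c\<bar> * 0) (nhds 0)"
    using base by (intro tendsto_intros shift_diff_tendsto_0) auto
  moreover have "\<bar>c\<bar> * shift_diff A u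
      = (LINT x|lborel. \<bar>indicator A (x + u) *\<^sub>R c - indicator A x *\<^sub>R c\<bar>)" for u
    unfolding shift_diff_def
    by (subst integral_mult_right_zero[symmetric], intro integral_cong)
       (auto simp: abs_mult[symmetric] algebra_simps)
  ultimately show ?case by simp
next
  case (add f g)
  show ?case
  proof (rule tendsto_sandwich[OF _ _ tendsto_const])
    show "((\<lambda>u. (LINT x|lborel. \<bar>f (x + u) - f x\<bar>) + (LINT x|lborel. \<bar>g (x + u) - g x\<bar>)) \<longlongrightarrow> 0) (nhds 0)"
      using tendsto_add[OF add.IH] by simp
    show "\<forall>\<^sub>F u in nhds 0. (LINT x|lborel. \<bar>f (x + u) + g (x + u) - (f x + g x)\<bar>)
        \<le> (LINT x|lborel. \<bar>f (x + u) - f x\<bar>) + (LINT x|lborel. \<bar>g (x + u) - g x\<bar>)"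
      using add.hyps
      by (intro always_eventually allI, subst integral_add[symmetric])
         (auto intro!: integral_mono integrable_abs integrable_diff
            integrable_add lborel_integrable_translate)
  qed auto
next
  case (lim f s)
  show ?case
  proof (rule tendstoI)
    fix e :: real assume e: "e > 0"
    \<comment> \<open>The induction rule supplies approximants with
      \<open>\<bar>s i x\<bar> \<le> 2 * \<bar>f x\<bar>\<close>, whence the dominating function
      \<open>3 * \<bar>f x\<bar>\<close>.\<close>
    have "(\<lambda>i. LINT x|lborel. \<bar>s i x - f x\<bar>) \<longlonglongrightarrow> (LINT x|(lborel::'a measure). (0::real))"
    proof (rule integral_dominated_convergence[where w="\<lambda>x. 3 * \<bar>f x\<bar>"])
      show "AE x in lborel. (\<lambda>i. \<bar>s i x - f x\<bar>) \<longlonglongrightarrow> 0"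
        using lim.hyps(2) by (auto intro!: AE_I2 tendsto_rabs_zero simp: LIM_zero_iff)
      show "AE x in lborel. norm \<bar>s i x - f x\<bar> \<le> 3 * \<bar>f x\<bar>" for i
      proof (intro AE_I2)
        fix x :: 'a assume "x \<in> space lborel"
        from lim.hyps(3)[OF this, of i] have "\<bar>s i x\<bar> \<le> 2 * \<bar>f x\<bar>" by simp
        then show "norm \<bar>s i x - f x\<bar> \<le> 3 * \<bar>f x\<bar>" by (simp add: abs_if split: if_splits)
      qed
    qed (use lim.hyps in \<open>auto dest: borel_measurable_integrable\<close>)
    then have "\<forall>\<^sub>F i in sequentially. (LINT x|lborel. \<bar>s i x - f x\<bar>) < e/3"
      using e by (intro order_tendstoD) auto
    then obtain i where i: "(LINT x|lborel. \<bar>s i x - f x\<bar>) < e/3"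
      by (auto simp: eventually_sequentially)
    have int: "integrable lborel (\<lambda>x. \<bar>s i x - f x\<bar>)"
      using lim.hyps by (auto intro!: integrable_abs)
    have "\<forall>\<^sub>F u in nhds 0. (LINT x|lborel. \<bar>s i (x + u) - s i x\<bar>) < e/3"
      using lim.IH[of i] e by (intro order_tendstoD) auto
    then show "\<forall>\<^sub>F u in nhds 0. dist (LINT x|lborel. \<bar>f (x + u) - f x\<bar>) 0 < e"
    proof (eventually_elim)
      case (elim u)
      have "(LINT x|lborel. \<bar>f (x + u) - f x\<bar>)
        \<le> (LINT x|lborel. \<bar>s i (x + u) - f (x + u)\<bar> + \<bar>s i (x + u) - s i x\<bar> + \<bar>s i x - f x\<bar>)"
        using lim.hyps lborel_integrable_translate[OF int]
        by (intro integral_mono integrable_abs integrable_diff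
            integrable_add lborel_integrable_translate) auto
      also have "\<dots> = (LINT x|lborel. \<bar>s i (x + u) - f (x + u)\<bar>) + (LINT x|lborel. \<bar>s i (x + u) - s i x\<bar>) + (LINT x|lborel. \<bar>s i x - f x\<bar>)"
        using lim.hyps lborel_integrable_translate[OF int, of u] int
        by (subst integral_add; (subst integral_add)?)
           (auto intro!: integrable_abs integrable_diff
            integrable_add lborel_integrable_translate)
      also have "\<dots> < e"
        using elim i lborel_integral_translate[of "\<lambda>x. \<bar>s i x - f x\<bar>" u] by simp
      finally show ?case by simp
    qed
  qed
qed

section \<open>Square-integrable functions and Gaussians\<close>

lemma integrable_mult_square:
  fixes f g :: "'b \<Rightarrow> complex"
  assumes [measurable]: "f \<in> borel_measurable M" "g \<in> borel_measurable M"
    and f: "integrable M (\<lambda>x. (cmod (f x))\<^sup>2)" and g: "integrable M (\<lambda>x. (cmod (g x))\<^sup>2)"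
  shows "integrable M (\<lambda>x. f x * g x)"
proof (rule integrable_bound)
  show "integrable M (\<lambda>x. (cmod (f x))\<^sup>2 + (cmod (g x))\<^sup>2)" using f g by auto
  show "AE x in M. norm (f x * g x) \<le> norm ((cmod (f x))\<^sup>2 + (cmod (g x))\<^sup>2)"
  proof (intro AE_I2)
    fix x
    have "2 * (cmod (f x) * cmod (g x)) \<le> (cmod (f x))\<^sup>2 + (cmod (g x))\<^sup>2"
      using sum_squares_bound[of "cmod (f x)" "cmod (g x)"] by simp
    moreover have "0 \<le> cmod (f x) * cmod (g x)" by simp
    ultimately have "cmod (f x) * cmod (g x) \<le> (cmod (f x))\<^sup>2 + (cmod (g x))\<^sup>2" by linarith
    then show "norm (f x * g x) \<le> norm ((cmod (f x))\<^sup>2 + (cmod (g x))\<^sup>2)"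
      by (simp add: norm_mult)
  qed
qed measurable

text \<open>The integral of \<open>(cmod (f x) - t * cmod (g x))\<^sup>2\<close> is a nonnegative
  quadratic in \<open>t\<close>; its value at the minimiser \<open>t = B / C\<close> gives the
  claim.\<close>

lemma Cauchy_Schwarz_integral:
  fixes f g :: "'b \<Rightarrow> complex"
  assumes [measurable]: "f \<in> borel_measurable M" "g \<in> borel_measurable M"
    and f: "integrable M (\<lambda>x. (cmod (f x))\<^sup>2)" and g: "integrable M (\<lambda>x. (cmod (g x))\<^sup>2)"
  shows "cmod (LINT x|M. f x * g x) \<le> sqrt (LINT x|M. (cmod (f x))\<^sup>2) * sqrt (LINT x|M. (cmod (g x))\<^sup>2)"
proof -
  define A where "A = (LINT x|M. (cmod (f x))\<^sup>2)"
  define B where "B = (LINT x|M. cmod (f x) * cmod (g x))"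
  define C where "C = (LINT x|M. (cmod (g x))\<^sup>2)"
  have int: "integrable M (\<lambda>x. cmod (f x) * cmod (g x))"
    using integrable_norm[OF integrable_mult_square[OF assms]] by (simp add: norm_mult)
  have nonneg: "A \<ge> 0" "B \<ge> 0" "C \<ge> 0" by (simp_all add: A_def B_def C_def)
  have quad: "0 \<le> A - 2 * t * B + t\<^sup>2 * C" for t
  proof -
    have "0 \<le> (LINT x|M. (cmod (f x) - t * cmod (g x))\<^sup>2)" by simp
    also have "\<dots> = (LINT x|M. ((cmod (f x))\<^sup>2 - 2 * t * (cmod (f x) * cmod (g x))) + t\<^sup>2 * (cmod (g x))\<^sup>2)"
      by (intro integral_cong) (auto simp: power2_eq_square algebra_simps)
    also have "\<dots> = A - 2 * t * B + t\<^sup>2 * C"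
      using f g int by (simp add: A_def B_def C_def)
    finally show ?thesis .
  qed
  have "B\<^sup>2 \<le> A * C"
  proof (cases "C = 0")
    case True
    have "B = 0"
    proof (rule ccontr)
      assume "B \<noteq> 0"
      \<comment> \<open>With \<open>C = 0\<close> the quadratic is affine in \<open>t\<close>, and
        at \<open>t = (A + 1) / B\<close> it would equal \<open>- A - 2\<close>.\<close>
      then have "2 * ((A + 1) / B) * B = 2 * (A + 1)" by simp
      with quad[of "(A + 1) / B"] True nonneg show False by simp
    qed
    then show ?thesis using True by simp
  next
    case False
    with nonneg have "C > 0" by simp
    then have "(A - 2 * (B / C) * B + (B / C)\<^sup>2 * C) * C = A * C - B\<^sup>2"
      by (simp add: field_simps power2_eq_square)
    with quad[of "B / C"] \<open>C > 0\<close> show ?thesis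
      by (smt (verit) mult_nonneg_nonneg)
  qed
  then have "B \<le> sqrt A * sqrt C"
    using nonneg by (metis real_le_rsqrt real_sqrt_mult)
  moreover have "cmod (LINT x|M. f x * g x) \<le> B"
    unfolding B_def using integral_norm_bound[of M "\<lambda>x. f x * g x"] by (simp add: norm_mult)
  ultimately show ?thesis by (simp add: A_def C_def)
qed

lemma square_diff_le_abs_diff_squares:
  fixes p q :: real
  assumes "p \<ge> 0" "q \<ge> 0"
  shows "(p - q)\<^sup>2 \<le> \<bar>p\<^sup>2 - q\<^sup>2\<bar>"
proof -
  have "(p - q)\<^sup>2 = \<bar>p - q\<bar> * \<bar>p - q\<bar>" by (simp add: power2_eq_square)
  also have "\<dots> \<le> \<bar>p - q\<bar> * (p + q)" using assms by (intro mult_left_mono) auto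
  also have "\<dots> = \<bar>p\<^sup>2 - q\<^sup>2\<bar>"
    using assms by (simp add: power2_eq_square square_diff_square_factored abs_mult)
  finally show ?thesis .
qed

text \<open>Reduces square-mean continuity to continuity in the mean: the squared positive and
  negative parts of a square-integrable function are integrable, and only their differences occur on
  the right.\<close>

lemma square_diff_le_parts:
  fixes a b :: real
  shows "(a - b)\<^sup>2 \<le> 2 * \<bar>(max 0 a)\<^sup>2 - (max 0 b)\<^sup>2\<bar> + 2 * \<bar>(max 0 (- a))\<^sup>2 - (max 0 (- b))\<^sup>2\<bar>"
proof -
  define p q where "p = max 0 a - max 0 b" and "q = max 0 (- a) - max 0 (- b)"
  have "a - b = p - q" by (auto simp: p_def q_def)
  then have "(a - b)\<^sup>2 \<le> 2 * p\<^sup>2 + 2 * q\<^sup>2"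
    using sum_squares_bound[of p "- q"] by (simp add: power2_diff)
  also have "\<dots> \<le> 2 * \<bar>(max 0 a)\<^sup>2 - (max 0 b)\<^sup>2\<bar> + 2 * \<bar>(max 0 (- a))\<^sup>2 - (max 0 (- b))\<^sup>2\<bar>"
    unfolding p_def q_def by (intro add_mono mult_left_mono square_diff_le_abs_diff_squares) auto
  finally show ?thesis .
qed

lemma integrable_cmod_diff_square:
  fixes f g :: "'b \<Rightarrow> complex"
  assumes [measurable]: "f \<in> borel_measurable M" "g \<in> borel_measurable M"
    and f: "integrable M (\<lambda>x. (cmod (f x))\<^sup>2)" and g: "integrable M (\<lambda>x. (cmod (g x))\<^sup>2)"
  shows "integrable M (\<lambda>x. (cmod (f x - g x))\<^sup>2)"
proof (rule integrable_bound)
  show "integrable M (\<lambda>x. 2 * (cmod (f x))\<^sup>2 + 2 * (cmod (g x))\<^sup>2)" using f g by auto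
  show "AE x in M. norm ((cmod (f x - g x))\<^sup>2) \<le> norm (2 * (cmod (f x))\<^sup>2 + 2 * (cmod (g x))\<^sup>2)"
  proof (intro AE_I2)
    fix x
    have "(cmod (f x - g x))\<^sup>2 \<le> (cmod (f x) + cmod (g x))\<^sup>2"
      by (intro power_mono norm_triangle_ineq4) auto
    also have "\<dots> \<le> 2 * (cmod (f x))\<^sup>2 + 2 * (cmod (g x))\<^sup>2"
      using sum_squares_bound[of "cmod (f x)" "cmod (g x)"] by (simp add: power2_sum)
    finally show "norm ((cmod (f x - g x))\<^sup>2) \<le> norm (2 * (cmod (f x))\<^sup>2 + 2 * (cmod (g x))\<^sup>2)" by simp
  qed
qed measurable

lemma L2_translation_continuous:
  fixes h :: "'a::euclidean_space \<Rightarrow> complex"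
  assumes [measurable]: "h \<in> borel_measurable borel" and h: "integrable lborel (\<lambda>x. (cmod (h x))\<^sup>2)"
  shows "((\<lambda>u. LINT x|lborel. (cmod (h (x + u) - h x))\<^sup>2) \<longlongrightarrow> 0) (nhds 0)"
proof -
  \<comment> \<open>The squares of the positive and negative parts of \<open>Re h\<close> and
    \<open>Im h\<close>; each is integrable, so the translation result for integrable functions
    applies to it.\<close>
  define p where "p j x = (case j of 0 \<Rightarrow> (max 0 (Re (h x)))\<^sup>2 | Suc 0 \<Rightarrow> (max 0 (- Re (h x)))\<^sup>2
     | Suc (Suc 0) \<Rightarrow> (max 0 (Im (h x)))\<^sup>2 | _ \<Rightarrow> (max 0 (- Im (h x)))\<^sup>2)" for j :: nat and x
  have [measurable]: "p j \<in> borel_measurable borel" for j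
    unfolding p_def by (cases j; cases "j - 1"; cases "j - 2") (auto split: nat.splits)
  have pbound: "\<bar>p j x\<bar> \<le> (cmod (h x))\<^sup>2" for j x
    by (auto simp: p_def cmod_power2 max_def split: nat.splits)
  have pint: "integrable lborel (p j)" for j
    by (rule integrable_bound[OF h]) (use pbound in auto)
  have dint: "integrable lborel (\<lambda>x. \<bar>p j (x + u) - p j x\<bar>)" for j u
    using pint[of j] lborel_integrable_translate[OF pint[of j], of u] by auto
  have hint: "integrable lborel (\<lambda>x. (cmod (h (x + u)))\<^sup>2)" for u
    using lborel_integrable_translate[OF h] .
  have pt: "(cmod (h (x + u) - h x))\<^sup>2 \<le> 2 * (\<Sum>j<4. \<bar>p j (x + u) - p j x\<bar>)" for x u
  proof -
    have "(\<Sum>j<4. g j) = g 0 + g (Suc 0) + g (Suc (Suc 0)) + g (Suc (Suc (Suc 0)))" for g :: "nat \<Rightarrow> real"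
      by (simp add: eval_nat_numeral)
    then show ?thesis
      using square_diff_le_parts[of "Re (h (x + u))" "Re (h x)"] square_diff_le_parts[of "Im (h (x + u))" "Im (h x)"]
      by (simp add: cmod_power2 p_def)
  qed
  have bd: "(LINT x|lborel. (cmod (h (x + u) - h x))\<^sup>2) \<le> 2 * (\<Sum>j<4. LINT x|lborel. \<bar>p j (x + u) - p j x\<bar>)" for u
  proof -
    have "(LINT x|lborel. (cmod (h (x + u) - h x))\<^sup>2) \<le> (LINT x|lborel. 2 * (\<Sum>j<4. \<bar>p j (x + u) - p j x\<bar>))"
      using pt dint by (intro integral_mono integrable_cmod_diff_square hint h) auto
    also have "\<dots> = 2 * (\<Sum>j<4. LINT x|lborel. \<bar>p j (x + u) - p j x\<bar>)"
      using dint by simp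
    finally show ?thesis .
  qed
  have "((\<lambda>u. 2 * (\<Sum>j<4. LINT x|lborel. \<bar>p j (x + u) - p j x\<bar>)) \<longlongrightarrow> 2 * (\<Sum>j<(4::nat). 0)) (nhds 0)"
    by (intro tendsto_intros L1_translation_continuous pint)
  then have lim: "((\<lambda>u. 2 * (\<Sum>j<4. LINT x|lborel. \<bar>p j (x + u) - p j x\<bar>)) \<longlongrightarrow> 0) (nhds 0)" by simp
  show ?thesis
    by (rule tendsto_sandwich[OF _ _ tendsto_const lim]) (use bd in auto)
qed

section \<open>Gaussian integrals\<close>

text \<open>\<open>lborel\<close> is the image of the product measure under summation along the
  basis, so integrals of products of one-variable functions factor.\<close>

lemma
  fixes f :: "'a::euclidean_space \<Rightarrow> real \<Rightarrow> complex"
  assumes f: "\<And>b. b \<in> Basis \<Longrightarrow> integrable lborel (f b)"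
  shows lborel_integrable_prod_Basis: "integrable lborel (\<lambda>x. \<Prod>b\<in>Basis. f b (x \<bullet> b))"
    and lborel_integral_prod_Basis: "(LINT x|lborel. (\<Prod>b\<in>Basis. f b (x \<bullet> b))) = (\<Prod>b\<in>Basis. LINT t|lborel. f b t)"
proof -
  interpret product_sigma_finite "\<lambda>_::'a. lborel :: real measure" ..
  have fm[measurable]: "f b \<in> borel_measurable borel" if "b \<in> Basis" for b using f[OF that] by auto
  have F: "(\<lambda>x. \<Prod>b\<in>Basis. f b (x \<bullet> b)) \<in> borel_measurable (borel :: 'a measure)"
    by (intro borel_measurable_prod) (auto intro!: measurable_compose[OF _ fm])
  have coord: "(\<Sum>b'\<in>Basis. g b' *\<^sub>R b') \<bullet> b = g b" if "b \<in> Basis" for g and b :: 'a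
    using that by simp
  have D: "(\<lambda>g. \<Sum>b\<in>Basis. g b *\<^sub>R b) \<in> measurable (\<Pi>\<^sub>M b\<in>Basis. lborel) (borel :: 'a measure)"
    by measurable
  have eq: "(\<lambda>g. \<Prod>b\<in>Basis. f b ((\<Sum>b'\<in>Basis. g b' *\<^sub>R b') \<bullet> b)) = (\<lambda>g. \<Prod>b\<in>Basis. f b (g b))"
    by (intro ext prod.cong refl) simp
  show "integrable lborel (\<lambda>x. \<Prod>b\<in>Basis. f b (x \<bullet> b))"
    using integrable_distr_eq[OF D F] product_integrable_prod[of Basis f] f
    by (subst lborel_eq) (simp add: eq)
  show "(LINT x|lborel. (\<Prod>b\<in>Basis. f b (x \<bullet> b))) = (\<Prod>b\<in>Basis. LINT t|lborel. f b t)"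
    using integral_distr[OF D F] product_integral_prod[of Basis f] f
    by (subst lborel_eq) (simp add: eq)
qed

abbreviation niexp :: "real \<Rightarrow> complex" where
  "niexp x \<equiv> exp (- (\<i> * complex_of_real x))"

text \<open>After normalisation this is the characteristic function of the standard normal
  distribution at \<open>- t\<close>.\<close>

lemma
  fixes t :: real
  shows integrable_gaussian_1: "integrable lborel (\<lambda>x. of_real (exp (- x\<^sup>2 / 2)) * niexp (t * x))"
    and integral_gaussian_1: "(LINT x|lborel. of_real (exp (- x\<^sup>2 / 2)) * niexp (t * x))
       = of_real (sqrt (2 * pi) * exp (- t\<^sup>2 / 2))"
proof -
  have eq: "of_real (exp (- x\<^sup>2 / 2)) * niexp (t * x) =
      of_real (sqrt (2 * pi)) * (std_normal_density x *\<^sub>R iexp (- t * x))" for x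
    by (simp add: std_normal_density_def scaleR_conv_of_real real_sqrt_mult)
  have int: "integrable lborel (\<lambda>x. std_normal_density x *\<^sub>R iexp (- t * x))"
    by (rule integrable_bound[OF integrable_normal_density[of 1 0]])
      (auto intro!: AE_I2)
  then show "integrable lborel (\<lambda>x. of_real (exp (- x\<^sup>2 / 2)) * niexp (t * x))"
    unfolding eq by (intro integrable_mult_right)
  have "(LINT x|lborel. std_normal_density x *\<^sub>R iexp (- t * x)) = char std_normal_distribution (- t)"
    unfolding char_def by (subst integral_density) (auto intro!: AE_I2)
  also have "\<dots> = of_real (exp (- t\<^sup>2 / 2))" by (simp add: char_std_normal_distribution)
  finally show "(LINT x|lborel. of_real (exp (- x\<^sup>2 / 2)) * niexp (t * x))
       = of_real (sqrt (2 * pi) * exp (- t\<^sup>2 / 2))"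
    unfolding eq by (subst integral_mult_right_zero) simp
qed

lemma norm_power2_Basis: "(norm (x::'a::euclidean_space))\<^sup>2 = (\<Sum>b\<in>Basis. (x \<bullet> b)\<^sup>2)"
  by (simp only: power2_norm_eq_inner euclidean_inner[of x x]) (simp add: power2_eq_square)

lemma
  fixes z :: "'a::euclidean_space"
  shows integrable_gaussian: "integrable lborel (\<lambda>x. of_real (exp (- (norm x)\<^sup>2 / 2)) * niexp (x \<bullet> z))"
    and integral_gaussian: "(LINT x|lborel. of_real (exp (- (norm x)\<^sup>2 / 2)) * niexp (x \<bullet> z))
       = of_real ((2 * pi) powr (DIM('a) / 2) * exp (- (norm z)\<^sup>2 / 2))"
proof -
  define f where "f b x = of_real (exp (- x\<^sup>2 / 2)) * niexp ((z \<bullet> b) * x)" for b x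
  have eq: "of_real (exp (- (norm x)\<^sup>2 / 2)) * niexp (x \<bullet> z) = (\<Prod>b\<in>Basis. f b (x \<bullet> b))" for x
  proof -
    have "exp (- (norm x)\<^sup>2 / 2) = (\<Prod>b\<in>Basis. exp (- (x \<bullet> b)\<^sup>2 / 2))"
      by (subst exp_sum[symmetric]) (auto simp: norm_power2_Basis sum_divide_distrib sum_negf)
    moreover have "niexp (x \<bullet> z) = (\<Prod>b\<in>Basis. niexp ((z \<bullet> b) * (x \<bullet> b)))"
      by (subst exp_sum[symmetric]) (auto simp: euclidean_inner[of x z] sum_distrib_left sum_negf mult_ac)
    ultimately show ?thesis by (simp add: f_def prod.distrib)
  qed
  have fint: "integrable lborel (f b)" for b
    unfolding f_def by (rule integrable_gaussian_1)
  show "integrable lborel (\<lambda>x. of_real (exp (- (norm x)\<^sup>2 / 2)) * niexp (x \<bullet> z))"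
    unfolding eq by (intro lborel_integrable_prod_Basis fint)
  have "(\<Prod>b\<in>(Basis::'a set). sqrt (2 * pi) * exp (- (z \<bullet> b)\<^sup>2 / 2)) = sqrt (2 * pi) ^ DIM('a) * exp (- (norm z)\<^sup>2 / 2)"
    by (simp add: prod.distrib norm_power2_Basis exp_sum[symmetric] sum_divide_distrib sum_negf)
  moreover have "sqrt (2 * pi) ^ DIM('a) = (2 * pi) powr (DIM('a) / 2)"
    by (simp add: powr_half_sqrt[symmetric] powr_powr powr_realpow[symmetric])
  moreover have "(LINT x|lborel. of_real (exp (- (norm x)\<^sup>2 / 2)) * niexp (x \<bullet> z))
      = (\<Prod>b\<in>Basis. LINT t|lborel. f b t)"
    unfolding eq by (intro lborel_integral_prod_Basis fint)
  moreover have "(\<Prod>b\<in>(Basis::'a set). LINT t|lborel. f b t)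
      = of_real (\<Prod>b\<in>(Basis::'a set). sqrt (2 * pi) * exp (- (z \<bullet> b)\<^sup>2 / 2))"
    unfolding f_def integral_gaussian_1 by simp
  ultimately show "(LINT x|lborel. of_real (exp (- (norm x)\<^sup>2 / 2)) * niexp (x \<bullet> z))
       = of_real ((2 * pi) powr (DIM('a) / 2) * exp (- (norm z)\<^sup>2 / 2))"
    by simp
qed

lemma
  fixes z :: "'a::euclidean_space" and \<delta> :: real
  assumes \<delta>: "\<delta> > 0"
  shows integrable_gaussian_scaled: "integrable lborel (\<lambda>x. of_real (exp (- (\<delta> * norm x)\<^sup>2 / 2)) * niexp (x \<bullet> z))"
    and integral_gaussian_scaled: "(LINT x|lborel. of_real (exp (- (\<delta> * norm x)\<^sup>2 / 2)) * niexp (x \<bullet> z))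
       = of_real ((2 * pi) powr (DIM('a) / 2) / \<delta> ^ DIM('a) * exp (- (norm (z /\<^sub>R \<delta>))\<^sup>2 / 2))"
proof -
  have eq: "of_real (exp (- (\<delta> * norm x)\<^sup>2 / 2)) * niexp (x \<bullet> z) =
    of_real (exp (- (norm (0 + \<delta> *\<^sub>R x))\<^sup>2 / 2)) * niexp ((0 + \<delta> *\<^sub>R x) \<bullet> (z /\<^sub>R \<delta>))" for x
  proof -
    have "(0 + \<delta> *\<^sub>R x) \<bullet> (z /\<^sub>R \<delta>) = x \<bullet> z" using \<delta> by simp
    then show ?thesis using \<delta> by (simp only:) simp
  qed
  show "integrable lborel (\<lambda>x. of_real (exp (- (\<delta> * norm x)\<^sup>2 / 2)) * niexp (x \<bullet> z))"
    unfolding eq using \<delta> by (intro lborel_integrable_affine[OF integrable_gaussian]) auto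
  show "(LINT x|lborel. of_real (exp (- (\<delta> * norm x)\<^sup>2 / 2)) * niexp (x \<bullet> z))
       = of_real ((2 * pi) powr (DIM('a) / 2) / \<delta> ^ DIM('a) * exp (- (norm (z /\<^sub>R \<delta>))\<^sup>2 / 2))"
    using lborel_integral_affine[of \<delta> "\<lambda>x. of_real (exp (- (norm x)\<^sup>2 / 2)) * niexp (x \<bullet> (z /\<^sub>R \<delta>))" 0] \<delta>
    unfolding integral_gaussian eq by (simp add: field_simps scaleR_conv_of_real)
qed

section \<open>Plancherel's theorem\<close>

notation fourier_integral ("\<F>")

lemma borel_measurable_cnj [measurable]:
  "f \<in> borel_measurable M \<Longrightarrow> (\<lambda>x. cnj (f x)) \<in> borel_measurable M"
  by (rule borel_measurable_continuous_on[OF continuous_on_cnj[OF continuous_on_id]])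

text \<open>For Borel functions, expressions such as \<open>h (x + u)\<close> are jointly measurable
  and Fubini applies on \<open>lborel\<close>. Elements of \<open>L2\<close> are only Lebesgue
  measurable and enter through such a representative.\<close>

lemma borel_representative:
  fixes f :: "'a::euclidean_space \<Rightarrow> complex"
  assumes f: "f \<in> borel_measurable lebesgue"
  obtains g where "g \<in> borel_measurable borel" "AE x in lebesgue. f x = g x"
proof -
  have "(\<lambda>x. Re (f x)) \<in> borel_measurable lebesgue" "(\<lambda>x. Im (f x)) \<in> borel_measurable lebesgue"
    using f by measurable
  from this[THEN completion_ex_borel_measurable_real]
  obtain p q where p: "p \<in> borel_measurable lborel" "AE x in lborel. Re (f x) = p x"
    and q: "q \<in> borel_measurable lborel" "AE x in lborel. Im (f x) = q x"
    by blast
  have [measurable]: "p \<in> borel_measurable borel" "q \<in> borel_measurable borel" using p q by auto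
  show thesis
  proof
    show "(\<lambda>x. Complex (p x) (q x)) \<in> borel_measurable borel" 
      unfolding Complex_eq by measurable
    show "AE x in lebesgue. f x = Complex (p x) (q x)"
      using p(2) q(2) by (intro AE_completion) (auto simp: complex_eq_iff elim: AE_mp)
  qed
qed

lemma lebesgue_measurable_borel: "f \<in> borel_measurable borel \<Longrightarrow> f \<in> borel_measurable lebesgue"
  by (simp add: measurable_completion)

lemma fourier_integral_lborel:
  fixes f :: "'a::euclidean_space \<Rightarrow> complex"
  assumes [measurable]: "f \<in> borel_measurable borel"
  shows "\<F> f \<xi> = of_real ((2 * pi) powr (- real DIM('a) / 2)) *
     (LINT t|lborel. f t * niexp (\<xi> \<bullet> t))"
  unfolding fourier_integral_def by (subst integral_completion) auto

lemma fourier_integral_cong_AE: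
  fixes f g :: "'a::euclidean_space \<Rightarrow> complex"
  assumes f: "f \<in> borel_measurable lebesgue" "g \<in> borel_measurable lebesgue" "AE x in lebesgue. f x = g x"
  shows "\<F> f = \<F> g"
proof
  fix \<xi> :: 'a
  have "(\<lambda>t. niexp (\<xi> \<bullet> t)) \<in> borel_measurable lebesgue"
    by (rule lebesgue_measurable_borel) measurable
  then show "\<F> f \<xi> = \<F> g \<xi>"
    unfolding fourier_integral_def
    using f by (intro arg_cong2[where f="(*)"] refl integral_cong_AE borel_measurable_times) auto
qed

text \<open>The transform is insensitive to null sets, so \<open>f\<close> may be replaced by a
  Borel representative; what remains is a parameter integral.\<close>

lemma borel_measurable_fourier_integral:
  fixes f :: "'a::euclidean_space \<Rightarrow> complex"
  assumes "f \<in> borel_measurable lebesgue"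
  shows "\<F> f \<in> borel_measurable borel"
proof -
  obtain g where g[measurable]: "g \<in> borel_measurable borel" "AE x in lebesgue. f x = g x"
    using borel_representative[OF assms] .
  have "\<F> f = \<F> g"
    by (rule fourier_integral_cong_AE) (use assms g in \<open>auto intro: lebesgue_measurable_borel\<close>)
  also have "\<dots> = (\<lambda>\<xi>. of_real ((2 * pi) powr (- real DIM('a) / 2)) *
     (LINT t|lborel. g t * niexp (\<xi> \<bullet> t)))"
    by (intro ext fourier_integral_lborel g)
  also have "\<dots> \<in> borel_measurable borel" by measurable
  finally show ?thesis .
qed

lemma integrable_mult_unimodular:
  fixes f :: "'b \<Rightarrow> complex"
  assumes "integrable M f" "g \<in> borel_measurable M" "\<And>x. cmod (g x) = 1"
  shows "integrable M (\<lambda>x. f x * g x)"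
  by (rule integrable_bound[OF assms(1)])
    (use assms in \<open>auto simp: norm_mult\<close>)

lemma cmod_fourier_integral_le:
  fixes f :: "'a::euclidean_space \<Rightarrow> complex"
  shows "cmod (\<F> f \<xi>) \<le> (2 * pi) powr (- real DIM('a) / 2) * (LINT t|lebesgue. cmod (f t))"
proof -
  have "cmod (LINT t|lebesgue. f t * exp (- \<i> * of_real (\<xi> \<bullet> t))) \<le> (LINT t|lebesgue. cmod (f t))"
    using integral_norm_bound[of lebesgue "\<lambda>t. f t * exp (- \<i> * of_real (\<xi> \<bullet> t))"] by (simp add: norm_mult)
  then show ?thesis
    unfolding fourier_integral_def norm_mult by (intro mult_mono) auto
qed

text \<open>Fubini, since the kernel is symmetric in its two variables. This formula yields
  Plancherel, inversion, the quadratic form of the localization operator and the kernel of the band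
  projection.\<close>

lemma fourier_multiplication_formula_lborel:
  fixes f g :: "'a::euclidean_space \<Rightarrow> complex"
  assumes f: "integrable lborel f" and g: "integrable lborel g"
  shows "(LINT x|lborel. \<F> f x * g x) = (LINT x|lborel. f x * \<F> g x)"
proof -
  have [measurable]: "f \<in> borel_measurable borel" "g \<in> borel_measurable borel" using f g by auto
  define c where "c = complex_of_real ((2 * pi) powr (- real DIM('a) / 2))"
  define K where "K x t = f t * g x * niexp (x \<bullet> t)" for x t
  have K: "integrable (lborel \<Otimes>\<^sub>M lborel) (\<lambda>(x, t). K x t)"
  proof (rule lborel_pair.Fubini_integrable)
    show "(\<lambda>(x, t). K x t) \<in> borel_measurable (lborel \<Otimes>\<^sub>M lborel)" unfolding K_def by measurable
    show "integrable lborel (\<lambda>x. LINT t|lborel. norm (case (x, t) of (x, t) \<Rightarrow> K x t))"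
      using f g by (simp add: K_def norm_mult)
    show "AE x in lborel. integrable lborel (\<lambda>t. case (x, t) of (x, t) \<Rightarrow> K x t)"
      unfolding K_def prod.case using f
      by (intro AE_I2 integrable_mult_unimodular[where f="\<lambda>t. f t * g x" for x]) auto
  qed
  have "(LINT t|lborel. K x t) = g x * (LINT t|lborel. f t * niexp (x \<bullet> t))" for x
    by (subst integral_mult_right_zero[symmetric]) (simp add: K_def[abs_def] mult_ac)
  then have 1: "\<F> f x * g x = c * (LINT t|lborel. K x t)" for x
    by (simp add: fourier_integral_lborel c_def)
  have "(LINT x|lborel. K x t) = f t * (LINT x|lborel. g x * niexp (t \<bullet> x))" for t
    by (subst integral_mult_right_zero[symmetric]) (simp add: K_def mult_ac inner_commute)
  then have 2: "c * (LINT x|lborel. K x t) = f t * \<F> g t" for t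
    by (simp add: fourier_integral_lborel c_def)
  have "(LINT x|lborel. \<F> f x * g x) = c * (LINT x|lborel. LINT t|lborel. K x t)"
    by (simp add: 1)
  also have "\<dots> = c * (LINT t|lborel. LINT x|lborel. K x t)"
    using lborel_pair.Fubini_integral[OF K] by simp
  also have "\<dots> = (LINT t|lborel. c * (LINT x|lborel. K x t))" by simp
  finally show ?thesis by (simp add: 2)
qed

text \<open>Up to the factor \<open>(2 * pi) powr (DIM('a) / 2)\<close> the result is a probability
  density in \<open>y\<close> concentrated within about \<open>\<delta>\<close> of \<open>x\<close>.
  A Gaussian cut-off in frequency thus becomes a local average in space.\<close>

lemma fourier_integral_gaussian_modulated:
  fixes x y :: "'a::euclidean_space"
  assumes \<delta>: "\<delta> > 0"
  shows "\<F> (\<lambda>\<xi>. of_real (exp (- (\<delta> * norm \<xi>)\<^sup>2 / 2)) * iexp (\<xi> \<bullet> x)) y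
    = complex_of_real (exp (- (norm ((y - x) /\<^sub>R \<delta>))\<^sup>2 / 2) / \<delta> ^ DIM('a))"
proof -
  have "(2 * pi) powr (- real DIM('a) / 2) * (2 * pi) powr (real DIM('a) / 2) = 1"
    by (simp flip: powr_add)
  then have c: "complex_of_real ((2 * pi) powr (- real DIM('a) / 2)) * complex_of_real ((2 * pi) powr (real DIM('a) / 2)) = 1"
    by (simp flip: of_real_mult)
  have "complex_of_real (exp (- (\<delta> * norm \<xi>)\<^sup>2 / 2)) * iexp (\<xi> \<bullet> x) * niexp (y \<bullet> \<xi>)
      = complex_of_real (exp (- (\<delta> * norm \<xi>)\<^sup>2 / 2)) * niexp (\<xi> \<bullet> (y - x))" (is "?l \<xi> = ?r \<xi>") for \<xi>
    by (simp add: mult.assoc flip: exp_add) (simp add: inner_diff_right inner_commute algebra_simps)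
  then have eq: "?l = ?r" by (rule ext)
  have "\<F> (\<lambda>\<xi>. complex_of_real (exp (- (\<delta> * norm \<xi>)\<^sup>2 / 2)) * iexp (\<xi> \<bullet> x)) y
    = complex_of_real ((2 * pi) powr (- real DIM('a) / 2)) *
     (LINT \<xi>|lborel. complex_of_real (exp (- (\<delta> * norm \<xi>)\<^sup>2 / 2)) * niexp (\<xi> \<bullet> (y - x)))"
    by (subst fourier_integral_lborel, measurable) (simp only: eq)
  also have "\<dots> = complex_of_real (exp (- (norm ((y - x) /\<^sub>R \<delta>))\<^sup>2 / 2) / \<delta> ^ DIM('a))"
    unfolding integral_gaussian_scaled[OF \<delta>] using c by (simp add: field_simps)
  finally show ?thesis .
qed

text \<open>Testing \<open>|F h|\<^sup>2\<close> against a wide Gaussian turns it, by the multiplication formula used twice,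
  into the autocorrelation of \<open>h\<close> averaged against a narrow Gaussian.\<close>

lemma fourier_integral_gaussian_weighted:
  fixes h :: "'a::euclidean_space \<Rightarrow> complex"
  assumes h: "integrable lborel h" and h2: "integrable lborel (\<lambda>x. (cmod (h x))\<^sup>2)" and \<delta>: "\<delta> > 0"
  defines "\<gamma> \<equiv> \<lambda>v::'a. (2 * pi) powr (- real DIM('a) / 2) * exp (- (norm v)\<^sup>2 / 2)"
  shows "(LINT \<xi>|lborel. of_real ((cmod (\<F> h \<xi>))\<^sup>2 * exp (- (\<delta> * norm \<xi>)\<^sup>2 / 2)))
    = (LINT v|lborel. of_real (\<gamma> v) * (LINT x|lborel. h x * cnj (h (x + \<delta> *\<^sub>R v))))"
    and "integrable lborel (\<lambda>\<xi>. (cmod (\<F> h \<xi>))\<^sup>2 * exp (- (\<delta> * norm \<xi>)\<^sup>2 / 2))"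
proof -
  have hm[measurable]: "h \<in> borel_measurable borel" using h by auto
  have Fm[measurable]: "\<F> h \<in> borel_measurable borel"
    by (intro borel_measurable_fourier_integral lebesgue_measurable_borel hm)
  define c where "c = (2 * pi) powr (- real DIM('a) / 2)"
  define w where "w \<xi> = exp (- (\<delta> * norm \<xi>)\<^sup>2 / 2)" for \<xi> :: 'a
  have wint: "integrable lborel w"
    using integrable_norm[OF integrable_gaussian_scaled[OF \<delta>, of "0::'a"]]
    by (simp add: w_def[abs_def])
  have wm[measurable]: "w \<in> borel_measurable borel" unfolding w_def by measurable
  define B where "B = c * (LINT t|lebesgue. cmod (h t))"
  have B: "cmod (\<F> h \<xi>) \<le> B" for \<xi>
    unfolding B_def c_def by (rule cmod_fourier_integral_le)
  \<comment> \<open>Chosen so that \<open>\<F> h \<xi> * g \<xi>\<close> is the weighted square of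
    the modulus; the weight makes \<open>g\<close> integrable although \<open>\<F> h\<close> itself
    is only known to be bounded.\<close>
  define g where "g \<xi> = cnj (\<F> h \<xi>) * of_real (w \<xi>)" for \<xi>
  have gm[measurable]: "g \<in> borel_measurable borel" unfolding g_def by measurable
  have gint: "integrable lborel g"
  proof (rule integrable_bound)
    show "integrable lborel (\<lambda>\<xi>. B * w \<xi>)" using wint by simp
    show "AE x in lborel. norm (g x) \<le> norm (B * w x)"
      using B by (intro AE_I2) (auto simp: g_def norm_mult abs_mult w_def intro: order_trans[OF _ abs_ge_self])
  qed auto
  have "integrable lborel (\<lambda>\<xi>. (cmod (\<F> h \<xi>))\<^sup>2 * w \<xi>)"
  proof (rule integrable_bound)
    show "integrable lborel (\<lambda>\<xi>. B\<^sup>2 * w \<xi>)" using wint by simp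
    show "AE x in lborel. norm ((cmod (\<F> h x))\<^sup>2 * w x) \<le> norm (B\<^sup>2 * w x)"
      using B by (intro AE_I2) (auto simp: abs_mult w_def intro: power_mono)
  qed auto
  then show "integrable lborel (\<lambda>\<xi>. (cmod (\<F> h \<xi>))\<^sup>2 * exp (- (\<delta> * norm \<xi>)\<^sup>2 / 2))"
    by (simp add: w_def)
  \<comment> \<open>Second use of the multiplication formula: the transform of \<open>g\<close> is,
    up to conjugation, \<open>\<F> h\<close> tested against a modulated Gaussian, hence a local
    average of \<open>h\<close> at scale \<open>\<delta>\<close>.\<close>
  have inner: "\<F> g x = cnj (of_real c * (LINT v|lborel. h (x + \<delta> *\<^sub>R v) * of_real (exp (- (norm v)\<^sup>2 / 2))))" for x
  proof -
    define m where "m \<xi> = of_real (exp (- (\<delta> * norm \<xi>)\<^sup>2 / 2)) * iexp (\<xi> \<bullet> x)" for \<xi>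
    have mint: "integrable lborel m"
      using integrable_gaussian_scaled[OF \<delta>, of "- x"] by (simp add: m_def[abs_def])
    have "\<F> g x = of_real c * (LINT \<xi>|lborel. g \<xi> * niexp (x \<bullet> \<xi>))"
      by (simp add: fourier_integral_lborel c_def)
    also have "(\<lambda>\<xi>. g \<xi> * niexp (x \<bullet> \<xi>)) = (\<lambda>\<xi>. cnj (\<F> h \<xi> * m \<xi>))"
      by (simp add: g_def m_def w_def exp_cnj inner_commute mult_ac)
    also have "of_real c * (LINT \<xi>|lborel. cnj (\<F> h \<xi> * m \<xi>))
        = cnj (of_real c * (LINT \<xi>|lborel. \<F> h \<xi> * m \<xi>))"
      by (simp only: integral_cnj complex_cnj_mult[of "complex_of_real c"] complex_cnj_complex_of_real)
    also have "(LINT \<xi>|lborel. \<F> h \<xi> * m \<xi>) = (LINT y|lborel. h y * \<F> m y)"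
      by (rule fourier_multiplication_formula_lborel[OF h mint])
    also have "\<dots> = (LINT y|lborel. h y * of_real (exp (- (norm ((y - x) /\<^sub>R \<delta>))\<^sup>2 / 2) / \<delta> ^ DIM('a)))"
      unfolding m_def fourier_integral_gaussian_modulated[OF \<delta>] ..
    also have "\<dots> = (LINT v|lborel. h (x + \<delta> *\<^sub>R v) * of_real (exp (- (norm v)\<^sup>2 / 2)))"
      using \<delta> by (subst lborel_integral_affine[where c=\<delta> and t=x]) (auto simp: scaleR_conv_of_real)
    finally show ?thesis .
  qed
  define K where "K v x = of_real (\<gamma> v) * (h x * cnj (h (x + \<delta> *\<^sub>R v)))" for v x
  have ht2: "integrable lborel (\<lambda>x. (cmod (h (x + u)))\<^sup>2)" for u
    by (rule lborel_integrable_translate[OF h2])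
  have hh: "integrable lborel (\<lambda>x. h x * cnj (h (x + u)))" for u
    by (rule integrable_mult_square) (use h2 ht2 in auto)
  have \<gamma>int: "integrable lborel \<gamma>"
    using integrable_norm[OF integrable_gaussian[of "0::'a"]] by (simp add: \<gamma>_def)
  have \<gamma>m[measurable]: "\<gamma> \<in> borel_measurable borel" unfolding \<gamma>_def by measurable
  have K: "integrable (lborel \<Otimes>\<^sub>M lborel) (\<lambda>(v, x). K v x)"
  proof (rule lborel_pair.Fubini_integrable)
    show "(\<lambda>(x, t). K x t) \<in> borel_measurable (lborel \<Otimes>\<^sub>M lborel)" unfolding K_def by measurable
    \<comment> \<open>Cauchy-Schwarz and translation invariance bound the autocorrelation of
      \<open>cmod h\<close> by the squared norm, uniformly in \<open>v\<close>. Integrability over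
      the pair then rests on \<open>\<gamma>\<close> alone.\<close>
    have "cmod (LINT x|lborel. of_real (cmod (h x) * cmod (h (x + \<delta> *\<^sub>R v)))) \<le> (LINT x|lborel. (cmod (h x))\<^sup>2)" for v
      using Cauchy_Schwarz_integral[of "\<lambda>x. of_real (cmod (h x))" lborel "\<lambda>x. of_real (cmod (h (x + \<delta> *\<^sub>R v)))"]
        h2 ht2[of "\<delta> *\<^sub>R v"] lborel_integral_translate[of "\<lambda>x. (cmod (h x))\<^sup>2" "\<delta> *\<^sub>R v"]
      by simp
    then have bd: "\<bar>LINT x|lborel. cmod (h x) * cmod (h (x + \<delta> *\<^sub>R v))\<bar> \<le> (LINT x|lborel. (cmod (h x))\<^sup>2)" for v
      unfolding integral_complex_of_real by simp
    show "integrable lborel (\<lambda>x. LINT t|lborel. norm (case (x, t) of (x, t) \<Rightarrow> K x t))"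
    proof (rule integrable_bound)
      show "integrable lborel (\<lambda>v. (LINT x|lborel. (cmod (h x))\<^sup>2) * \<gamma> v)" using \<gamma>int by simp
      show "AE v in lborel. norm (LINT t|lborel. norm (case (v, t) of (x, t) \<Rightarrow> K x t)) \<le> norm ((LINT x|lborel. (cmod (h x))\<^sup>2) * \<gamma> v)"
        using bd by (intro AE_I2) (auto simp: K_def norm_mult abs_mult mult.commute intro!: mult_left_mono)
    qed (auto simp: K_def)
    show "AE x in lborel. integrable lborel (\<lambda>t. case (x, t) of (x, t) \<Rightarrow> K x t)"
      unfolding K_def using hh by (intro AE_I2) auto
  qed
  have "(LINT \<xi>|lborel. of_real ((cmod (\<F> h \<xi>))\<^sup>2 * exp (- (\<delta> * norm \<xi>)\<^sup>2 / 2)))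
     = (LINT \<xi>|lborel. \<F> h \<xi> * g \<xi>)"
    by (intro integral_cong refl)
       (simp add: g_def w_def complex_norm_square mult.assoc flip: of_real_power)
  also have "\<dots> = (LINT x|lborel. h x * \<F> g x)"
    by (rule fourier_multiplication_formula_lborel[OF h gint])
  also have "\<dots> = (LINT x|lborel. LINT v|lborel. K v x)"
  proof (intro integral_cong refl)
    fix x
    have "h x * \<F> g x = (h x * of_real c) * (LINT v|lborel. cnj (h (x + \<delta> *\<^sub>R v) * of_real (exp (- (norm v)\<^sup>2 / 2))))"
      unfolding inner integral_cnj by simp
    also have "\<dots> = (LINT v|lborel. (h x * of_real c) * cnj (h (x + \<delta> *\<^sub>R v) * of_real (exp (- (norm v)\<^sup>2 / 2))))"
      by (rule integral_mult_right_zero[symmetric])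
    also have "\<dots> = (LINT v|lborel. K v x)"
      by (simp add: K_def \<gamma>_def c_def mult_ac)
    finally show "h x * \<F> g x = (LINT v|lborel. K v x)" .
  qed
  also have "\<dots> = (LINT v|lborel. LINT x|lborel. K v x)"
    using lborel_pair.Fubini_integral[OF K] .
  also have "\<dots> = (LINT v|lborel. of_real (\<gamma> v) * (LINT x|lborel. h x * cnj (h (x + \<delta> *\<^sub>R v))))"
    by (simp add: K_def)
  finally show "(LINT \<xi>|lborel. of_real ((cmod (\<F> h \<xi>))\<^sup>2 * exp (- (\<delta> * norm \<xi>)\<^sup>2 / 2)))
    = (LINT v|lborel. of_real (\<gamma> v) * (LINT x|lborel. h x * cnj (h (x + \<delta> *\<^sub>R v))))" .
qed

text \<open>Let the width \<open>\<delta>\<close> tend to 0 in the weighted identity. The spatial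
  side tends to the autocorrelation \<open>C 0\<close> by dominated convergence, as \<open>C\<close>
  is continuous at 0 and \<open>\<gamma>\<close> has mass 1. The frequency side increases, and
  monotone convergence gives both integrability and the value.\<close>

lemma Plancherel_lborel:
  fixes h :: "'a::euclidean_space \<Rightarrow> complex"
  assumes h: "integrable lborel h" and h2: "integrable lborel (\<lambda>x. (cmod (h x))\<^sup>2)"
  shows "integrable lborel (\<lambda>\<xi>. (cmod (\<F> h \<xi>))\<^sup>2)"
    and "(LINT \<xi>|lborel. (cmod (\<F> h \<xi>))\<^sup>2) = (LINT x|lborel. (cmod (h x))\<^sup>2)"
proof -
  have hm[measurable]: "h \<in> borel_measurable borel" using h by auto
  have Fm[measurable]: "\<F> h \<in> borel_measurable borel"
    by (intro borel_measurable_fourier_integral lebesgue_measurable_borel hm)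
  define \<gamma> where "\<gamma> v = (2 * pi) powr (- real DIM('a) / 2) * exp (- (norm v)\<^sup>2 / 2)" for v :: 'a
  define C where "C u = (LINT x|lborel. h x * cnj (h (x + u)))" for u
  define N where "N = (LINT x|lborel. (cmod (h x))\<^sup>2)"
  define d where "d n = 1 / real (Suc n)" for n
  have dpos: "d n > 0" for n by (simp add: d_def)
  have dlim: "d \<longlonglongrightarrow> 0" unfolding d_def by (rule LIMSEQ_Suc[OF lim_1_over_n])
  have ht2: "integrable lborel (\<lambda>x. (cmod (h (x + u)))\<^sup>2)" for u
    by (rule lborel_integrable_translate[OF h2])
  have hh: "integrable lborel (\<lambda>x. h x * cnj (h (x + u)))" for u
    by (rule integrable_mult_square) (use h2 ht2 in auto)
  have \<gamma>m[measurable]: "\<gamma> \<in> borel_measurable borel" unfolding \<gamma>_def by measurable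
  have \<gamma>int: "integrable lborel \<gamma>"
    using integrable_norm[OF integrable_gaussian[of "0::'a"]] by (simp add: \<gamma>_def[abs_def])
  have "of_real (LINT v|lborel. \<gamma> v) = of_real ((2 * pi) powr (- real DIM('a) / 2) * (2 * pi) powr (real DIM('a) / 2))"
    using integral_gaussian[of "0::'a"] unfolding integral_complex_of_real[symmetric] by (simp add: \<gamma>_def)
  also have "\<dots> = 1" by (simp flip: powr_add)
  finally have \<gamma>1: "(LINT v|lborel. \<gamma> v) = 1" by simp
  have C0: "C 0 = of_real N"
    unfolding C_def N_def integral_complex_of_real[symmetric]
    by (simp only: complex_norm_square add_0_right)
  have hcm: "(\<lambda>x. cnj (h (x + u))) \<in> borel_measurable lborel" for u by measurable
  have Cb: "cmod (C u) \<le> N" for u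
    unfolding C_def N_def
    using Cauchy_Schwarz_integral[of h lborel, OF _ hcm[of u]] h2 ht2[of u]
      lborel_integral_translate[of "\<lambda>x. (cmod (h x))\<^sup>2" u] by simp
  have Cm[measurable]: "C \<in> borel_measurable borel" unfolding C_def by measurable
  have Cbound: "cmod (C u - C 0) \<le> sqrt N * sqrt (LINT x|lborel. (cmod (h (x + u) - h x))\<^sup>2)" for u
  proof -
    have m: "(\<lambda>x. cnj (h (x + u) - h x)) \<in> borel_measurable lborel" by measurable
    have "C u - C 0 = (LINT x|lborel. h x * cnj (h (x + u) - h x))"
      using hh[of u] hh[of 0] by (simp add: C_def algebra_simps)
    then show ?thesis
      unfolding N_def
      using Cauchy_Schwarz_integral[of h lborel, OF _ m] h2 integrable_cmod_diff_square[of "\<lambda>x. h (x + u)" lborel h] ht2[of u]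
      by (simp flip: complex_cnj_diff)
  qed
  have "((\<lambda>u. C u - C 0) \<longlongrightarrow> 0) (nhds 0)"
  proof (rule Lim_null_comparison)
    show "\<forall>\<^sub>F u in nhds 0. norm (C u - C 0) \<le> sqrt N * sqrt (LINT x|lborel. (cmod (h (x + u) - h x))\<^sup>2)"
      using Cbound by simp
    show "((\<lambda>u. sqrt N * sqrt (LINT x|lborel. (cmod (h (x + u) - h x))\<^sup>2)) \<longlongrightarrow> 0) (nhds 0)"
      using tendsto_mult[OF tendsto_const[of "sqrt N"] tendsto_real_sqrt[OF L2_translation_continuous[OF hm h2]]] by simp
  qed
  then have Ccont: "(C \<longlongrightarrow> C 0) (nhds 0)" by (simp add: LIM_zero_iff)
  have lim: "(\<lambda>n. LINT v|lborel. of_real (\<gamma> v) * C (d n *\<^sub>R v)) \<longlonglongrightarrow> (LINT v|lborel. of_real (\<gamma> v) * C 0)"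
  proof (rule integral_dominated_convergence[where w="\<lambda>v. N * \<gamma> v"])
    show "AE v in lborel. (\<lambda>n. of_real (\<gamma> v) * C (d n *\<^sub>R v)) \<longlonglongrightarrow> of_real (\<gamma> v) * C 0"
    proof (intro AE_I2 tendsto_mult tendsto_const)
      fix v :: 'a
      have "(\<lambda>n. d n *\<^sub>R v) \<longlonglongrightarrow> 0" using tendsto_scaleR[OF dlim tendsto_const[of v]] by simp
      then show "(\<lambda>n. C (d n *\<^sub>R v)) \<longlonglongrightarrow> C 0" by (rule filterlim_compose[OF Ccont])
    qed
    show "AE v in lborel. norm (of_real (\<gamma> v) * C (d n *\<^sub>R v)) \<le> N * \<gamma> v" for n
    proof (rule AE_I2)
      fix v
      have "0 \<le> \<gamma> v" by (simp add: \<gamma>_def)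
      then show "norm (complex_of_real (\<gamma> v) * C (d n *\<^sub>R v)) \<le> N * \<gamma> v"
        using mult_left_mono[OF Cb[of "d n *\<^sub>R v"], of "\<gamma> v"] by (simp add: norm_mult mult.commute)
    qed
  qed (use \<gamma>int in auto)
  define A where "A n \<xi> = (cmod (\<F> h \<xi>))\<^sup>2 * exp (- (d n * norm \<xi>)\<^sup>2 / 2)" for n \<xi>
  have Aint: "integrable lborel (A n)" for n
    unfolding A_def by (rule fourier_integral_gaussian_weighted(2)[OF h h2 dpos])
  have "complex_of_real (LINT \<xi>|lborel. A n \<xi>) = (LINT v|lborel. complex_of_real (\<gamma> v) * C (d n *\<^sub>R v))" for n
    unfolding A_def integral_complex_of_real[symmetric] C_def \<gamma>_def
    by (rule fourier_integral_gaussian_weighted(1)[OF h h2 dpos])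
  moreover have "(LINT v|lborel. complex_of_real (\<gamma> v) * C 0) = complex_of_real N"
    using \<gamma>1 C0 integral_complex_of_real[of lborel \<gamma>] by simp
  ultimately have "(\<lambda>n. complex_of_real (LINT \<xi>|lborel. A n \<xi>)) \<longlonglongrightarrow> complex_of_real N" using lim by simp
  then have Alim: "(\<lambda>n. LINT \<xi>|lborel. A n \<xi>) \<longlonglongrightarrow> N"
    by (simp only: tendsto_of_real_iff)
  have mono: "AE \<xi> in lborel. mono (\<lambda>n. A n \<xi>)"
  proof (intro AE_I2 monoI)
    fix \<xi> :: 'a and m n :: nat assume "m \<le> n"
    then have "(d n * norm \<xi>)\<^sup>2 \<le> (d m * norm \<xi>)\<^sup>2"
      by (intro power_mono mult_right_mono) (auto simp: d_def field_simps)
    then show "A m \<xi> \<le> A n \<xi>" unfolding A_def by (intro mult_left_mono) auto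
  qed
  have conv: "AE \<xi> in lborel. (\<lambda>n. A n \<xi>) \<longlonglongrightarrow> (cmod (\<F> h \<xi>))\<^sup>2"
  proof (intro AE_I2)
    fix \<xi> :: 'a
    have "(\<lambda>n. (cmod (\<F> h \<xi>))\<^sup>2 * exp (- (d n * norm \<xi>)\<^sup>2 / 2))
        \<longlonglongrightarrow> (cmod (\<F> h \<xi>))\<^sup>2 * exp (- (0 * norm \<xi>)\<^sup>2 / 2)"
      by (intro tendsto_intros dlim) auto
    then show "(\<lambda>n. A n \<xi>) \<longlonglongrightarrow> (cmod (\<F> h \<xi>))\<^sup>2" by (simp add: A_def)
  qed
  show "integrable lborel (\<lambda>\<xi>. (cmod (\<F> h \<xi>))\<^sup>2)"
    by (rule integrable_monotone_convergence[OF Aint mono conv Alim]) measurable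
  show "(LINT \<xi>|lborel. (cmod (\<F> h \<xi>))\<^sup>2) = (LINT x|lborel. (cmod (h x))\<^sup>2)"
    using integral_monotone_convergence[OF Aint mono conv Alim] by (simp add: N_def)
qed

section \<open>The inner product space and Fourier inversion\<close>

lemma L2_measurable [measurable_dest]: "f \<in> L2 \<Longrightarrow> f \<in> borel_measurable lebesgue"
  by (simp add: L2_def)

lemma L2_integrable_square: "f \<in> L2 \<Longrightarrow> integrable lebesgue (\<lambda>x. (cmod (f x))\<^sup>2)"
  by (simp add: L2_def)

lemma L2I: "f \<in> borel_measurable lebesgue \<Longrightarrow> integrable lebesgue (\<lambda>x. (cmod (f x))\<^sup>2) \<Longrightarrow> f \<in> L2"
  by (simp add: L2_def)

lemma L2_dominated:
  assumes "f \<in> L2" "g \<in> borel_measurable lebesgue" "\<And>x. cmod (g x) \<le> cmod (f x)"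
  shows "g \<in> L2"
proof (rule L2I)
  show "integrable lebesgue (\<lambda>x. (cmod (g x))\<^sup>2)"
    by (rule integrable_bound[OF L2_integrable_square[OF assms(1)]])
      (use assms(2,3) in \<open>auto intro!: AE_I2 power_mono\<close>)
qed fact

lemma L2_diff: "f \<in> L2 \<Longrightarrow> g \<in> L2 \<Longrightarrow> (\<lambda>x. f x - g x) \<in> L2"
  by (rule L2I) (auto intro: integrable_cmod_diff_square L2_measurable L2_integrable_square)

lemma L2_scale: "f \<in> L2 \<Longrightarrow> (\<lambda>x. c * f x) \<in> L2"
  by (rule L2I) (auto simp: norm_mult power_mult_distrib intro: L2_measurable L2_integrable_square)

lemma L2_add: "f \<in> L2 \<Longrightarrow> g \<in> L2 \<Longrightarrow> (\<lambda>x. f x + g x) \<in> L2"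
  using L2_diff[of f "\<lambda>x. (-1) * g x"] L2_scale[of g "-1"] by simp

lemma L2_zero: "(\<lambda>x. 0) \<in> L2"
  by (rule L2I) auto

lemma L2_sum: "(\<And>i. i \<in> I \<Longrightarrow> f i \<in> L2) \<Longrightarrow> (\<lambda>x. \<Sum>i\<in>I. f i x) \<in> L2"
  by (induction I rule: infinite_finite_induct) (auto simp: L2_zero intro: L2_add)

lemma L2_integrable_inner: "f \<in> L2 \<Longrightarrow> g \<in> L2 \<Longrightarrow> integrable lebesgue (\<lambda>x. f x * cnj (g x))"
  by (rule integrable_mult_square) (auto intro: L2_measurable L2_integrable_square)

lemma L2_inner_add_left:
  "f \<in> L2 \<Longrightarrow> g \<in> L2 \<Longrightarrow> k \<in> L2 \<Longrightarrow> L2_inner (\<lambda>x. f x + g x) k = L2_inner f k + L2_inner g k"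
  by (simp add: L2_inner_def ring_distribs L2_integrable_inner)

lemma L2_inner_scale_left: "L2_inner (\<lambda>x. c * f x) k = c * L2_inner f k"
  by (simp add: L2_inner_def mult.assoc)

lemma L2_inner_commute: "L2_inner g f = cnj (L2_inner f g)"
  unfolding L2_inner_def integral_cnj[symmetric] by (simp add: mult.commute)

lemma L2_inner_add_right:
  "f \<in> L2 \<Longrightarrow> g \<in> L2 \<Longrightarrow> k \<in> L2 \<Longrightarrow> L2_inner k (\<lambda>x. f x + g x) = L2_inner k f + L2_inner k g"
  using L2_inner_add_left[of f g k] L2_inner_commute[of k] by simp

lemma L2_inner_scale_right: "L2_inner k (\<lambda>x. c * f x) = cnj c * L2_inner k f"
  using L2_inner_scale_left[of c f k] L2_inner_commute[of k] by simp

lemma L2_inner_sum_left: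
  "(\<And>i. i \<in> I \<Longrightarrow> f i \<in> L2) \<Longrightarrow> k \<in> L2 \<Longrightarrow> L2_inner (\<lambda>x. \<Sum>i\<in>I. f i x) k = (\<Sum>i\<in>I. L2_inner (f i) k)"
  by (simp add: L2_inner_def sum_distrib_right L2_integrable_inner)

lemma L2_inner_self: "L2_inner f f = of_real (LINT x|lebesgue. (cmod (f x))\<^sup>2)"
  unfolding L2_inner_def integral_complex_of_real[symmetric] by (simp only: complex_norm_square)

lemma L2_norm_nonneg: "L2_norm f \<ge> 0"
  by (simp add: L2_norm_def)

lemma L2_norm_square: "(L2_norm f)\<^sup>2 = (LINT x|lebesgue. (cmod (f x))\<^sup>2)"
  by (simp add: L2_norm_def)

lemma L2_inner_eq_norm: "L2_inner f f = of_real ((L2_norm f)\<^sup>2)"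
  by (simp add: L2_inner_self L2_norm_square)

lemma L2_Cauchy_Schwarz:
  "f \<in> L2 \<Longrightarrow> g \<in> L2 \<Longrightarrow> cmod (L2_inner f g) \<le> L2_norm f * L2_norm g"
  using Cauchy_Schwarz_integral[of f lebesgue "\<lambda>x. cnj (g x)"]
  by (simp add: L2_inner_def L2_norm_def L2_measurable L2_integrable_square)

lemma L2_norm_square_add:
  assumes "f \<in> L2" "g \<in> L2"
  shows "(L2_norm (\<lambda>x. f x + g x))\<^sup>2 = (L2_norm f)\<^sup>2 + (L2_norm g)\<^sup>2 + 2 * Re (L2_inner f g)"
proof -
  have "of_real ((L2_norm (\<lambda>x. f x + g x))\<^sup>2)
      = L2_inner f f + L2_inner g g + (L2_inner f g + cnj (L2_inner f g))"
    using assms L2_inner_commute[of g f]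
    unfolding L2_inner_eq_norm[symmetric] by (simp add: L2_inner_add_left L2_inner_add_right L2_add)
  also have "\<dots> = of_real ((L2_norm f)\<^sup>2 + (L2_norm g)\<^sup>2 + 2 * Re (L2_inner f g))"
    by (simp add: L2_inner_eq_norm complex_add_cnj)
  finally show ?thesis by (simp only: of_real_eq_iff)
qed

lemma L2_norm_scale: "L2_norm (\<lambda>x. c * f x) = cmod c * L2_norm f"
  by (simp add: L2_norm_def norm_mult power_mult_distrib real_sqrt_mult)

lemma L2_norm_minus_commute: "L2_norm (\<lambda>x. f x - g x) = L2_norm (\<lambda>x. g x - f x)"
  by (simp add: L2_norm_def norm_minus_commute)

lemma L2_norm_square_diff:
  assumes "f \<in> L2" "g \<in> L2"
  shows "(L2_norm (\<lambda>x. f x - g x))\<^sup>2 = (L2_norm f)\<^sup>2 + (L2_norm g)\<^sup>2 - 2 * Re (L2_inner f g)"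
  using L2_norm_square_add[OF assms(1) L2_scale[OF assms(2), of "-1"]]
    L2_norm_scale[of "-1" g] L2_inner_scale_right[of f "-1" g]
  by simp

lemma L2_norm_triangle:
  assumes "f \<in> L2" "g \<in> L2"
  shows "L2_norm (\<lambda>x. f x + g x) \<le> L2_norm f + L2_norm g"
proof (rule power2_le_imp_le)
  have "Re (L2_inner f g) \<le> L2_norm f * L2_norm g"
    using L2_Cauchy_Schwarz[OF assms] complex_Re_le_cmod order_trans by blast
  then show "(L2_norm (\<lambda>x. f x + g x))\<^sup>2 \<le> (L2_norm f + L2_norm g)\<^sup>2"
    unfolding L2_norm_square_add[OF assms] power2_sum by linarith
  show "0 \<le> L2_norm f + L2_norm g" using L2_norm_nonneg[of f] L2_norm_nonneg[of g] by simp
qed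

lemma L2_norm_triangle_diff:
  assumes "f \<in> L2" "g \<in> L2" "k \<in> L2"
  shows "L2_norm (\<lambda>x. f x - g x) \<le> L2_norm (\<lambda>x. f x - k x) + L2_norm (\<lambda>x. k x - g x)"
  using L2_norm_triangle[OF L2_diff[OF assms(1,3)] L2_diff[OF assms(3,2)]] by simp

lemma L2_norm_cong_AE:
  assumes "f \<in> borel_measurable lebesgue" "g \<in> borel_measurable lebesgue" "AE x in lebesgue. f x = g x"
  shows "L2_norm f = L2_norm g"
  unfolding L2_norm_def using assms by (intro arg_cong[where f=sqrt] integral_cong_AE) auto

lemma L2_norm_eq_0_AE:
  assumes "f \<in> L2" "L2_norm f = 0"
  shows "AE x in lebesgue. f x = 0"
  using integral_nonneg_eq_0_iff_AE[OF L2_integrable_square[OF assms(1)]] assms(2)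
  by (simp add: L2_norm_def)

text \<open>Nonnegativity of the squared distance from \<open>u\<close> to its orthogonal projection
  \<open>s\<close> onto the span.\<close>

lemma Bessel_inequality:
  assumes on: "L2_orthonormal n f" and u: "u \<in> L2"
  shows "(\<Sum>i<n. (cmod (L2_inner (f i) u))\<^sup>2) \<le> (L2_norm u)\<^sup>2"
proof -
  have f: "f i \<in> L2" if "i < n" for i using on that by (simp add: L2_orthonormal_def)
  have ff: "L2_inner (f i) (f j) = (if i = j then 1 else 0)" if "i < n" "j < n" for i j
    using on that by (simp add: L2_orthonormal_def)
  \<comment> \<open>\<open>L2_inner\<close> is linear in its first argument, so the coefficient of
    \<open>u\<close> along \<open>f i\<close> is the conjugate of
    \<open>L2_inner (f i) u\<close>.\<close>
  define b where "b i = cnj (L2_inner (f i) u)" for i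
  define s where "s x = (\<Sum>i<n. b i * f i x)" for x
  have s: "s \<in> L2" unfolding s_def[abs_def] using f by (intro L2_sum L2_scale) auto
  have sk: "L2_inner s k = (\<Sum>i<n. b i * L2_inner (f i) k)" if "k \<in> L2" for k
    unfolding s_def[abs_def] using f that by (subst L2_inner_sum_left) (auto intro: L2_scale simp: L2_inner_scale_left)
  define S where "S = (\<Sum>i<n. (cmod (L2_inner (f i) u))\<^sup>2)"
  have su: "L2_inner s u = of_real S"
    unfolding sk[OF u] S_def by (simp add: b_def complex_norm_square mult.commute del: of_real_power)
  have "L2_inner (f i) s = cnj (b i)" if i: "i < n" for i
  proof -
    have "L2_inner (f i) s = cnj (\<Sum>j<n. b j * L2_inner (f j) (f i))"
      unfolding sk[OF f[OF i], symmetric] by (rule L2_inner_commute)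
    also have "(\<Sum>j<n. b j * L2_inner (f j) (f i)) = (\<Sum>j<n. if j = i then b j else 0)"
      using i by (intro sum.cong) (auto simp: ff)
    also have "\<dots> = b i" using i by simp
    finally show ?thesis .
  qed
  then have ss: "L2_inner s s = of_real S"
    unfolding sk[OF s] S_def by (simp add: b_def complex_norm_square mult.commute del: of_real_power)
  have "0 \<le> (L2_norm (\<lambda>x. s x - u x))\<^sup>2" by simp
  also have "\<dots> = S + (L2_norm u)\<^sup>2 - 2 * S"
    using L2_norm_square_diff[OF s u] su ss L2_inner_eq_norm[of s] by (simp only: of_real_eq_iff Re_complex_of_real)
  finally show ?thesis by (simp add: S_def)
qed

lemma Plancherel:
  assumes f: "integrable lebesgue f" "f \<in> L2"
  shows "\<F> f \<in> L2" and "L2_norm (\<F> f) = L2_norm f"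
proof -
  obtain g where g[measurable]: "g \<in> borel_measurable borel" "AE x in lebesgue. f x = g x"
    using borel_representative[OF L2_measurable[OF f(2)]] .
  have gm: "g \<in> borel_measurable lebesgue" by (rule lebesgue_measurable_borel) fact
  have F: "\<F> f = \<F> g"
    by (rule fourier_integral_cong_AE) (use f gm g(2) in \<open>auto intro: L2_measurable\<close>)
  have "integrable lebesgue g"
    using integrable_cong_AE_imp[OF f(1) gm] g(2) by (auto simp: eq_commute)
  then have g1: "integrable lborel g" by (simp add: integrable_completion)
  have "integrable lebesgue (\<lambda>x. (cmod (g x))\<^sup>2)"
    by (rule integrable_cong_AE_imp[OF L2_integrable_square[OF f(2)]])
       (use g(2) gm in auto)
  then have g2: "integrable lborel (\<lambda>x. (cmod (g x))\<^sup>2)" by (simp add: integrable_completion)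
  have Fm[measurable]: "\<F> g \<in> borel_measurable borel"
    by (rule borel_measurable_fourier_integral[OF gm])
  show "\<F> f \<in> L2"
    unfolding F using Plancherel_lborel(1)[OF g1 g2]
    by (intro L2I lebesgue_measurable_borel Fm) (simp add: integrable_completion)
  have "L2_norm (\<F> g) = L2_norm g"
    using Plancherel_lborel(2)[OF g1 g2] by (simp add: L2_norm_def integral_completion)
  also have "\<dots> = L2_norm f"
    by (rule L2_norm_cong_AE) (use f gm g(2) in \<open>auto intro: L2_measurable\<close>)
  finally show "L2_norm (\<F> f) = L2_norm f" unfolding F .
qed

lemma fourier_multiplication_formula:
  assumes f: "integrable lebesgue f" and g: "integrable lebesgue g"
  shows "(LINT x|lebesgue. \<F> f x * g x) = (LINT x|lebesgue. f x * \<F> g x)"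
proof -
  have fm: "f \<in> borel_measurable lebesgue" and gm: "g \<in> borel_measurable lebesgue" using f g by auto
  obtain f' where f'[measurable]: "f' \<in> borel_measurable borel" "AE x in lebesgue. f x = f' x"
    using borel_representative[OF fm] .
  obtain g' where g'[measurable]: "g' \<in> borel_measurable borel" "AE x in lebesgue. g x = g' x"
    using borel_representative[OF gm] .
  have f'm: "f' \<in> borel_measurable lebesgue" and g'm: "g' \<in> borel_measurable lebesgue"
    by (rule lebesgue_measurable_borel, fact)+
  have F: "\<F> f = \<F> f'" "\<F> g = \<F> g'"
    by (rule fourier_integral_cong_AE; use fm gm f'm g'm f' g' in auto)+
  have Fm[measurable]: "\<F> f' \<in> borel_measurable borel" "\<F> g' \<in> borel_measurable borel"
    using borel_measurable_fourier_integral f'm g'm by auto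
  then have Fm': "\<F> f' \<in> borel_measurable lebesgue" "\<F> g' \<in> borel_measurable lebesgue"
    by (simp_all add: lebesgue_measurable_borel)
  have int: "integrable lborel f'" "integrable lborel g'"
    using integrable_cong_AE_imp[OF f f'm] integrable_cong_AE_imp[OF g g'm] f'(2) g'(2)
    by (auto simp: integrable_completion eq_commute)
  have "(LINT x|lebesgue. \<F> f x * g x) = (LINT x|lebesgue. \<F> f' x * g' x)"
    unfolding F using g'(2) gm g'm Fm' by (intro integral_cong_AE borel_measurable_times) auto
  also have "\<dots> = (LINT x|lborel. \<F> f' x * g' x)"
    by (rule integral_completion) measurable
  also have "\<dots> = (LINT x|lborel. f' x * \<F> g' x)"
    by (rule fourier_multiplication_formula_lborel[OF int])
  also have "\<dots> = (LINT x|lebesgue. f' x * \<F> g' x)"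
    by (rule integral_completion[symmetric]) measurable
  also have "\<dots> = (LINT x|lebesgue. f x * \<F> g x)"
    unfolding F using f'(2) fm f'm Fm' by (intro integral_cong_AE borel_measurable_times) auto
  finally show ?thesis .
qed

lemma borel_measurable_lebesgue_fourier_kernel:
  "(\<lambda>t::'a::euclidean_space. niexp (\<xi> \<bullet> t)) \<in> borel_measurable lebesgue"
  by (rule lebesgue_measurable_borel) measurable

lemma integrable_fourier_kernel:
  assumes "integrable lebesgue f"
  shows "integrable lebesgue (\<lambda>t. f t * niexp (\<xi> \<bullet> t))"
  by (rule integrable_mult_unimodular[OF assms borel_measurable_lebesgue_fourier_kernel]) simp

lemma fourier_integral_add:
  assumes "integrable lebesgue f" "integrable lebesgue g"
  shows "\<F> (\<lambda>x. f x + g x) \<xi> = \<F> f \<xi> + \<F> g \<xi>"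
  using integrable_fourier_kernel[OF assms(1), of \<xi>] integrable_fourier_kernel[OF assms(2), of \<xi>]
  by (simp add: fourier_integral_def ring_distribs)

lemma fourier_integral_scale: "\<F> (\<lambda>x. c * f x) \<xi> = c * \<F> f \<xi>"
  by (simp add: fourier_integral_def mult.assoc)

lemma fourier_integral_diff:
  assumes "integrable lebesgue f" "integrable lebesgue g"
  shows "\<F> (\<lambda>x. f x - g x) \<xi> = \<F> f \<xi> - \<F> g \<xi>"
  using fourier_integral_add[OF assms(1), of "\<lambda>x. (-1) * g x" \<xi>] assms(2) fourier_integral_scale[of "-1" g \<xi>]
  by simp

lemma fourier_integral_cnj: "\<F> (\<lambda>x. cnj (f x)) \<xi> = cnj (\<F> f (- \<xi>))"
proof -
  have "cnj (LINT t|lebesgue. f t * exp (- \<i> * of_real (- \<xi> \<bullet> t)))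
      = (LINT t|lebesgue. cnj (f t * exp (- \<i> * of_real (- \<xi> \<bullet> t))))"
    by (rule integral_cnj[symmetric])
  then show ?thesis by (simp add: fourier_integral_def exp_cnj)
qed

lemma fourier_integral_modulate:
  "\<F> (\<lambda>t. f t * iexp (a \<bullet> t)) \<xi> = \<F> f (\<xi> - a)"
proof -
  have "iexp (a \<bullet> t) * exp (- \<i> * of_real (\<xi> \<bullet> t))
      = exp (- \<i> * of_real ((\<xi> - a) \<bullet> t))" for t
    by (simp only: exp_add[symmetric]) (simp add: inner_diff_left algebra_simps)
  then show ?thesis by (simp only: fourier_integral_def mult.assoc)
qed

section \<open>The Fourier transform as a closed graph\<close>

text \<open>Plancherel for the approximants, passed to the limit. With \<open>f = f'\<close> or
  \<open>g = g'\<close> it shows that a partner in the graph is unique almost everywhere, which is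
  what makes the choices in \<open>fourier\<close> and \<open>inv_fourier\<close> harmless.\<close>

lemma fourier_graph_isometric:
  assumes "fourier_graph f g" "fourier_graph f' g'"
  shows "L2_norm (\<lambda>x. g x - g' x) = L2_norm (\<lambda>x. f x - f' x)"
proof -
  from assms(1) obtain h where h: "f \<in> L2" "g \<in> L2" "\<And>n. integrable lebesgue (h n)" "\<And>n. h n \<in> L2"
      "\<And>n. \<F> (h n) \<in> L2" "(\<lambda>n. L2_norm (\<lambda>x. h n x - f x)) \<longlonglongrightarrow> 0"
      "(\<lambda>n. L2_norm (\<lambda>\<xi>. \<F> (h n) \<xi> - g \<xi>)) \<longlonglongrightarrow> 0"
    unfolding fourier_graph_def by blast
  from assms(2) obtain h' where h': "f' \<in> L2" "g' \<in> L2" "\<And>n. integrable lebesgue (h' n)" "\<And>n. h' n \<in> L2"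
      "\<And>n. \<F> (h' n) \<in> L2" "(\<lambda>n. L2_norm (\<lambda>x. h' n x - f' x)) \<longlonglongrightarrow> 0"
      "(\<lambda>n. L2_norm (\<lambda>\<xi>. \<F> (h' n) \<xi> - g' \<xi>)) \<longlonglongrightarrow> 0"
    unfolding fourier_graph_def by blast
  have iso: "L2_norm (\<lambda>\<xi>. \<F> (h n) \<xi> - \<F> (h' n) \<xi>) = L2_norm (\<lambda>x. h n x - h' n x)" for n
  proof -
    have "\<F> (\<lambda>x. h n x - h' n x) = (\<lambda>\<xi>. \<F> (h n) \<xi> - \<F> (h' n) \<xi>)"
      by (rule ext) (rule fourier_integral_diff[OF h(3) h'(3)])
    then show ?thesis
      using Plancherel(2)[of "\<lambda>x. h n x - h' n x"] h(3,4)[of n] h'(3,4)[of n] by (simp add: L2_diff)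
  qed
  define e where "e n = L2_norm (\<lambda>x. h n x - f x) + L2_norm (\<lambda>\<xi>. \<F> (h n) \<xi> - g \<xi>)
     + (L2_norm (\<lambda>x. h' n x - f' x) + L2_norm (\<lambda>\<xi>. \<F> (h' n) \<xi> - g' \<xi>))" for n
  have e: "e \<longlonglongrightarrow> 0"
    using tendsto_add[OF tendsto_add[OF h(6,7)] tendsto_add[OF h'(6,7)]] by (simp add: e_def[abs_def])
  have 1: "L2_norm (\<lambda>x. g x - g' x) \<le> L2_norm (\<lambda>x. f x - f' x) + e n" for n
    using L2_norm_triangle_diff[of g g' "\<F> (h n)"] L2_norm_triangle_diff[of "\<F> (h n)" g' "\<F> (h' n)"]
      L2_norm_triangle_diff[of "h n" "h' n" f] L2_norm_triangle_diff[of f "h' n" f'] iso[of n] h h'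
      L2_norm_minus_commute[of g "\<F> (h n)"] L2_norm_minus_commute[of "f'" "h' n"]
    by (simp add: e_def)
  have 2: "L2_norm (\<lambda>x. f x - f' x) \<le> L2_norm (\<lambda>x. g x - g' x) + e n" for n
    using L2_norm_triangle_diff[of f f' "h n"] L2_norm_triangle_diff[of "h n" f' "h' n"]
      L2_norm_triangle_diff[of "\<F> (h n)" "\<F> (h' n)" g]
      L2_norm_triangle_diff[of g "\<F> (h' n)" g'] iso[of n] h h'
      L2_norm_minus_commute[of f "h n"] L2_norm_minus_commute[of g' "\<F> (h' n)"]
    by (simp add: e_def)
  show ?thesis
  proof (rule antisym)
    show "L2_norm (\<lambda>x. g x - g' x) \<le> L2_norm (\<lambda>x. f x - f' x)"
      using LIMSEQ_le_const[OF tendsto_add[OF tendsto_const e]] 1 by force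
    show "L2_norm (\<lambda>x. f x - f' x) \<le> L2_norm (\<lambda>x. g x - g' x)"
      using LIMSEQ_le_const[OF tendsto_add[OF tendsto_const e]] 2 by force
  qed
qed

lemma fourier_graph_fourier_integral:
  assumes "integrable lebesgue f" "f \<in> L2"
  shows "fourier_graph f (\<F> f)"
  using assms Plancherel[OF assms] unfolding fourier_graph_def
  by (auto intro!: exI[of _ "\<lambda>_. f"] simp: L2_norm_def)

text \<open>\<open>\<F> f\<close> witnesses that a partner of \<open>f\<close> exists, so the chosen
  \<open>fourier f\<close> lies in the graph, and isometry identifies the two almost
  everywhere.\<close>

lemma fourier_eq_fourier_integral:
  assumes "integrable lebesgue f" "f \<in> L2"
  shows "fourier f \<in> L2" and "AE \<xi> in lebesgue. fourier f \<xi> = \<F> f \<xi>"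
proof -
  have g: "fourier_graph f (\<F> f)" by (rule fourier_graph_fourier_integral[OF assms])
  then have g': "fourier_graph f (fourier f)" unfolding fourier_def by (rule someI[where P="fourier_graph f"])
  then show L: "fourier f \<in> L2" by (simp add: fourier_graph_def)
  have "L2_norm (\<lambda>\<xi>. fourier f \<xi> - \<F> f \<xi>) = 0"
    using fourier_graph_isometric[OF g' g] by (simp add: L2_norm_def)
  from L2_norm_eq_0_AE[OF L2_diff[OF L Plancherel(1)[OF assms]] this]
  show "AE \<xi> in lebesgue. fourier f \<xi> = \<F> f \<xi>" by simp
qed

lemma fourier_graph_cong_AE:
  assumes "fourier_graph f g" "g' \<in> borel_measurable lebesgue" "AE x in lebesgue. g x = g' x"
  shows "fourier_graph f g'"
proof -
  from assms(1) obtain h where h: "f \<in> L2" "g \<in> L2" "\<And>n. integrable lebesgue (h n)" "\<And>n. h n \<in> L2"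
      "\<And>n. \<F> (h n) \<in> L2" "(\<lambda>n. L2_norm (\<lambda>x. h n x - f x)) \<longlonglongrightarrow> 0"
      "(\<lambda>n. L2_norm (\<lambda>\<xi>. \<F> (h n) \<xi> - g \<xi>)) \<longlonglongrightarrow> 0"
    unfolding fourier_graph_def by blast
  have gm: "g \<in> borel_measurable lebesgue" using h(2) by (rule L2_measurable)
  have "L2_norm (\<lambda>\<xi>. \<F> (h n) \<xi> - g \<xi>) = L2_norm (\<lambda>\<xi>. \<F> (h n) \<xi> - g' \<xi>)" for n
    by (rule L2_norm_cong_AE) (use gm assms L2_measurable[OF h(5)[of n]] in auto)
  moreover have "g' \<in> L2"
    by (rule L2I[OF assms(2) integrable_cong_AE_imp[OF L2_integrable_square[OF h(2)]]])
      (use assms in auto)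
  ultimately show ?thesis using h unfolding fourier_graph_def by (intro conjI exI[of _ h]) auto
qed

text \<open>The inverse kernel is the conjugate kernel, so the inverse transform is the reflected
  forward transform and inherits its estimates.\<close>

definition inv_fourier_integral :: "('a::euclidean_space \<Rightarrow> complex) \<Rightarrow> 'a \<Rightarrow> complex" where
  "inv_fourier_integral g x = \<F> g (- x)"

lemma lebesgue_integral_uminus:
  fixes f :: "'a::euclidean_space \<Rightarrow> 'b::{banach, second_countable_topology}"
  assumes "f \<in> borel_measurable borel"
  shows "integrable lebesgue (\<lambda>x. f (- x)) \<longleftrightarrow> integrable lebesgue f"
    and "(LINT x|lebesgue. f (- x)) = (LINT x|lebesgue. f x)"
proof -
  have [measurable]: "f \<in> borel_measurable borel" by fact
  have "integrable lborel (\<lambda>x. f (- x)) \<longleftrightarrow> integrable lborel f"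
    using lborel_integrable_affine[of f "-1" 0] lborel_integrable_affine[of "\<lambda>x. f (- x)" "-1" 0] by auto
  then show "integrable lebesgue (\<lambda>x. f (- x)) \<longleftrightarrow> integrable lebesgue f"
    by (simp add: integrable_completion)
  show "(LINT x|lebesgue. f (- x)) = (LINT x|lebesgue. f x)"
    using lborel_integral_affine[of "-1" f 0] by (simp add: integral_completion)
qed

lemma borel_measurable_inv_fourier_integral:
  "f \<in> borel_measurable lebesgue \<Longrightarrow> inv_fourier_integral f \<in> borel_measurable borel"
  unfolding inv_fourier_integral_def[abs_def]
  by (rule measurable_compose[OF _ borel_measurable_fourier_integral]) auto

lemma inv_fourier_integral_L2:
  assumes g: "integrable lebesgue g" "g \<in> L2"
  shows "inv_fourier_integral g \<in> L2" and "L2_norm (inv_fourier_integral g) = L2_norm g"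
proof -
  have m: "(\<lambda>x. (cmod (\<F> g x))\<^sup>2) \<in> borel_measurable borel"
    using borel_measurable_fourier_integral[OF L2_measurable[OF g(2)]] by measurable
  show "inv_fourier_integral g \<in> L2"
    using lebesgue_integral_uminus(1)[OF m] L2_integrable_square[OF Plancherel(1)[OF g]]
      lebesgue_measurable_borel[OF borel_measurable_inv_fourier_integral[OF L2_measurable[OF g(2)]]]
    by (intro L2I) (auto simp: inv_fourier_integral_def)
  show "L2_norm (inv_fourier_integral g) = L2_norm g"
    using lebesgue_integral_uminus(2)[OF m] Plancherel(2)[OF g]
    by (simp add: inv_fourier_integral_def L2_norm_def)
qed

lemma fourier_integral_cnj_eq_inv: "\<F> (\<lambda>x. cnj (g x)) x = cnj (inv_fourier_integral g x)"
  by (simp add: fourier_integral_cnj inv_fourier_integral_def)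

text \<open>Fourier inversion in the weak form needed here. The function \<open>\<phi>\<close> need
  not be integrable, so it is damped by widening Gaussians; the damped \<open>h n\<close> tend to
  \<open>\<phi>\<close>, and it remains to see that their transforms tend to
  \<open>g\<close>.\<close>

lemma fourier_graph_inv_fourier_integral:
  fixes g :: "'a::euclidean_space \<Rightarrow> complex"
  assumes g: "integrable lebesgue g" "g \<in> L2"
  shows "fourier_graph (inv_fourier_integral g) g"
proof -
  define \<phi> where "\<phi> = inv_fourier_integral g"
  define w where "w n x = exp (- (norm x / real (Suc n))\<^sup>2 / 2)" for n and x :: 'a
  define h where "h n x = of_real (w n x) * \<phi> x" for n x
  have \<phi>: "\<phi> \<in> L2" "L2_norm \<phi> = L2_norm g"
    unfolding \<phi>_def using inv_fourier_integral_L2[OF g] by auto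
  have \<phi>m[measurable]: "\<phi> \<in> borel_measurable borel"
    unfolding \<phi>_def using borel_measurable_inv_fourier_integral[OF L2_measurable[OF g(2)]] .
  have wm[measurable]: "w n \<in> borel_measurable borel" for n unfolding w_def by measurable
  have w01: "0 \<le> w n x" "w n x \<le> 1" for n x by (auto simp: w_def)
  have wint: "integrable lebesgue (w n)" for n
    using integrable_norm[OF integrable_gaussian_scaled[of "1 / real (Suc n)" "0::'a"]]
    by (simp add: w_def[abs_def] integrable_completion)
  define B where "B = (2 * pi) powr (- real DIM('a) / 2) * (LINT t|lebesgue. cmod (g t))"
  have B: "cmod (\<phi> x) \<le> B" for x
    unfolding B_def \<phi>_def inv_fourier_integral_def by (rule cmod_fourier_integral_le)
  have B0: "0 \<le> B" using B[of 0] norm_ge_zero order_trans by blast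
  have hm: "h n \<in> borel_measurable lebesgue" for n
    unfolding h_def[abs_def] by (rule lebesgue_measurable_borel) measurable
  have h1: "integrable lebesgue (h n)" for n
  proof (rule integrable_bound[OF integrable_mult_right[OF wint[of n]] hm])
    show "AE x in lebesgue. norm (h n x) \<le> norm (B * w n x)"
      using B B0 w01(1)[of n]
      by (intro AE_I2) (auto simp: h_def norm_mult abs_mult mult.commute intro!: mult_mono)
  qed
  have h2: "h n \<in> L2" for n
  proof (rule L2_dominated[OF \<phi>(1) hm])
    show "cmod (h n x) \<le> cmod (\<phi> x)" for x
      using w01[of n x] by (simp add: h_def norm_mult mult_left_le_one_le)
  qed
  have conv: "(\<lambda>n. LINT x|lebesgue. (cmod (h n x - \<phi> x))\<^sup>2) \<longlonglongrightarrow> (LINT x|(lebesgue :: 'a measure). 0)"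
  proof (rule integral_dominated_convergence[where w="\<lambda>x. (cmod (\<phi> x))\<^sup>2"])
    have diff: "h n x - \<phi> x = of_real (w n x - 1) * \<phi> x" for n x
      by (simp add: h_def algebra_simps)
    show "AE x in lebesgue. (\<lambda>n. (cmod (h n x - \<phi> x))\<^sup>2) \<longlonglongrightarrow> 0"
    proof (rule AE_I2)
      fix x :: 'a
      have "(\<lambda>n. norm x * (1 / real (Suc n))) \<longlonglongrightarrow> norm x * 0"
        by (intro tendsto_intros LIMSEQ_Suc[OF lim_1_over_n])
      then have "(\<lambda>n. norm x / real (Suc n)) \<longlonglongrightarrow> 0" by simp
      then have "(\<lambda>n. w n x) \<longlonglongrightarrow> exp (- 0\<^sup>2 / 2)"
        unfolding w_def by (intro tendsto_intros) auto
      then have "(\<lambda>n. (cmod (of_real (w n x - 1) * \<phi> x))\<^sup>2) \<longlonglongrightarrow> (cmod (of_real (1 - 1) * \<phi> x))\<^sup>2"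
        by (intro tendsto_intros) simp
      then show "(\<lambda>n. (cmod (h n x - \<phi> x))\<^sup>2) \<longlonglongrightarrow> 0" by (simp add: diff)
    qed
    show "AE x in lebesgue. norm ((cmod (h n x - \<phi> x))\<^sup>2) \<le> (cmod (\<phi> x))\<^sup>2" for n
    proof (intro AE_I2)
      fix x
      have "\<bar>w n x - 1\<bar> \<le> 1" using w01[of n x] by auto
      then have "\<bar>w n x - 1\<bar> * cmod (\<phi> x) \<le> cmod (\<phi> x)" by (intro mult_left_le_one_le) auto
      then show "norm ((cmod (h n x - \<phi> x))\<^sup>2) \<le> (cmod (\<phi> x))\<^sup>2"
        unfolding diff norm_mult norm_of_real by (simp add: power_mono)
    qed
  qed (use L2_integrable_square[OF \<phi>(1)] L2_measurable[OF L2_diff[OF h2 \<phi>(1)]] in auto)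
  then have conv1: "(\<lambda>n. L2_norm (\<lambda>x. h n x - \<phi> x)) \<longlonglongrightarrow> 0"
    using tendsto_real_sqrt[OF conv] by (simp add: L2_norm_def)
  \<comment> \<open>No pointwise inversion is needed: Plancherel matches the norms, the
    multiplication formula matches the inner products, so the two distances agree when their squares
    are expanded.\<close>
  have "L2_norm (\<lambda>\<xi>. \<F> (h n) \<xi> - g \<xi>) = L2_norm (\<lambda>x. h n x - \<phi> x)" for n
  proof -
    have "L2_inner (\<F> (h n)) g = (LINT x|lebesgue. h n x * \<F> (\<lambda>x. cnj (g x)) x)"
      unfolding L2_inner_def using g by (intro fourier_multiplication_formula h1) auto
    also have "\<dots> = L2_inner (h n) \<phi>"
      unfolding L2_inner_def \<phi>_def fourier_integral_cnj_eq_inv ..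
    finally have "(L2_norm (\<lambda>\<xi>. \<F> (h n) \<xi> - g \<xi>))\<^sup>2 = (L2_norm (\<lambda>x. h n x - \<phi> x))\<^sup>2"
      using Plancherel[OF h1[of n] h2[of n]] g h2[of n] \<phi> by (simp add: L2_norm_square_diff)
    then show ?thesis using L2_norm_nonneg power2_eq_imp_eq by blast
  qed
  with conv1 show ?thesis
    unfolding fourier_graph_def \<phi>_def[symmetric] using \<phi>(1) g(2) h1 h2 Plancherel(1)[OF h1 h2]
    by (auto intro!: exI[of _ h])
qed

section \<open>The localization operator\<close>

lemma indicator_lebesgue_measurable:
  "A \<in> sets lebesgue \<Longrightarrow> (\<lambda>x. indicator A x :: complex) \<in> borel_measurable lebesgue"
  by (rule borel_measurable_indicator)

lemma time_proj_L2:
  assumes "A \<in> sets lebesgue" "f \<in> L2"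
  shows "time_proj A f \<in> L2"
proof (rule L2_dominated[OF assms(2)])
  show "time_proj A f \<in> borel_measurable lebesgue"
    unfolding time_proj_def
    by (intro borel_measurable_times indicator_lebesgue_measurable L2_measurable assms)
  show "cmod (time_proj A f x) \<le> cmod (f x)" for x
    by (auto simp: time_proj_def indicator_def)
qed

lemma integrable_indicator_lmeasurable:
  "A \<in> lmeasurable \<Longrightarrow> integrable lebesgue (indicator A :: 'a::euclidean_space \<Rightarrow> real)"
  by (rule integrable_real_indicator) (auto simp: fmeasurable_def)

lemma indicator_L2:
  assumes "A \<in> lmeasurable"
  shows "(\<lambda>x. indicator A x) \<in> L2"
proof (rule L2I)
  have "(\<lambda>x. (cmod (indicator A x))\<^sup>2) = (indicator A :: 'a \<Rightarrow> real)"
    by (auto simp: indicator_def)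
  then show "integrable lebesgue (\<lambda>x. (cmod (indicator A x))\<^sup>2)"
    using integrable_indicator_lmeasurable[OF assms] by simp
qed (use assms in \<open>auto intro: indicator_lebesgue_measurable\<close>)

lemma time_proj_integrable:
  assumes "A \<in> lmeasurable" "f \<in> L2"
  shows "integrable lebesgue (time_proj A f)"
  unfolding time_proj_def
  by (rule integrable_mult_square)
    (use assms indicator_L2[OF assms(1)] in \<open>auto intro: L2_measurable L2_integrable_square\<close>)

lemma L2_norm_time_proj_split:
  assumes "A \<in> sets lebesgue" "f \<in> L2"
  shows "(L2_norm f)\<^sup>2 = (L2_norm (time_proj A f))\<^sup>2 + (L2_norm (time_proj (- A) f))\<^sup>2"
proof -
  have A': "- A \<in> sets lebesgue" using assms(1) by (simp add: Compl_in_sets_lebesgue)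
  have "(cmod (f x))\<^sup>2 = (cmod (time_proj A f x))\<^sup>2 + (cmod (time_proj (- A) f x))\<^sup>2" for x
    by (auto simp: time_proj_def indicator_def)
  then show ?thesis
    using L2_integrable_square[OF time_proj_L2[OF assms]] L2_integrable_square[OF time_proj_L2[OF A' assms(2)]]
    by (simp add: L2_norm_square)
qed

text \<open>The frequency side of B D f. For \<open>A\<close> of finite measure the truncated
  function is integrable, so the Fourier integral can be used in place of the chosen
  transform.\<close>

definition band_part :: "'a::euclidean_space set \<Rightarrow> 'a set \<Rightarrow> ('a \<Rightarrow> complex) \<Rightarrow> 'a \<Rightarrow> complex" where
  "band_part A \<Omega> f = time_proj \<Omega> (\<F> (time_proj A f))"

text \<open>An explicit representative of B D f: it is defined at every point and, for finite
  measures, is linear in \<open>f\<close> pointwise and not just almost everywhere.\<close>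

definition band_fun :: "'a::euclidean_space set \<Rightarrow> 'a set \<Rightarrow> ('a \<Rightarrow> complex) \<Rightarrow> 'a \<Rightarrow> complex" where
  "band_fun A \<Omega> f = inv_fourier_integral (band_part A \<Omega> f)"

definition loc_defect :: "'a::euclidean_space set \<Rightarrow> 'a set \<Rightarrow> ('a \<Rightarrow> complex) \<Rightarrow> 'a \<Rightarrow> complex" where
  "loc_defect A \<Omega> f = (\<lambda>x. time_proj A (band_fun A \<Omega> f) x - f x)"

lemma band_part_L2:
  assumes "A \<in> lmeasurable" "\<Omega> \<in> lmeasurable" "f \<in> L2"
  shows "integrable lebesgue (band_part A \<Omega> f)" "band_part A \<Omega> f \<in> L2"
  unfolding band_part_def using assms
  by (auto intro!: time_proj_integrable time_proj_L2 Plancherel(1) dest: fmeasurableD)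

lemma band_fun_L2:
  assumes "A \<in> lmeasurable" "\<Omega> \<in> lmeasurable" "f \<in> L2"
  shows "band_fun A \<Omega> f \<in> L2" "L2_norm (band_fun A \<Omega> f) = L2_norm (band_part A \<Omega> f)"
  unfolding band_fun_def using inv_fourier_integral_L2 band_part_L2[OF assms] by auto

lemma loc_defect_L2:
  assumes "A \<in> lmeasurable" "\<Omega> \<in> lmeasurable" "f \<in> L2"
  shows "loc_defect A \<Omega> f \<in> L2"
  unfolding loc_defect_def using assms
  by (auto intro!: L2_diff time_proj_L2 band_fun_L2 dest: fmeasurableD)

text \<open>Removes both choice operators from the norm that \<open>eta\<close> tests. Inversion
  shows that the explicit function is a preimage in the graph, and isometry shows that the chosen
  preimage agrees with it almost everywhere.\<close>

lemma L2_norm_loc_op_defect: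
  assumes A: "A \<in> lmeasurable" and \<Omega>: "\<Omega> \<in> lmeasurable" and f: "f \<in> L2"
  shows "L2_norm (\<lambda>x. loc_op A \<Omega> f x - f x) = L2_norm (loc_defect A \<Omega> f)"
proof -
  define h where "h = time_proj A f"
  have h: "integrable lebesgue h" "h \<in> L2"
    unfolding h_def using A f by (auto intro: time_proj_integrable time_proj_L2 dest: fmeasurableD)
  define G where "G = band_part A \<Omega> f"
  \<comment> \<open>The function to which \<open>inv_fourier\<close> is really applied. It contains
    the chosen \<open>fourier h\<close> and so agrees with \<open>G\<close> only almost everywhere,
    hence the transfer of the graph relation below.\<close>
  define G' where "G' = (\<lambda>\<xi>. indicator \<Omega> \<xi> * fourier h \<xi>)"
  note Fh = fourier_eq_fourier_integral[OF h]
  have "G' \<in> borel_measurable lebesgue"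
    unfolding G'_def
    by (intro borel_measurable_times indicator_lebesgue_measurable L2_measurable Fh fmeasurableD \<Omega>)
  moreover have "AE \<xi> in lebesgue. G \<xi> = G' \<xi>"
    using Fh(2) by eventually_elim (simp add: G_def G'_def band_part_def time_proj_def[of \<Omega>] h_def)
  moreover have "fourier_graph (band_fun A \<Omega> f) G"
    unfolding band_fun_def G_def by (rule fourier_graph_inv_fourier_integral[OF band_part_L2[OF A \<Omega> f]])
  ultimately have g: "fourier_graph (band_fun A \<Omega> f) G'" by (metis fourier_graph_cong_AE)
  then have g': "fourier_graph (inv_fourier G') G'"
    unfolding inv_fourier_def by (rule someI[where P="\<lambda>f. fourier_graph f G'"])
  have bL: "inv_fourier G' \<in> L2" using g' by (simp add: fourier_graph_def)
  have "L2_norm (\<lambda>x. inv_fourier G' x - band_fun A \<Omega> f x) = 0"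
    using fourier_graph_isometric[OF g' g] by (simp add: L2_norm_def)
  from L2_norm_eq_0_AE[OF L2_diff[OF bL band_fun_L2(1)[OF assms]] this]
  have ae: "AE x in lebesgue. inv_fourier G' x = band_fun A \<Omega> f x" by simp
  have op: "loc_op A \<Omega> f = time_proj A (inv_fourier G')"
    by (simp add: loc_op_def band_proj_def G'_def h_def)
  show ?thesis
  proof (rule L2_norm_cong_AE)
    show "(\<lambda>x. loc_op A \<Omega> f x - f x) \<in> borel_measurable lebesgue"
      unfolding op using A f bL by (intro L2_measurable L2_diff time_proj_L2) (auto dest: fmeasurableD)
    show "loc_defect A \<Omega> f \<in> borel_measurable lebesgue"
      by (intro L2_measurable loc_defect_L2 assms)
    show "AE x in lebesgue. loc_op A \<Omega> f x - f x = loc_defect A \<Omega> f x"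
      using ae by eventually_elim (simp add: op loc_defect_def time_proj_def)
  qed
qed

text \<open>The multiplication formula gives the inner product of \<open>f\<close> with P f as the
  squared norm of B D f. Expanding the square of P f - f and splitting B D f into its parts inside
  and outside \<open>A\<close> leaves exactly these terms.\<close>

lemma L2_norm_loc_defect:
  assumes A: "A \<in> lmeasurable" and \<Omega>: "\<Omega> \<in> lmeasurable" and f: "f \<in> L2"
  shows "(L2_norm (loc_defect A \<Omega> f))\<^sup>2 = (L2_norm f)\<^sup>2 - (L2_norm (band_part A \<Omega> f))\<^sup>2
    - (L2_norm (time_proj (- A) (band_fun A \<Omega> f)))\<^sup>2"
proof -
  define h where "h = time_proj A f"
  have h: "integrable lebesgue h" "h \<in> L2"
    unfolding h_def using A f by (auto intro: time_proj_integrable time_proj_L2 dest: fmeasurableD)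
  define G where "G = band_part A \<Omega> f"
  define \<phi> where "\<phi> = band_fun A \<Omega> f"
  note G = band_part_L2[OF A \<Omega> f, folded G_def]
  note \<phi> = band_fun_L2[OF A \<Omega> f, folded G_def \<phi>_def]
  have Al: "A \<in> sets lebesgue" using A by auto
  have "L2_inner f (time_proj A \<phi>) = (LINT x|lebesgue. h x * \<F> (\<lambda>x. cnj (G x)) x)"
    unfolding L2_inner_def fourier_integral_cnj_eq_inv
    by (intro integral_cong refl)
       (auto simp: h_def \<phi>_def band_fun_def G_def time_proj_def indicator_def)
  also have "\<dots> = (LINT x|lebesgue. \<F> h x * cnj (G x))"
    using fourier_multiplication_formula[OF h(1), of "\<lambda>x. cnj (G x)"] G(1) by simp
  also have "\<dots> = L2_inner G G"
    unfolding L2_inner_def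
    by (intro integral_cong refl)
       (auto simp: G_def band_part_def h_def time_proj_def indicator_def)
  finally have "L2_inner f (time_proj A \<phi>) = of_real ((L2_norm G)\<^sup>2)"
    by (simp only: L2_inner_eq_norm)
  then have "Re (L2_inner (time_proj A \<phi>) f) = (L2_norm G)\<^sup>2"
    using L2_inner_commute[of "time_proj A \<phi>" f] by (simp del: of_real_power)
  then have "(L2_norm (loc_defect A \<Omega> f))\<^sup>2 = (L2_norm (time_proj A \<phi>))\<^sup>2 + (L2_norm f)\<^sup>2 - 2 * (L2_norm G)\<^sup>2"
    unfolding loc_defect_def \<phi>_def[symmetric]
    using L2_norm_square_diff[OF time_proj_L2[OF Al \<phi>(1)] f] by simp
  moreover have "(L2_norm (time_proj A \<phi>))\<^sup>2 = (L2_norm G)\<^sup>2 - (L2_norm (time_proj (- A) \<phi>))\<^sup>2"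
    using L2_norm_time_proj_split[OF Al \<phi>(1)] \<phi>(2) by simp
  ultimately show ?thesis by (simp add: G_def \<phi>_def)
qed

section \<open>From average defect to individual defects\<close>

lemma loc_defect_linear:
  assumes A: "A \<in> lmeasurable" and \<Omega>: "\<Omega> \<in> lmeasurable" and f: "f \<in> L2" and g: "g \<in> L2"
  shows "loc_defect A \<Omega> (\<lambda>x. c * f x + d * g x) x = c * loc_defect A \<Omega> f x + d * loc_defect A \<Omega> g x"
proof -
  have 1: "time_proj A (\<lambda>x. c * f x + d * g x) = (\<lambda>x. c * time_proj A f x + d * time_proj A g x)"
    by (auto simp: time_proj_def algebra_simps)
  have "\<F> (\<lambda>x. c * time_proj A f x + d * time_proj A g x) \<xi>
      = c * \<F> (time_proj A f) \<xi> + d * \<F> (time_proj A g) \<xi>" for \<xi>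
    using time_proj_integrable[OF A f] time_proj_integrable[OF A g]
    by (subst fourier_integral_add) (auto simp: fourier_integral_scale)
  then have 2: "band_part A \<Omega> (\<lambda>x. c * f x + d * g x) = (\<lambda>\<xi>. c * band_part A \<Omega> f \<xi> + d * band_part A \<Omega> g \<xi>)"
    unfolding band_part_def 1 by (auto simp: time_proj_def algebra_simps)
  have "band_fun A \<Omega> (\<lambda>x. c * f x + d * g x) x = c * band_fun A \<Omega> f x + d * band_fun A \<Omega> g x" for x
    unfolding band_fun_def 2 inv_fourier_integral_def
    using band_part_L2(1)[OF A \<Omega> f] band_part_L2(1)[OF A \<Omega> g]
    by (subst fourier_integral_add) (auto simp: fourier_integral_scale)
  then show ?thesis by (simp add: loc_defect_def time_proj_def algebra_simps)
qed

text \<open>Provides the quadratic-form hypothesis of \<open>orthonormal_equalize\<close>. Real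
  coefficients are enough because only real rotations are used.\<close>

lemma loc_defect_quadratic:
  assumes A: "A \<in> lmeasurable" and \<Omega>: "\<Omega> \<in> lmeasurable" and f: "f \<in> L2" and g: "g \<in> L2"
  shows "(L2_norm (loc_defect A \<Omega> (\<lambda>x. of_real c * f x + of_real d * g x)))\<^sup>2
    = c\<^sup>2 * (L2_norm (loc_defect A \<Omega> f))\<^sup>2 + d\<^sup>2 * (L2_norm (loc_defect A \<Omega> g))\<^sup>2
      + c * d * (2 * Re (L2_inner (loc_defect A \<Omega> f) (loc_defect A \<Omega> g)))"
proof -
  have "loc_defect A \<Omega> (\<lambda>x. of_real c * f x + of_real d * g x)
     = (\<lambda>x. of_real c * loc_defect A \<Omega> f x + of_real d * loc_defect A \<Omega> g x)"
    by (rule ext) (rule loc_defect_linear[OF assms])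
  then show ?thesis
    using L2_scale[OF loc_defect_L2[OF A \<Omega> f], of "of_real c"] L2_scale[OF loc_defect_L2[OF A \<Omega> g], of "of_real d"]
    by (simp add: L2_norm_square_add L2_norm_scale power_mult_distrib L2_inner_scale_left L2_inner_scale_right)
qed

text \<open>Two family members whose values of \<open>q\<close> lie on different sides of \<open>\<epsilon>\<close> can be rotated within
  their plane so that one of them attains \<open>\<epsilon>\<close> exactly; a rotation does not change the sum of \<open>q\<close>.\<close>

lemma orthonormal_equalize:
  fixes q :: "('a::euclidean_space \<Rightarrow> complex) \<Rightarrow> real"
  assumes quad: "\<And>f g c d. f \<in> L2 \<Longrightarrow> g \<in> L2 \<Longrightarrow>
      q (\<lambda>x. of_real c * f x + of_real d * g x) = c\<^sup>2 * q f + d\<^sup>2 * q g + c * d * b f g"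
    and "L2_orthonormal n f" and "(\<Sum>i<n. q (f i)) \<le> real n * \<epsilon>"
  shows "\<exists>f'. L2_orthonormal n f' \<and> (\<forall>i<n. q (f' i) \<le> \<epsilon>)"
  using assms(2,3)
\<comment> \<open>The induction counts the members whose value differs from
  \<open>\<epsilon>\<close>; every rotation lowers this number.\<close>
proof (induction "card {i. i < n \<and> q (f i) \<noteq> \<epsilon>}" arbitrary: f rule: less_induct)
  case less
  show ?case
  proof (cases "\<forall>i<n. q (f i) \<le> \<epsilon>")
    case True
    with less.prems show ?thesis by blast
  next
    case False
    then obtain i where i: "i < n" "q (f i) > \<epsilon>" by (auto simp: not_le)
    \<comment> \<open>Otherwise all values are at least \<open>\<epsilon>\<close> and one exceeds
      it, which contradicts the bound on the sum.\<close>
    have "\<exists>j<n. q (f j) < \<epsilon>"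
    proof (rule ccontr)
      assume "\<not> (\<exists>j<n. q (f j) < \<epsilon>)"
      then have "\<forall>k<n. \<epsilon> \<le> q (f k)" by (meson not_less)
      then have "(\<Sum>i<n. \<epsilon>) < (\<Sum>i<n. q (f i))"
        using i by (intro sum_strict_mono_ex1) auto
      with less.prems(2) show False by simp
    qed
    then obtain j where j: "j < n" "q (f j) < \<epsilon>" by blast
    have ij: "i \<noteq> j" using i j by auto
    have fL: "f i \<in> L2" "f j \<in> L2" using less.prems(1) i j by (auto simp: L2_orthonormal_def)
    have ff: "L2_inner (f k) (f l) = (if k = l then 1 else 0)" if "k < n" "l < n" for k l
      using less.prems(1) that by (simp add: L2_orthonormal_def)
    define v where "v t x = of_real (cos t) * f i x + of_real (sin t) * f j x" for t x
    define w where "w t x = of_real (- sin t) * f i x + of_real (cos t) * f j x" for t x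
    have qv: "q (v t) = (cos t)\<^sup>2 * q (f i) + (sin t)\<^sup>2 * q (f j) + cos t * sin t * b (f i) (f j)" for t
      unfolding v_def[abs_def] by (rule quad[OF fL])
    have qw: "q (w t) = (sin t)\<^sup>2 * q (f i) + (cos t)\<^sup>2 * q (f j) - cos t * sin t * b (f i) (f j)" for t
      using quad[OF fL, of "- sin t" "cos t"] unfolding w_def[abs_def] by simp
    \<comment> \<open>The rotation runs from \<open>f i\<close> at \<open>t = 0\<close>, with value
      above \<open>\<epsilon>\<close>, to \<open>f j\<close> at \<open>t = pi / 2\<close>, with
      value below it.\<close>
    have "\<exists>t\<ge>0. t \<le> pi / 2 \<and> q (v t) = \<epsilon>"
      unfolding qv using i j by (intro IVT2) (auto intro!: continuous_intros)
    then obtain t where t: "q (v t) = \<epsilon>" by blast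
    have "q (v t) + q (w t) = ((cos t)\<^sup>2 + (sin t)\<^sup>2) * (q (f i) + q (f j))"
      unfolding qv qw by (simp only: ring_distribs)
    then have qsum: "q (v t) + q (w t) = q (f i) + q (f j)" by simp
    define f' where "f' = f(i := v t, j := w t)"
    have f': "f' i = v t" "f' j = w t" "\<And>k. k \<noteq> i \<Longrightarrow> k \<noteq> j \<Longrightarrow> f' k = f k"
      using ij by (auto simp: f'_def)
    have vL: "v t \<in> L2" and wL: "w t \<in> L2"
      unfolding v_def[abs_def] w_def[abs_def] by (intro L2_add L2_scale fL)+
    have inner: "L2_inner (\<lambda>x. of_real a * f i x + of_real a' * f j x) g
        = of_real a * L2_inner (f i) g + of_real a' * L2_inner (f j) g" if "g \<in> L2" for a a' g
      using fL that by (simp add: L2_inner_add_left L2_inner_scale_left L2_scale)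
    have inner': "L2_inner g (\<lambda>x. of_real a * f i x + of_real a' * f j x)
        = of_real a * L2_inner g (f i) + of_real a' * L2_inner g (f j)" if "g \<in> L2" for a a' g
      using fL that by (simp add: L2_inner_add_right L2_inner_scale_right L2_scale)
    have sc: "of_real (cos t) * of_real (cos t) + of_real (sin t) * of_real (sin t) = 1"
    proof -
      have "cos t * cos t + sin t * sin t = 1" by (simp flip: power2_eq_square)
      then show ?thesis by (metis of_real_1 of_real_add of_real_mult)
    qed
    have vf: "L2_inner (v t) (f k) = (if k = i then of_real (cos t) else if k = j then of_real (sin t) else 0)"
        "L2_inner (w t) (f k) = (if k = i then of_real (- sin t) else if k = j then of_real (cos t) else 0)"
      if "k < n" for k
    proof -
      have fk: "f k \<in> L2" using less.prems(1) that by (simp add: L2_orthonormal_def)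
      show "L2_inner (v t) (f k) = (if k = i then of_real (cos t) else if k = j then of_real (sin t) else 0)"
        "L2_inner (w t) (f k) = (if k = i then of_real (- sin t) else if k = j then of_real (cos t) else 0)"
        unfolding v_def[abs_def] w_def[abs_def] inner[OF fk]
        using ff[OF i(1) that] ff[OF j(1) that] ij by auto
    qed
    have gv: "L2_inner g (v t) = of_real (cos t) * L2_inner g (f i) + of_real (sin t) * L2_inner g (f j)"
      and gw: "L2_inner g (w t) = of_real (- sin t) * L2_inner g (f i) + of_real (cos t) * L2_inner g (f j)"
      if "g \<in> L2" for g
      unfolding v_def[abs_def] w_def[abs_def] by (rule inner'[OF that])+
    have vw: "L2_inner (v t) (v t) = 1" "L2_inner (w t) (w t) = 1" "L2_inner (v t) (w t) = 0"
      unfolding gv[OF vL] gw[OF vL] gw[OF wL] vf[OF i(1)] vf[OF j(1)]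
      using ij sc by (auto simp: mult.commute add.commute)
    have "L2_orthonormal n f'"
      unfolding L2_orthonormal_def
    proof (intro conjI allI impI)
      fix k assume "k < n"
      then show "f' k \<in> L2" using vL wL less.prems(1) by (auto simp: f'_def L2_orthonormal_def)
    next
      fix k l assume kl: "k < n" "l < n"
      have sym: "L2_inner (f l) (v t) = cnj (L2_inner (v t) (f l))" "L2_inner (f l) (w t) = cnj (L2_inner (w t) (f l))"
         "L2_inner (w t) (v t) = cnj (L2_inner (v t) (w t))" for l
        by (rule L2_inner_commute)+
      show "L2_inner (f' k) (f' l) = (if k = l then 1 else 0)"
        using kl vf vw ff ij sym by (cases "k = i"; cases "k = j"; cases "l = i"; cases "l = j") (auto simp: f')
    qed
    moreover have "(\<Sum>k<n. q (f' k)) \<le> real n * \<epsilon>"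
    proof -
      have split: "(\<Sum>k<n. g k) = g i + g j + (\<Sum>k\<in>{..<n} - {i, j}. g k)" for g :: "nat \<Rightarrow> real"
        using sum.subset_diff[of "{i, j}" "{..<n}" g] i j ij by simp
      have "(\<Sum>k<n. q (f' k)) = (\<Sum>k<n. q (f k))"
        unfolding split using qsum by (simp add: f')
      with less.prems(2) show ?thesis by simp
    qed
    moreover have "card {k. k < n \<and> q (f' k) \<noteq> \<epsilon>} < card {k. k < n \<and> q (f k) \<noteq> \<epsilon>}"
    proof (rule psubset_card_mono)
      \<comment> \<open>Index \<open>i\<close> leaves the set. Index \<open>j\<close> was in it
        already, so whatever value the rotated member \<open>w t\<close> has cannot enlarge
        it.\<close>
      show "{k. k < n \<and> q (f' k) \<noteq> \<epsilon>} \<subset> {k. k < n \<and> q (f k) \<noteq> \<epsilon>}"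
      proof (intro psubsetI subsetI)
        fix k assume "k \<in> {k. k < n \<and> q (f' k) \<noteq> \<epsilon>}"
        then show "k \<in> {k. k < n \<and> q (f k) \<noteq> \<epsilon>}"
          using f' t j(2) by (cases "k = i"; cases "k = j") auto
      next
        have "i \<in> {k. k < n \<and> q (f k) \<noteq> \<epsilon>}" "i \<notin> {k. k < n \<and> q (f' k) \<noteq> \<epsilon>}"
          using i f'(1) t by auto
        then show "{k. k < n \<and> q (f' k) \<noteq> \<epsilon>} \<noteq> {k. k < n \<and> q (f k) \<noteq> \<epsilon>}" by blast
      qed
    qed auto
    ultimately show ?thesis using less.hyps by blast
  qed
qed

text \<open>Only the average defect has to be small. This is what allows functions of defect up to 1
  to be counted along with good ones.\<close>

lemma eta_ge:
  assumes A: "A \<in> lmeasurable" and \<Omega>: "\<Omega> \<in> lmeasurable"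
    and on: "L2_orthonormal n f" and sum: "(\<Sum>i<n. (L2_norm (loc_defect A \<Omega> (f i)))\<^sup>2) \<le> real n * \<epsilon>"
  shows "enat n \<le> eta \<epsilon> A \<Omega>"
proof -
  obtain f' where f': "L2_orthonormal n f'" "\<And>i. i < n \<Longrightarrow> (L2_norm (loc_defect A \<Omega> (f' i)))\<^sup>2 \<le> \<epsilon>"
    using orthonormal_equalize[of "\<lambda>f. (L2_norm (loc_defect A \<Omega> f))\<^sup>2", OF loc_defect_quadratic[OF A \<Omega>] on sum]
    by blast
  have "(L2_norm (\<lambda>x. loc_op A \<Omega> (f' i) x - f' i x))\<^sup>2 \<le> \<epsilon>" if "i < n" for i
    using f' that L2_norm_loc_op_defect[OF A \<Omega>] by (simp add: L2_orthonormal_def)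
  with f'(1) show ?thesis unfolding eta_def by (intro Sup_upper) blast
qed

lemma fourier_const_square:
  "((2 * pi) powr (- real d / 2))\<^sup>2 = 1 / (2 * pi) ^ d"
proof -
  have "((2 * pi) powr (- real d / 2))\<^sup>2 = (2 * pi) powr (- real d)"
    by (simp add: power2_eq_square flip: powr_add)
  also have "\<dots> = 1 / (2 * pi) ^ d"
    by (simp add: powr_minus powr_realpow inverse_eq_divide)
  finally show ?thesis .
qed

text \<open>At a fixed frequency the transforms of the truncated \<open>f i\<close> are their inner
  products with one function, the exponential \<open>u \<xi>\<close> cut off to \<open>A\<close>,
  whose squared norm is the measure of \<open>A\<close> over \<open>(2 * pi) ^ DIM('a)\<close>.
  Bessel's inequality holds for each \<open>\<xi>\<close> and is then integrated over
  \<open>\<Omega>\<close>.\<close>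

lemma sum_band_part_le:
  fixes A \<Omega> :: "'a::euclidean_space set"
  assumes A: "A \<in> lmeasurable" and \<Omega>: "\<Omega> \<in> lmeasurable" and on: "L2_orthonormal n f"
  shows "(\<Sum>i<n. (L2_norm (band_part A \<Omega> (f i)))\<^sup>2) \<le> measure lebesgue A * measure lebesgue \<Omega> / (2 * pi) ^ DIM('a)"
proof -
  have f: "f i \<in> L2" if "i < n" for i using on that by (simp add: L2_orthonormal_def)
  define c where "c = (2 * pi) powr (- real DIM('a) / 2)"
  define u where "u \<xi> t = of_real c * iexp (\<xi> \<bullet> t) * indicator A t" for \<xi> t :: 'a
  have um: "u \<xi> \<in> borel_measurable lebesgue" for \<xi>
  proof -
    have m: "(\<lambda>t. of_real c * iexp (\<xi> \<bullet> t)) \<in> borel_measurable lebesgue"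
      by (rule lebesgue_measurable_borel) measurable
    show ?thesis unfolding u_def[abs_def]
      by (rule borel_measurable_times[OF m indicator_lebesgue_measurable[OF fmeasurableD[OF A]]])
  qed
  have us: "(cmod (u \<xi> t))\<^sup>2 = c\<^sup>2 * indicator A t" for \<xi> t
    by (auto simp: u_def norm_mult indicator_def)
  have uL: "u \<xi> \<in> L2" for \<xi>
    using um by (rule L2I) (use integrable_indicator_lmeasurable[OF A] in \<open>simp add: us\<close>)
  have un: "(L2_norm (u \<xi>))\<^sup>2 = c\<^sup>2 * measure lebesgue A" for \<xi>
    using A by (simp add: L2_norm_square us)
  have F: "\<F> (time_proj A (f i)) \<xi> = L2_inner (f i) (u \<xi>)" if "i < n" for i \<xi>
  proof -
    have "L2_inner (f i) (u \<xi>) = (LINT t|lebesgue. of_real c * (time_proj A (f i) t * exp (- \<i> * of_real (\<xi> \<bullet> t))))"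
      unfolding L2_inner_def
      by (intro integral_cong) (auto simp: u_def time_proj_def exp_cnj indicator_def)
    also have "\<dots> = \<F> (time_proj A (f i)) \<xi>"
      unfolding fourier_integral_def c_def by (rule integral_mult_right_zero)
    finally show ?thesis ..
  qed
  have "(\<Sum>i<n. (L2_norm (band_part A \<Omega> (f i)))\<^sup>2) = (LINT \<xi>|lebesgue. (\<Sum>i<n. (cmod (band_part A \<Omega> (f i) \<xi>))\<^sup>2))"
    using f L2_integrable_square[OF band_part_L2(2)[OF A \<Omega>]] by (simp add: L2_norm_square)
  also have "\<dots> \<le> (LINT \<xi>|lebesgue. indicator \<Omega> \<xi> * (c\<^sup>2 * measure lebesgue A))"
  proof (rule integral_mono)
    show "integrable lebesgue (\<lambda>\<xi>. \<Sum>i<n. (cmod (band_part A \<Omega> (f i) \<xi>))\<^sup>2)"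
      using f L2_integrable_square[OF band_part_L2(2)[OF A \<Omega>]] by auto
    show "integrable lebesgue (\<lambda>\<xi>. indicator \<Omega> \<xi> * (c\<^sup>2 * measure lebesgue A))"
      using integrable_indicator_lmeasurable[OF \<Omega>] by simp
    fix \<xi> :: 'a
    have "(\<Sum>i<n. (cmod (band_part A \<Omega> (f i) \<xi>))\<^sup>2) = indicator \<Omega> \<xi> * (\<Sum>i<n. (cmod (L2_inner (f i) (u \<xi>)))\<^sup>2)"
      unfolding sum_distrib_left
      by (intro sum.cong) (auto simp: band_part_def time_proj_def[of \<Omega>] F indicator_def)
    also have "\<dots> \<le> indicator \<Omega> \<xi> * (c\<^sup>2 * measure lebesgue A)"
      using Bessel_inequality[OF on uL[of \<xi>]] un by (intro mult_left_mono) auto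
    finally show "(\<Sum>i<n. (cmod (band_part A \<Omega> (f i) \<xi>))\<^sup>2) \<le> indicator \<Omega> \<xi> * (c\<^sup>2 * measure lebesgue A)" .
  qed
  also have "\<dots> = measure lebesgue A * measure lebesgue \<Omega> / (2 * pi) ^ DIM('a)"
    using \<Omega> unfolding c_def fourier_const_square by simp
  finally show ?thesis .
qed

section \<open>The upper bound\<close>

lemma borel_measurable_shift_diff [measurable]:
  assumes [measurable]: "A \<in> sets borel" "g \<in> borel_measurable M"
  shows "(\<lambda>x. shift_diff A (g x)) \<in> borel_measurable M"
  unfolding shift_diff_def by measurable

lemma integrable_indicator_complex:
  assumes "A \<in> lmeasurable"
  shows "integrable lebesgue (indicator A :: 'a::euclidean_space \<Rightarrow> complex)"
  by (rule integrable_bound[OF integrable_indicator_lmeasurable[OF assms]])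
    (use assms in \<open>auto intro!: indicator_lebesgue_measurable simp: indicator_def\<close>)

lemma integrable_shift_diff:
  assumes "A \<in> sets borel" "emeasure lborel A < \<infinity>"
  shows "integrable lborel (\<lambda>x. \<bar>indicator A (x + u) - indicator A x :: real\<bar>)"
proof -
  have "integrable lborel (indicator A :: 'a \<Rightarrow> real)"
    using assms by (intro integrable_real_indicator) auto
  then show ?thesis
    using lborel_integrable_translate[of "indicator A :: 'a \<Rightarrow> real" u]
    by (intro integrable_abs integrable_diff)
qed

lemma shift_diff_le:
  assumes "A \<in> sets borel" "emeasure lborel A < \<infinity>"
  shows "shift_diff A u \<le> 2 * measure lborel A"
proof -
  have int: "integrable lborel (indicator A :: 'a \<Rightarrow> real)"
    using assms by (intro integrable_real_indicator) auto
  have "\<bar>indicator A (x + u) - indicator A x :: real\<bar> \<le> indicator A (x + u) + indicator A x" for x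
    by (auto simp: indicator_def)
  then have "shift_diff A u \<le> (LINT x|lborel. indicator A (x + u) + indicator A x)"
    unfolding shift_diff_def using int lborel_integrable_translate[OF int, of u]
    by (intro integral_mono integrable_shift_diff assms integrable_add)
  also have "\<dots> = 2 * measure lborel A"
    using int lborel_integrable_translate[OF int, of u] lborel_integral_translate[of "indicator A :: 'a \<Rightarrow> real" u] assms
    by simp
  finally show ?thesis .
qed

lemma integrable_mult_shift_diff:
  assumes A: "A \<in> sets borel" "emeasure lborel A < \<infinity>" and k: "integrable lborel k"
  shows "integrable lborel (\<lambda>v. k v * shift_diff A (c *\<^sub>R v))"
proof (rule integrable_bound[OF integrable_mult_left[OF k]])
  have [measurable]: "A \<in> sets borel" "k \<in> borel_measurable borel" using A k by auto
  show "(\<lambda>v. k v * shift_diff A (c *\<^sub>R v)) \<in> borel_measurable lborel" by measurable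
  show "AE v in lborel. norm (k v * shift_diff A (c *\<^sub>R v)) \<le> norm (k v * (2 * measure lborel A))"
    using shift_diff_le[OF A] shift_diff_nonneg[of A]
    by (intro AE_I2) (auto simp: abs_mult intro!: mult_left_mono)
qed

lemma integrable_pair_shift_diff:
  fixes k :: "'a::euclidean_space \<Rightarrow> real"
  assumes A: "A \<in> sets borel" "emeasure lborel A < \<infinity>" and k: "integrable lborel k"
  shows "integrable (lborel \<Otimes>\<^sub>M lborel) (\<lambda>(v, x). k v * \<bar>indicator A (x + \<tau> *\<^sub>R v) - indicator A x\<bar>)"
proof (rule lborel_pair.Fubini_integrable)
  have [measurable]: "A \<in> sets borel" "k \<in> borel_measurable borel" using A k by auto
  show "(\<lambda>(v, x). k v * \<bar>indicator A (x + \<tau> *\<^sub>R v) - indicator A x\<bar>) \<in> borel_measurable (lborel \<Otimes>\<^sub>M lborel)"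
    by measurable
  show "integrable lborel (\<lambda>v. LINT x|lborel. norm (case (v, x) of (v, x) \<Rightarrow> k v * \<bar>indicator A (x + \<tau> *\<^sub>R v) - indicator A x\<bar>))"
    using integrable_mult_shift_diff[OF A integrable_abs[OF k], of \<tau>] by (simp add: abs_mult shift_diff_def)
  show "AE v in lborel. integrable lborel (\<lambda>x. case (v, x) of (v, x) \<Rightarrow> k v * \<bar>indicator A (x + \<tau> *\<^sub>R v) - indicator A x\<bar>)"
    using integrable_shift_diff[OF A] by auto
qed

text \<open>Dominated convergence with the bound \<open>shift_diff_le\<close>. It is used three
  times: for the squared kernel in the upper bound, and for the time and frequency profiles of the
  windows in the lower bound.\<close>

lemma shift_diff_average_tendsto_0:
  fixes k :: "'a::euclidean_space \<Rightarrow> real"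
  assumes A: "A \<in> sets borel" "emeasure lborel A < \<infinity>" and k: "integrable lborel k"
  shows "((\<lambda>r. LINT v|lborel. k v * shift_diff A ((1 / r) *\<^sub>R v)) \<longlongrightarrow> 0) at_top"
proof -
  have [measurable]: "A \<in> sets borel" "k \<in> borel_measurable borel" using A k by auto
  have "((\<lambda>r. LINT v|lborel. k v * shift_diff A ((1 / r) *\<^sub>R v)) \<longlongrightarrow> (LINT v|(lborel :: 'a measure). 0)) at_top"
  proof (rule integral_dominated_convergence_at_top)
    show "integrable lborel (\<lambda>v. \<bar>k v\<bar> * (2 * measure lborel A))"
      using k by (intro integrable_mult_left integrable_abs)
    show "AE v in lborel. ((\<lambda>r. k v * shift_diff A ((1 / r) *\<^sub>R v)) \<longlongrightarrow> 0) at_top"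
    proof (rule AE_I2)
      fix v :: 'a
      have "((\<lambda>r::real. 1 / r) \<longlongrightarrow> 0) at_top"
        by (rule tendsto_divide_0[OF tendsto_const]) (auto simp: filterlim_at_top_imp_at_infinity filterlim_ident)
      then have "((\<lambda>r::real. (1 / r) *\<^sub>R v) \<longlongrightarrow> 0 *\<^sub>R v) at_top"
        by (intro tendsto_intros)
      then have "((\<lambda>r::real. shift_diff A ((1 / r) *\<^sub>R v)) \<longlongrightarrow> 0) at_top"
        using filterlim_compose[OF shift_diff_tendsto_0[OF A]] by simp
      then show "((\<lambda>r. k v * shift_diff A ((1 / r) *\<^sub>R v)) \<longlongrightarrow> 0) at_top"
        by (rule tendsto_mult_right_zero)
    qed
    show "\<forall>\<^sub>F r in at_top. AE v in lborel. norm (k v * shift_diff A ((1 / r) *\<^sub>R v)) \<le> \<bar>k v\<bar> * (2 * measure lborel A)"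
      using shift_diff_le[OF A] shift_diff_nonneg[of A]
      by (intro always_eventually allI AE_I2) (auto simp: abs_mult intro!: mult_left_mono)
  qed auto
  then show ?thesis by simp
qed

abbreviation dilate :: "real \<Rightarrow> 'a::real_vector set \<Rightarrow> 'a set" where
  "dilate r A \<equiv> (\<lambda>t. r *\<^sub>R t) ` A"

lemma mem_scaleR_image:
  fixes A :: "'a::real_vector set"
  assumes "r \<noteq> 0"
  shows "x \<in> dilate r A \<longleftrightarrow> (1 / r) *\<^sub>R x \<in> A"
  using assms by (auto simp: image_iff) (metis scaleR_one scaleR_scaleR divide_self mult.commute times_divide_eq_right)

lemma sets_borel_scaleR_image:
  fixes A :: "'a::euclidean_space set"
  assumes [measurable]: "A \<in> sets borel" and "r \<noteq> 0"
  shows "dilate r A \<in> sets borel"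
proof -
  have "dilate r A = (\<lambda>x. (1 / r) *\<^sub>R x) -` A \<inter> space borel"
    using mem_scaleR_image[OF assms(2), of _ A] by auto
  also have "\<dots> \<in> sets borel" by measurable
  finally show ?thesis .
qed

text \<open>Trades the growing set for a shrinking shift, with the volume factor split off.\<close>

lemma shift_diff_scaleR:
  fixes A :: "'a::euclidean_space set"
  assumes "r > 0"
  shows "shift_diff (dilate r A) u = r ^ DIM('a) * shift_diff A ((1 / r) *\<^sub>R u)"
proof -
  have ind: "indicator (dilate r A) x = (indicator A ((1 / r) *\<^sub>R x) :: real)" for x
    using mem_scaleR_image[of r x A] assms by (auto simp: indicator_def)
  show ?thesis
    unfolding shift_diff_def ind using assms
    by (subst lborel_integral_affine[of r _ 0]) (simp_all add: scaleR_right_distrib)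
qed

lemma lborel_lmeasurable: "A \<in> sets borel \<Longrightarrow> emeasure lborel A < \<infinity> \<Longrightarrow> A \<in> lmeasurable"
  by (simp add: fmeasurable_def)

text \<open>The kernel of the band projection as an integral operator, evaluated at
  \<open>y - x\<close>. One constant comes from the forward and one from the inverse transform. It
  is square integrable by Plancherel but in general not integrable, so the estimates use its
  square.\<close>

definition band_kernel :: "'a::euclidean_space set \<Rightarrow> 'a \<Rightarrow> complex" where
  "band_kernel \<Omega> v = of_real ((2 * pi) powr (- real DIM('a) / 2)) * \<F> (indicator \<Omega>) v"

lemma
  fixes \<Omega> :: "'a::euclidean_space set"
  assumes "\<Omega> \<in> lmeasurable"
  shows borel_measurable_band_kernel: "band_kernel \<Omega> \<in> borel_measurable borel"
    and integrable_band_kernel_square: "integrable lborel (\<lambda>v. (cmod (band_kernel \<Omega> v))\<^sup>2)"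
proof -
  have L: "indicator \<Omega> \<in> L2" using indicator_L2[OF assms] .
  have I: "integrable lebesgue (indicator \<Omega> :: 'a \<Rightarrow> complex)"
    by (rule integrable_indicator_complex[OF assms])
  have [measurable]: "\<F> (indicator \<Omega>) \<in> borel_measurable borel"
    by (rule borel_measurable_fourier_integral[OF L2_measurable[OF L]])
  show "band_kernel \<Omega> \<in> borel_measurable borel"
    unfolding band_kernel_def[abs_def] by measurable
  have "integrable lborel (\<lambda>v. (cmod (\<F> (indicator \<Omega>) v))\<^sup>2)"
    using L2_integrable_square[OF Plancherel(1)[OF I L]] by (simp add: integrable_completion)
  then show "integrable lborel (\<lambda>v. (cmod (band_kernel \<Omega> v))\<^sup>2)"
    unfolding band_kernel_def norm_mult power_mult_distrib by (rule integrable_mult_right)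
qed

text \<open>The multiplication formula for the truncated \<open>f\<close> and the modulated
  indicator of \<open>\<Omega>\<close>: modulation by \<open>x\<close> becomes translation of the
  kernel by \<open>x\<close>.\<close>

lemma band_fun_eq_kernel:
  fixes A \<Omega> :: "'a::euclidean_space set"
  assumes A: "A \<in> lmeasurable" and \<Omega>: "\<Omega> \<in> lmeasurable" and f: "f \<in> L2"
  shows "band_fun A \<Omega> f x = (LINT y|lebesgue. time_proj A f y * band_kernel \<Omega> (y - x))"
proof -
  define h where "h = time_proj A f"
  define c where "c = complex_of_real ((2 * pi) powr (- real DIM('a) / 2))"
  define k where "k \<xi> = indicator \<Omega> \<xi> * iexp (x \<bullet> \<xi>)" for \<xi>
  have h: "integrable lebesgue h" unfolding h_def by (rule time_proj_integrable[OF A f])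
  have "integrable lebesgue (indicator \<Omega> :: 'a \<Rightarrow> complex)"
    by (rule integrable_indicator_complex[OF \<Omega>])
  from integrable_fourier_kernel[OF this, of "- x"] have k: "integrable lebesgue k"
    by (simp add: k_def[abs_def])
  have "band_fun A \<Omega> f x = c * (LINT \<xi>|lebesgue. \<F> h \<xi> * k \<xi>)"
    unfolding band_fun_def inv_fourier_integral_def fourier_integral_def[of _ "- x"] c_def band_part_def
    by (rule arg_cong2[where f="(*)", OF refl], rule integral_cong[OF refl])
       (simp add: k_def h_def time_proj_def[of \<Omega>] mult_ac)
  also have "(LINT \<xi>|lebesgue. \<F> h \<xi> * k \<xi>) = (LINT y|lebesgue. h y * \<F> k y)"
    by (rule fourier_multiplication_formula[OF h k])
  also have "\<F> k = (\<lambda>y. \<F> (indicator \<Omega>) (y - x))"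
    unfolding k_def[abs_def] by (rule ext) (rule fourier_integral_modulate)
  also have "c * (LINT y|lebesgue. h y * \<F> (indicator \<Omega>) (y - x))
      = (LINT y|lebesgue. c * (h y * \<F> (indicator \<Omega>) (y - x)))"
    by (rule integral_mult_right_zero[symmetric])
  also have "\<dots> = (LINT y|lebesgue. time_proj A f y * band_kernel \<Omega> (y - x))"
    by (simp add: h_def band_kernel_def c_def mult_ac)
  finally show ?thesis .
qed

text \<open>By the kernel formula the values at \<open>x\<close> are the inner products of the
  \<open>f i\<close> with a single function \<open>u x\<close>. Bessel's inequality at each
  \<open>x\<close> outside \<open>A\<close>, followed by integration in \<open>x\<close> and Fubini,
  produces the average of \<open>shift_diff\<close>.\<close>

lemma sum_leak_le:
  fixes A \<Omega> :: "'a::euclidean_space set"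
  assumes A: "A \<in> sets borel" "emeasure lborel A < \<infinity>" and \<Omega>: "\<Omega> \<in> lmeasurable" and on: "L2_orthonormal n f"
  shows "(\<Sum>i<n. (L2_norm (time_proj (- A) (band_fun A \<Omega> (f i))))\<^sup>2)
    \<le> (LINT v|lborel. (cmod (band_kernel \<Omega> v))\<^sup>2 * shift_diff A v)"
proof -
  have Al: "A \<in> lmeasurable" using A by (rule lborel_lmeasurable)
  have f: "f i \<in> L2" if "i < n" for i using on that by (simp add: L2_orthonormal_def)
  have [measurable]: "A \<in> sets borel" "band_kernel \<Omega> \<in> borel_measurable borel"
    using A borel_measurable_band_kernel[OF \<Omega>] by auto
  define \<kappa> where "\<kappa> v = (cmod (band_kernel \<Omega> v))\<^sup>2" for v
  have \<kappa>: "integrable lborel \<kappa>" unfolding \<kappa>_def by (rule integrable_band_kernel_square[OF \<Omega>])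
  have \<kappa>m[measurable]: "\<kappa> \<in> borel_measurable borel" using \<kappa> by auto
  define K where "K v x = \<kappa> v * \<bar>indicator A (x + v) - indicator A x\<bar>" for v x
  have K: "integrable (lborel \<Otimes>\<^sub>M lborel) (\<lambda>(v, x). K v x)"
    unfolding K_def using integrable_pair_shift_diff[OF A \<kappa>, of 1] by simp
  define u where "u x y = indicator A y * cnj (band_kernel \<Omega> (y - x))" for x y
  have um: "u x \<in> borel_measurable borel" for x unfolding u_def[abs_def] by measurable
  have us: "(cmod (u x y))\<^sup>2 = indicator A y * \<kappa> (y - x)" for x y
    by (auto simp: u_def \<kappa>_def norm_mult indicator_def)
  have \<kappa>s: "integrable lborel (\<lambda>y. indicator A y * \<kappa> (y - x))" for x
    using lborel_integrable_translate[OF \<kappa>, of "- x"]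
    by (intro integrable_real_mult_indicator[of A, unfolded mult.commute[of _ "indicator A _"]]) auto
  have uL: "u x \<in> L2" for x
    by (rule L2I[OF lebesgue_measurable_borel[OF um]]) (use \<kappa>s in \<open>simp add: us integrable_completion\<close>)
  have un: "(L2_norm (u x))\<^sup>2 = (LINT v|lborel. indicator A (x + v) * \<kappa> v)" for x
  proof -
    have "(L2_norm (u x))\<^sup>2 = (LINT y|lborel. indicator A y * \<kappa> (y - x))"
      unfolding L2_norm_square us by (rule integral_completion) measurable
    also have "\<dots> = (LINT v|lborel. indicator A (x + v) * \<kappa> v)"
      using lborel_integral_translate[of "\<lambda>y. indicator A y * \<kappa> (y - x)" x] by (simp add: add.commute)
    finally show ?thesis .
  qed
  have \<phi>: "band_fun A \<Omega> (f i) x = L2_inner (f i) (u x)" if "i < n" for i x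
    unfolding band_fun_eq_kernel[OF Al \<Omega> f[OF that]] L2_inner_def
    by (intro integral_cong refl) (auto simp: u_def time_proj_def indicator_def)
  define S where "S x = (\<Sum>i<n. (cmod (time_proj (- A) (band_fun A \<Omega> (f i)) x))\<^sup>2)" for x
  \<comment> \<open>Outside \<open>A\<close> the squared norm of \<open>u x\<close> is exactly the
    integral of \<open>K\<close>. Inside \<open>A\<close> the left side vanishes, so the bound holds
    everywhere and the integral over \<open>x\<close> yields the full
    \<open>shift_diff\<close>.\<close>
  have Sb: "S x \<le> (LINT v|lborel. K v x)" for x
  proof (cases "x \<in> A")
    case True
    then have "S x = 0" by (simp add: S_def time_proj_def)
    moreover have "0 \<le> (LINT v|lborel. K v x)" by (simp add: K_def \<kappa>_def)
    ultimately show ?thesis by simp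
  next
    case False
    then have "S x = (\<Sum>i<n. (cmod (L2_inner (f i) (u x)))\<^sup>2)"
      by (simp add: S_def time_proj_def \<phi>)
    also have "\<dots> \<le> (L2_norm (u x))\<^sup>2" by (rule Bessel_inequality[OF on uL])
    also have "\<dots> = (LINT v|lborel. K v x)"
      using False by (simp add: un K_def mult.commute)
    finally show ?thesis .
  qed
  have Ac: "- A \<in> sets lebesgue" using A by (simp add: Compl_in_sets_lebesgue)
  have Sint0: "integrable lebesgue (\<lambda>x. (cmod (time_proj (- A) (band_fun A \<Omega> (f i)) x))\<^sup>2)" if "i < n" for i
    using L2_integrable_square[OF time_proj_L2[OF Ac band_fun_L2(1)[OF Al \<Omega> f[OF that]]]] .
  have "band_fun A \<Omega> (f i) \<in> borel_measurable borel" if "i < n" for i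
    unfolding band_fun_def
    by (intro borel_measurable_inv_fourier_integral L2_measurable band_part_L2 Al \<Omega> f that)
  then have Sm: "S \<in> borel_measurable borel"
    unfolding S_def[abs_def] time_proj_def
    by (intro borel_measurable_sum borel_measurable_power borel_measurable_norm borel_measurable_times borel_measurable_indicator) auto
  have "integrable lebesgue S" unfolding S_def[abs_def] using Sint0 by auto
  then have Sint: "integrable lborel S" using Sm by (simp add: integrable_completion)
  have "(\<Sum>i<n. (L2_norm (time_proj (- A) (band_fun A \<Omega> (f i))))\<^sup>2) = (LINT x|lebesgue. S x)"
    unfolding S_def[abs_def] using Sint0 by (simp add: L2_norm_square)
  also have "\<dots> = (LINT x|lborel. S x)" using Sm by (intro integral_completion) auto
  also have "\<dots> \<le> (LINT x|lborel. LINT v|lborel. K v x)"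
    using Sint Sb lborel_pair.integrable_snd[OF K] by (intro integral_mono) auto
  also have "\<dots> = (LINT v|lborel. LINT x|lborel. K v x)"
    using lborel_pair.Fubini_integral[OF K] .
  also have "\<dots> = (LINT v|lborel. (cmod (band_kernel \<Omega> v))\<^sup>2 * shift_diff A v)"
    by (simp add: K_def \<kappa>_def shift_diff_def)
  finally show ?thesis .
qed

text \<open>Each admissible unit vector contributes at least \<open>1 - \<epsilon>\<close> to the
  sum of its band part and its leakage, and both totals are bounded independently of the size of the
  family.\<close>

lemma eta_le:
  fixes A \<Omega> :: "'a::euclidean_space set"
  assumes A: "A \<in> sets borel" "emeasure lborel A < \<infinity>" and \<Omega>: "\<Omega> \<in> lmeasurable" and \<epsilon>: "\<epsilon> < 1"
  shows "ereal_of_enat (eta \<epsilon> A \<Omega>) \<le> ereal ((measure lborel A * measure lebesgue \<Omega> / (2 * pi) ^ DIM('a)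
    + (LINT v|lborel. (cmod (band_kernel \<Omega> v))\<^sup>2 * shift_diff A v)) / (1 - \<epsilon>))" (is "_ \<le> ereal (?X / _)")
proof -
  have Al: "A \<in> lmeasurable" using A by (rule lborel_lmeasurable)
  have bound: "real n \<le> ?X / (1 - \<epsilon>)"
    if on: "L2_orthonormal n f" and le: "\<And>i. i < n \<Longrightarrow> (L2_norm (\<lambda>x. loc_op A \<Omega> (f i) x - f i x))\<^sup>2 \<le> \<epsilon>" for n f
  proof -
    have f: "f i \<in> L2" "L2_norm (f i) = 1" if "i < n" for i
    proof -
      show "f i \<in> L2" using on that by (simp add: L2_orthonormal_def)
      have "complex_of_real ((L2_norm (f i))\<^sup>2) = 1"
        using on that by (simp only: L2_inner_eq_norm[symmetric]) (simp add: L2_orthonormal_def)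
      then have "(L2_norm (f i))\<^sup>2 = 1" by (simp only: of_real_eq_1_iff)
      then show "L2_norm (f i) = 1" using L2_norm_nonneg[of "f i"] by (simp add: power2_eq_1_iff)
    qed
    have "real n * (1 - \<epsilon>) = (\<Sum>i<n. 1 - \<epsilon>)" by simp
    also have "\<dots> \<le> (\<Sum>i<n. (L2_norm (band_part A \<Omega> (f i)))\<^sup>2 + (L2_norm (time_proj (- A) (band_fun A \<Omega> (f i))))\<^sup>2)"
    proof (rule sum_mono)
      fix i assume "i \<in> {..<n}"
      then have i: "i < n" by simp
      show "1 - \<epsilon> \<le> (L2_norm (band_part A \<Omega> (f i)))\<^sup>2 + (L2_norm (time_proj (- A) (band_fun A \<Omega> (f i))))\<^sup>2"
        using le[OF i] L2_norm_loc_op_defect[OF Al \<Omega> f(1)[OF i]] L2_norm_loc_defect[OF Al \<Omega> f(1)[OF i]] f(2)[OF i]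
        by simp
    qed
    also have "\<dots> \<le> ?X"
      unfolding sum.distrib using sum_band_part_le[OF Al \<Omega> on] sum_leak_le[OF A \<Omega> on] A by simp
    finally show ?thesis using \<epsilon> by (simp add: field_simps)
  qed
  have "eta \<epsilon> A \<Omega> \<le> enat (nat \<lfloor>?X / (1 - \<epsilon>)\<rfloor>)"
    unfolding eta_def
  proof (rule Sup_least, clarify)
    fix n f assume "L2_orthonormal n f" "\<forall>i<n. (L2_norm (\<lambda>x. loc_op A \<Omega> (f i) x - f i x))\<^sup>2 \<le> \<epsilon>"
    then have "real n \<le> ?X / (1 - \<epsilon>)" using bound by blast
    then show "enat n \<le> enat (nat \<lfloor>?X / (1 - \<epsilon>)\<rfloor>)" by (simp add: le_nat_floor)
  qed
  then have "ereal_of_enat (eta \<epsilon> A \<Omega>) \<le> ereal_of_enat (enat (nat \<lfloor>?X / (1 - \<epsilon>)\<rfloor>))"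
    by (simp only: ereal_of_enat_le_iff)
  also have "\<dots> \<le> ereal (?X / (1 - \<epsilon>))"
  proof -
    \<comment> \<open>The empty family shows that the bound is nonnegative, so \<open>nat\<close>
      does not truncate it.\<close>
    have "0 \<le> ?X / (1 - \<epsilon>)"
      using bound[of 0] by (simp add: L2_orthonormal_def)
    then show ?thesis by simp
  qed
  finally show ?thesis .
qed

section \<open>Lattices and averaging\<close>

definition int_lattice :: "'a::euclidean_space set" where
  "int_lattice = {x. \<forall>b\<in>Basis. x \<bullet> b \<in> \<int>}"

definition unit_cell :: "'a::euclidean_space set" where
  "unit_cell = {x. \<forall>b\<in>Basis. 0 \<le> x \<bullet> b \<and> x \<bullet> b < 1}"

lemma countable_int_lattice: "countable (int_lattice :: 'a::euclidean_space set)"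
proof -
  have "int_lattice \<subseteq> (\<lambda>f. \<Sum>b\<in>Basis. of_int (f b) *\<^sub>R b) ` (Basis \<rightarrow>\<^sub>E (UNIV :: int set) :: ('a \<Rightarrow> int) set)"
  proof
    fix x :: 'a assume "x \<in> int_lattice"
    then have "x = (\<Sum>b\<in>Basis. of_int (restrict (\<lambda>b. \<lfloor>x \<bullet> b\<rfloor>) Basis b) *\<^sub>R b)"
      by (subst euclidean_representation[symmetric]) (auto simp: int_lattice_def intro!: sum.cong)
    then show "x \<in> (\<lambda>f. \<Sum>b\<in>Basis. of_int (f b) *\<^sub>R b) ` (Basis \<rightarrow>\<^sub>E UNIV)"
      by (rule image_eqI[where x="restrict (\<lambda>b. \<lfloor>x \<bullet> b\<rfloor>) Basis"]) auto
  qed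
  then show ?thesis
    by (rule countable_subset) (intro countable_image countable_PiE, auto)
qed

text \<open>Supplies as many additional windows as are needed to pad a family to a prescribed
  size.\<close>

lemma infinite_int_lattice: "infinite (int_lattice :: 'a::euclidean_space set)"
proof
  assume fin: "finite (int_lattice :: 'a set)"
  obtain b :: 'a where b: "b \<in> Basis" using nonempty_Basis by blast
  have "range (\<lambda>n. real n *\<^sub>R b) \<subseteq> int_lattice"
    using b by (auto simp: int_lattice_def inner_Basis)
  then have "finite (range (\<lambda>n. real n *\<^sub>R b))" using fin by (rule finite_subset)
  moreover have "inj (\<lambda>n. real n *\<^sub>R b)" using b by (auto simp: inj_on_def)
  ultimately show False using finite_imageD infinite_UNIV_nat by blast
qed

lemma unit_cell_lattice_unique:
  assumes "x - k \<in> unit_cell" "x - k' \<in> unit_cell" "k \<in> int_lattice" "k' \<in> int_lattice"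
  shows "k = k'"
proof (rule euclidean_eqI)
  fix b :: 'a assume b: "b \<in> Basis"
  obtain i j where "k \<bullet> b = of_int i" "k' \<bullet> b = of_int j"
    using assms(3,4) b unfolding int_lattice_def by (metis (lifting) Ints_cases mem_Collect_eq)
  moreover from this have "of_int i \<le> x \<bullet> b" "x \<bullet> b < of_int i + 1" "of_int j \<le> x \<bullet> b" "x \<bullet> b < of_int j + 1"
    using assms(1,2) b by (auto simp: unit_cell_def inner_diff_left algebra_simps)
  ultimately show "k \<bullet> b = k' \<bullet> b" by (metis floor_unique)
qed

lemma unit_cell_lattice_exists: "\<exists>k\<in>int_lattice. x - k \<in> unit_cell"
proof
  show "(\<Sum>b\<in>Basis. of_int \<lfloor>x \<bullet> b\<rfloor> *\<^sub>R b) \<in> int_lattice" by (auto simp: int_lattice_def)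
  show "x - (\<Sum>b\<in>Basis. of_int \<lfloor>x \<bullet> b\<rfloor> *\<^sub>R b) \<in> unit_cell"
    by (auto simp: unit_cell_def inner_diff_left) linarith
qed

lemma indicator_unit_cell: "indicator unit_cell x = (\<Prod>b\<in>Basis. indicator {0..<1} (x \<bullet> b) :: complex)"
  by (auto simp: unit_cell_def indicator_def)

lemma sets_borel_unit_cell [measurable]: "unit_cell \<in> sets borel"
  unfolding unit_cell_def by measurable

lemma emeasure_unit_cell: "emeasure lborel (unit_cell :: 'a::euclidean_space set) = 1"
proof -
  have "indicator unit_cell x = (\<Prod>b\<in>Basis. indicator {0..<1} (x \<bullet> b) :: ennreal)" for x :: 'a
    by (auto simp: unit_cell_def indicator_def)
  then have "emeasure lborel (unit_cell :: 'a set) = (\<integral>\<^sup>+x. (\<Prod>b\<in>Basis. indicator {0..<1} (x \<bullet> b)) \<partial>(lborel :: 'a measure))"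
    by (simp flip: nn_integral_indicator)
  also have "\<dots> = 1"
    by (subst nn_integral_lborel_prod) auto
  finally show ?thesis .
qed

text \<open>Antiderivative and periodicity. The interval is half-open so that cells tile; it differs
  by a null set from the closed interval of the fundamental theorem.\<close>

lemma integral_unit_interval_character:
  fixes m :: real
  assumes "m \<in> \<int>"
  shows "integrable lborel (\<lambda>t. indicator {0..<1} t * iexp (2 * pi * m * t))"
    and "(LINT t|lborel. indicator {0..<1} t * iexp (2 * pi * m * t)) = (if m = 0 then 1 else 0)"
proof -
  define f where "f t = iexp (2 * pi * m * t)" for t
  define F where "F t = (if m = 0 then of_real t else f t / (2 * pi * m * \<i>))" for t
  have "has_bochner_integral lborel (\<lambda>t. indicator {0..1} t *\<^sub>R f t) (F 1 - F 0)"
  proof (rule has_bochner_integral_FTC_Icc)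
    show "(F has_vector_derivative f t) (at t within {0..1})" for t
    proof (cases "m = 0")
      case True
      then show ?thesis unfolding F_def f_def
        by (auto intro!: derivative_eq_intros simp: has_vector_derivative_of_real)
    next
      case False
      have "((\<lambda>t. exp (t *\<^sub>R (\<i> * (2 * pi * m))) / (2 * pi * m * \<i>)) has_vector_derivative
          (exp (t *\<^sub>R (\<i> * (2 * pi * m))) * (\<i> * (2 * pi * m))) / (2 * pi * m * \<i>)) (at t within {0..1})"
        by (intro has_vector_derivative_divide exp_scaleR_has_vector_derivative_right)
      moreover have "f t = exp (t *\<^sub>R (\<i> * (2 * pi * m)))" for t
        by (simp add: f_def scaleR_conv_of_real mult_ac)
      ultimately show ?thesis using False unfolding F_def by simp
    qed
    show "continuous_on {0..1} f" unfolding f_def by (intro continuous_intros)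
  qed auto
  moreover have "F 1 - F 0 = (if m = 0 then 1 else 0)"
  proof -
    obtain i where i: "m = of_int i" using assms by (auto elim: Ints_cases)
    have "f 1 = exp ((2 * of_int i * of_real pi) * \<i>)" by (simp add: f_def i mult_ac)
    also have "\<dots> = 1" using exp_integer_2pi[of "of_int i"] by (simp add: mult_ac)
    finally have "f 1 = f 0" by (simp add: f_def)
    then show ?thesis by (simp add: F_def)
  qed
  ultimately have hbi: "has_bochner_integral lborel (\<lambda>t. indicator {0..1} t *\<^sub>R f t) (if m = 0 then 1 else 0)" by simp
  have ae: "AE t in lborel. indicator {0..<1} t * f t = indicator {0..1} t *\<^sub>R f t"
    using AE_lborel_singleton[of "1::real"] by eventually_elim (auto simp: indicator_def)
  have m1: "(\<lambda>t. indicator {0..<1} t * f t) \<in> borel_measurable lborel"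
    and m2: "(\<lambda>t. indicator {0..1} t *\<^sub>R f t) \<in> borel_measurable lborel"
    unfolding f_def by measurable
  show "integrable lborel (\<lambda>t. indicator {0..<1} t * iexp (2 * pi * m * t))"
    using integrable_cong_AE[OF m1 m2 ae] hbi by (simp add: f_def has_bochner_integral_iff)
  show "(LINT t|lborel. indicator {0..<1} t * iexp (2 * pi * m * t)) = (if m = 0 then 1 else 0)"
    using integral_cong_AE[OF m1 m2 ae] hbi by (simp add: f_def has_bochner_integral_iff)
qed

lemma integral_unit_cell_character:
  fixes m :: "'a::euclidean_space"
  assumes m: "m \<in> int_lattice"
  shows "(LINT v|lborel. indicator unit_cell v * iexp (2 * pi * (m \<bullet> v))) = (if m = 0 then 1 else 0)"
proof -
  define f where "f b t = indicator {0..<1} t * iexp (2 * pi * (m \<bullet> b) * t)" for b t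
  have "indicator unit_cell v * iexp (2 * pi * (m \<bullet> v)) = (\<Prod>b\<in>Basis. f b (v \<bullet> b))" for v
  proof -
    have "iexp (2 * pi * (m \<bullet> v)) = (\<Prod>b\<in>Basis. iexp (2 * pi * (m \<bullet> b) * (v \<bullet> b)))"
      by (subst exp_sum[symmetric]) (auto simp: euclidean_inner[of m v] sum_distrib_left mult_ac)
    then show ?thesis by (simp add: f_def indicator_unit_cell prod.distrib)
  qed
  moreover have "(LINT v|lborel. (\<Prod>b\<in>Basis. f b (v \<bullet> b))) = (\<Prod>b\<in>Basis. if m \<bullet> b = 0 then 1 else (0 :: complex))"
  proof -
    have f: "integrable lborel (f b)" "(LINT t|lborel. f b t) = (if m \<bullet> b = 0 then 1 else 0)" if "b \<in> Basis" for b
      using integral_unit_interval_character[of "m \<bullet> b"] m that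
      unfolding f_def[abs_def] int_lattice_def by auto
    show ?thesis
      using f(1) by (subst lborel_integral_prod_Basis) (auto intro!: prod.cong f(2))
  qed
  moreover have "\<dots> = (if m = 0 then 1 else 0)"
    by (auto simp: euclidean_eq_iff[of m 0])
  ultimately show ?thesis by simp
qed

text \<open>Averaging the number of lattice points \<open>x + \<tau> k\<close> in \<open>E\<close> over \<open>x\<close> in a cell gives \<open>|E| / \<tau>\<^sup>d\<close>,
  so some translate of the lattice meets \<open>E\<close> at least that often.\<close>

lemma lattice_translate_many_points:
  fixes E :: "'a::euclidean_space set"
  assumes E[measurable]: "E \<in> sets borel" and fin: "emeasure lborel E < \<infinity>" and \<tau>: "\<tau> > 0"
  shows "\<exists>x F. finite F \<and> F \<subseteq> int_lattice \<and> (\<forall>k\<in>F. x + \<tau> *\<^sub>R k \<in> E) \<and> measure lborel E \<le> real (card F) * \<tau> ^ DIM('a)"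
proof (rule ccontr)
  assume contra: "\<not> ?thesis"
  define d where "d = DIM('a)"
  define a where "a = measure lborel E / \<tau> ^ d"
  \<comment> \<open>The largest natural number strictly below \<open>a\<close>. Averaging counts
    that are below \<open>a\<close> would give only a weak inequality; since counts are integers
    they are at most \<open>m\<close>, and this gap gives the contradiction.\<close>
  define m where "m = nat (\<lceil>a\<rceil> - 1)"
  have small: "real (card F) < a" if "finite F" "F \<subseteq> int_lattice" "\<And>k. k \<in> F \<Longrightarrow> x + \<tau> *\<^sub>R k \<in> E" for x F
    using contra that \<tau> unfolding a_def d_def by (auto simp: field_simps not_le)
  have a: "a > 0" using small[of "{}" 0] by simp
  have ma: "real m < a"
  proof -
    have "real m = of_int (\<lceil>a\<rceil> - 1)" using a by (simp add: m_def)
    then show ?thesis by linarith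
  qed
  have card_le: "card F \<le> m" if "finite F" "F \<subseteq> int_lattice" "\<And>k. k \<in> F \<Longrightarrow> x + \<tau> *\<^sub>R k \<in> E" for x F
    using small[OF that] unfolding m_def by linarith
  have count: "(\<integral>\<^sup>+k. indicator E (x + \<tau> *\<^sub>R k) \<partial>count_space int_lattice) \<le> ennreal (real m)" for x
  proof -
    define S where "S = {k \<in> int_lattice. x + \<tau> *\<^sub>R k \<in> E}"
    have fS: "finite S"
    proof (rule ccontr)
      assume "infinite S"
      then obtain B where "finite B" "card B = Suc m" "B \<subseteq> S" using infinite_arbitrarily_large by blast
      then show False using card_le[of B x] by (auto simp: S_def)
    qed
    have "(\<integral>\<^sup>+k. indicator E (x + \<tau> *\<^sub>R k) \<partial>count_space int_lattice) = (\<integral>\<^sup>+k. indicator S k \<partial>count_space int_lattice)"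
      by (intro nn_integral_cong) (auto simp: S_def indicator_def)
    also have "\<dots> = of_nat (card S)"
      using fS by (subst nn_integral_indicator) (auto simp: S_def emeasure_count_space_finite)
    also have "\<dots> \<le> ennreal (real m)"
    proof -
      have "card S \<le> m" by (rule card_le[OF fS, of x]) (auto simp: S_def)
      then show ?thesis by (simp add: ennreal_of_nat_eq_real_of_nat)
    qed
    finally show ?thesis .
  qed
  have one: "(\<integral>\<^sup>+k. indicator unit_cell (x - k) \<partial>count_space int_lattice) = 1" for x :: 'a
  proof -
    obtain k0 where k0: "k0 \<in> int_lattice" "x - k0 \<in> unit_cell" using unit_cell_lattice_exists by blast
    have "(\<integral>\<^sup>+k. indicator unit_cell (x - k) \<partial>count_space int_lattice) = (\<integral>\<^sup>+k. indicator {k0} k \<partial>count_space int_lattice)"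
    proof (rule nn_integral_cong)
      fix k :: 'a assume "k \<in> space (count_space int_lattice)"
      then have "x - k \<in> unit_cell \<longleftrightarrow> k = k0"
        using k0 unit_cell_lattice_unique[of x k k0] by auto
      then show "indicator unit_cell (x - k) = (indicator {k0} k :: ennreal)" by (simp add: indicator_def)
    qed
    also have "\<dots> = 1" using k0 by (subst nn_integral_indicator) auto
    finally show ?thesis .
  qed
  have shift: "(\<integral>\<^sup>+x. indicator E (\<tau> *\<^sub>R x) * indicator unit_cell (x - k) \<partial>lborel)
      = (\<integral>\<^sup>+x. indicator unit_cell x * indicator E (\<tau> *\<^sub>R x + \<tau> *\<^sub>R k) \<partial>lborel)" for k
    using nn_integral_lborel_affine[of "\<lambda>x. indicator E (\<tau> *\<^sub>R x) * indicator unit_cell (x - k)" 1 k]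
    by (simp add: scaleR_right_distrib algebra_simps)
  \<comment> \<open>Unfolding: the rescaled space is cut into lattice translates of the unit cell
    and all pieces are moved into one cell, where at every point at most \<open>m\<close> of them
    can meet \<open>E\<close>.\<close>
  have "emeasure lborel E = (\<integral>\<^sup>+x. indicator E x \<partial>lborel)" by simp
  also have "\<dots> = ennreal (\<tau> ^ d) * (\<integral>\<^sup>+x. indicator E (\<tau> *\<^sub>R x) \<partial>lborel)"
    using nn_integral_lborel_affine[of "indicator E" \<tau> 0] \<tau> by (simp add: d_def)
  also have "(\<integral>\<^sup>+x. indicator E (\<tau> *\<^sub>R x) \<partial>lborel)
      = (\<integral>\<^sup>+x. \<integral>\<^sup>+k. indicator E (\<tau> *\<^sub>R x) * indicator unit_cell (x - k) \<partial>count_space int_lattice \<partial>lborel)"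
    by (simp add: nn_integral_cmult one)
  also have "\<dots> = (\<integral>\<^sup>+k. \<integral>\<^sup>+x. indicator E (\<tau> *\<^sub>R x) * indicator unit_cell (x - k) \<partial>lborel \<partial>count_space int_lattice)"
    by (rule nn_integral_count_space_nn_integral[OF countable_int_lattice]) measurable
  also have "\<dots> = (\<integral>\<^sup>+k. \<integral>\<^sup>+x. indicator unit_cell x * indicator E (\<tau> *\<^sub>R x + \<tau> *\<^sub>R k) \<partial>lborel \<partial>count_space int_lattice)"
    by (simp only: shift)
  also have "\<dots> = (\<integral>\<^sup>+x. \<integral>\<^sup>+k. indicator unit_cell x * indicator E (\<tau> *\<^sub>R x + \<tau> *\<^sub>R k) \<partial>count_space int_lattice \<partial>lborel)"
    by (rule nn_integral_count_space_nn_integral[OF countable_int_lattice, symmetric]) measurable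
  also have "\<dots> = (\<integral>\<^sup>+x. indicator unit_cell x * (\<integral>\<^sup>+k. indicator E (\<tau> *\<^sub>R x + \<tau> *\<^sub>R k) \<partial>count_space int_lattice) \<partial>lborel)"
    by (simp add: nn_integral_cmult)
  also have "\<dots> \<le> (\<integral>\<^sup>+(x::'a). indicator unit_cell x * ennreal (real m) \<partial>lborel)"
    by (intro nn_integral_mono mult_left_mono count) auto
  also have "\<dots> = ennreal (real m)"
    by (simp add: nn_integral_multc emeasure_unit_cell)
  finally have "emeasure lborel E \<le> ennreal (\<tau> ^ d) * ennreal (real m)"
    by (simp add: mult_left_mono)
  then have "ennreal (measure lborel E) \<le> ennreal (\<tau> ^ d * real m)"
    using \<tau> fin by (simp add: ennreal_mult emeasure_eq_ennreal_measure)
  then have "measure lborel E \<le> \<tau> ^ d * real m" using \<tau> by simp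
  then have "a \<le> real m" using \<tau> by (simp add: a_def field_simps)
  with ma show False by simp
qed

text \<open>The mass of the profile \<open>\<rho>\<close>, shrunk or stretched by
  \<open>\<tau>\<close> and placed at \<open>x\<close>, that falls outside \<open>B\<close>. It
  measures the leakage of a window in time when \<open>\<rho>\<close> is the indicator of the cell,
  and in frequency when \<open>\<rho>\<close> is \<open>cell_spectrum\<close>.\<close>

definition outside_mass :: "('a::euclidean_space \<Rightarrow> real) \<Rightarrow> 'a set \<Rightarrow> real \<Rightarrow> 'a \<Rightarrow> real" where
  "outside_mass \<rho> B \<tau> x = (LINT v|lborel. \<rho> v * (1 - indicator B (x + \<tau> *\<^sub>R v)))"

text \<open>Markov's inequality. On \<open>B\<close> the outside mass is the
  \<open>\<rho>\<close>-average of the change of the indicator under a shift, and integrating this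
  over \<open>x\<close> gives the average of \<open>shift_diff\<close>.\<close>

lemma measure_small_outside_mass:
  fixes B :: "'a::euclidean_space set" and \<tau> :: real
  assumes B: "B \<in> sets borel" "emeasure lborel B < \<infinity>" and \<rho>: "integrable lborel \<rho>" "\<And>v. 0 \<le> \<rho> v" and \<delta>: "\<delta> > 0"
  defines "E \<equiv> {x \<in> B. outside_mass \<rho> B \<tau> x \<le> \<delta>}"
  shows "E \<in> sets borel" "emeasure lborel E < \<infinity>"
    "measure lborel B - (LINT v|lborel. \<rho> v * shift_diff B (\<tau> *\<^sub>R v)) / \<delta> \<le> measure lborel E"
proof -
  have [measurable]: "B \<in> sets borel" "\<rho> \<in> borel_measurable borel" using B \<rho> by auto
  have [measurable]: "outside_mass \<rho> B \<tau> \<in> borel_measurable borel"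
    unfolding outside_mass_def[abs_def] by measurable
  show Em[measurable]: "E \<in> sets borel"
  proof -
    have "E = B \<inter> (outside_mass \<rho> B \<tau> -` {..\<delta>} \<inter> space borel)" by (auto simp: E_def)
    also have "\<dots> \<in> sets borel" by measurable
    finally show ?thesis .
  qed
  have EB: "E \<subseteq> B" by (auto simp: E_def)
  show Efin: "emeasure lborel E < \<infinity>"
    using emeasure_mono[OF EB, of lborel] B by (simp add: order_le_less_trans)
  define K where "K v x = \<rho> v * \<bar>indicator B (x + \<tau> *\<^sub>R v) - indicator B x\<bar>" for v x
  have K: "integrable (lborel \<Otimes>\<^sub>M lborel) (\<lambda>(v, x). K v x)"
    unfolding K_def by (rule integrable_pair_shift_diff[OF B \<rho>(1)])
  have pt: "\<delta> * indicator (B - E) x \<le> (LINT v|lborel. K v x)" for x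
  proof (cases "x \<in> B - E")
    case True
    then have "\<delta> \<le> outside_mass \<rho> B \<tau> x" by (auto simp: E_def)
    also have "\<dots> = (LINT v|lborel. K v x)"
      unfolding outside_mass_def K_def using True
      by (intro integral_cong) (auto simp: indicator_def)
    finally show ?thesis using True by simp
  next
    case False
    then show ?thesis using \<rho>(2) by (simp add: K_def)
  qed
  have BE: "integrable lborel (indicator (B - E) :: 'a \<Rightarrow> real)"
    using B emeasure_mono[of "B - E" B lborel] by (intro integrable_real_indicator) (auto simp: order_le_less_trans)
  have "\<delta> * measure lborel (B - E) = (LINT x|lborel. \<delta> * indicator (B - E) x)"
    using BE by simp
  also have "\<dots> \<le> (LINT x|lborel. LINT v|lborel. K v x)"
    using BE pt lborel_pair.integrable_snd[OF K] by (intro integral_mono) auto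
  also have "\<dots> = (LINT v|lborel. LINT x|lborel. K v x)"
    using lborel_pair.Fubini_integral[OF K] .
  also have "\<dots> = (LINT v|lborel. \<rho> v * shift_diff B (\<tau> *\<^sub>R v))"
    by (simp add: K_def shift_diff_def)
  finally have "measure lborel (B - E) \<le> (LINT v|lborel. \<rho> v * shift_diff B (\<tau> *\<^sub>R v)) / \<delta>"
    using \<delta> by (simp add: field_simps)
  moreover have "measure lborel (B - E) = measure lborel B - measure lborel E"
    using B EB by (intro measure_Diff) auto
  ultimately show "measure lborel B - (LINT v|lborel. \<rho> v * shift_diff B (\<tau> *\<^sub>R v)) / \<delta> \<le> measure lborel E"
    by simp
qed

section \<open>Time-frequency windows\<close>

text \<open>A normalised exponential on a sharply cut cell. Sharp cells make the lattice family
  exactly orthonormal with spacings \<open>s\<close> in time and \<open>2 * pi / s\<close> in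
  frequency, one function per phase volume \<open>(2 * pi) ^ DIM('a)\<close>. The spectrum decays
  slowly, but only its integrability is used.\<close>

definition window :: "real \<Rightarrow> 'a::euclidean_space \<Rightarrow> 'a \<Rightarrow> 'a \<Rightarrow> complex" where
  "window s a \<eta> t = of_real (1 / sqrt (s ^ DIM('a))) * indicator unit_cell ((1 / s) *\<^sub>R (t - a))
     * iexp (\<eta> \<bullet> t)"

definition cell_spectrum :: "'a::euclidean_space \<Rightarrow> real" where
  "cell_spectrum v = (cmod (\<F> (indicator unit_cell) v))\<^sup>2"

lemma borel_measurable_window [measurable]: "window s a \<eta> \<in> borel_measurable borel"
  unfolding window_def[abs_def] by measurable

lemma cmod_window_square:
  fixes a :: "'a::euclidean_space"
  assumes "s > 0"
  shows "(cmod (window s a \<eta> t))\<^sup>2 = indicator unit_cell ((1 / s) *\<^sub>R (t - a)) / s ^ DIM('a)"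
  using assms by (auto simp: window_def norm_mult norm_divide power_divide indicator_def)

lemma unit_cell_lmeasurable: "unit_cell \<in> lmeasurable"
  by (rule lborel_lmeasurable) (auto simp: emeasure_unit_cell)

lemma integrable_indicator_unit_cell: "integrable lborel (indicator unit_cell :: 'a::euclidean_space \<Rightarrow> real)"
  by (rule integrable_real_indicator) (auto simp: emeasure_unit_cell)

lemma lborel_integral_rescale:
  fixes f :: "'a::euclidean_space \<Rightarrow> 'b::{banach, second_countable_topology}" and s :: real
  assumes "s > 0"
  shows "(LINT t|lborel. f t) = s ^ DIM('a) *\<^sub>R (LINT v|lborel. f (a + s *\<^sub>R v))"
  using lborel_integral_affine[of s f a] assms by simp

lemma
  fixes a \<eta> :: "'a::euclidean_space"
  assumes s: "s > 0"
  shows window_L2: "window s a \<eta> \<in> L2"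
    and window_integrable: "integrable lebesgue (window s a \<eta>)"
    and L2_norm_window: "L2_norm (window s a \<eta>) = 1"
proof -
  have "integrable lborel (\<lambda>t. indicator unit_cell ((- (1 / s) *\<^sub>R a) + (1 / s) *\<^sub>R t) :: real)"
    using s by (intro lborel_integrable_affine[OF integrable_indicator_unit_cell]) auto
  then have int: "integrable lborel (\<lambda>t. indicator unit_cell ((1 / s) *\<^sub>R (t - a)) :: real)"
    by (simp add: scaleR_diff_right)
  then have int2: "integrable lborel (\<lambda>t. (cmod (window s a \<eta> t))\<^sup>2)"
    using s by (simp add: cmod_window_square)
  then show "window s a \<eta> \<in> L2"
    by (intro L2I lebesgue_measurable_borel) (auto simp: integrable_completion)
  have "integrable lborel (window s a \<eta>)"
  proof (rule integrable_bound[OF integrable_mult_right[OF int, of "1 / sqrt (s ^ DIM('a))"]])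
    show "AE t in lborel. norm (window s a \<eta> t) \<le> norm (1 / sqrt (s ^ DIM('a)) * indicator unit_cell ((1 / s) *\<^sub>R (t - a)))"
      using s by (intro AE_I2) (auto simp: window_def norm_mult norm_divide indicator_def)
  qed auto
  then show "integrable lebesgue (window s a \<eta>)" by (simp add: integrable_completion)
  have "(LINT t|lebesgue. (cmod (window s a \<eta> t))\<^sup>2) = (LINT t|lborel. (cmod (window s a \<eta> t))\<^sup>2)"
    by (rule integral_completion) measurable
  also have "\<dots> = s ^ DIM('a) * (LINT v|lborel. (cmod (window s a \<eta> (a + s *\<^sub>R v)))\<^sup>2)"
    using lborel_integral_rescale[OF s, of "\<lambda>t. (cmod (window s a \<eta> t))\<^sup>2" a] by simp
  also have "\<dots> = measure lborel (unit_cell :: 'a set)"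
    using s by (simp add: cmod_window_square)
  also have "\<dots> = 1" by (simp add: measure_def emeasure_unit_cell)
  finally show "L2_norm (window s a \<eta>) = 1" by (simp add: L2_norm_def)
qed

text \<open>Different time points give disjoint cells; at the same time point the product is a
  lattice character on one cell, whose integral vanishes unless the frequencies agree.\<close>

lemma L2_inner_window:
  fixes a \<eta> k k' l l' :: "'a::euclidean_space"
  assumes s: "s > 0" and L: "k \<in> int_lattice" "k' \<in> int_lattice" "l \<in> int_lattice" "l' \<in> int_lattice"
  shows "L2_inner (window s (a + s *\<^sub>R k) (\<eta> + (2 * pi / s) *\<^sub>R l)) (window s (a + s *\<^sub>R k') (\<eta> + (2 * pi / s) *\<^sub>R l'))
    = (if k = k' \<and> l = l' then 1 else 0)" (is "L2_inner ?w ?w' = _")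
proof -
  have lb: "L2_inner ?w ?w' = (LINT t|lborel. ?w t * cnj (?w' t))"
    unfolding L2_inner_def by (rule integral_completion) measurable
  show ?thesis
  proof (cases "k = k'")
    case False
    have "?w t * cnj (?w' t) = 0" for t
    proof -
      have "\<not> (t' - k \<in> unit_cell \<and> t' - k' \<in> unit_cell)" for t'
        using unit_cell_lattice_unique[of t' k k'] L False by blast
      moreover have "(1 / s) *\<^sub>R (t - (a + s *\<^sub>R k)) = (1 / s) *\<^sub>R (t - a) - k"
        "(1 / s) *\<^sub>R (t - (a + s *\<^sub>R k')) = (1 / s) *\<^sub>R (t - a) - k'"
        using s by (simp_all add: scaleR_diff_right scaleR_add_right algebra_simps)
      ultimately show ?thesis by (auto simp: window_def indicator_def)
    qed
    then show ?thesis using False lb by (simp only: integral_zero) simp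
  next
    case True
    define a' where "a' = a + s *\<^sub>R k"
    define m where "m = l - l'"
    have m: "m \<in> int_lattice"
      using L by (auto simp: m_def int_lattice_def inner_diff_left)
    have "?w (a' + s *\<^sub>R v) * cnj (?w' (a' + s *\<^sub>R v))
       = of_real (1 / s ^ DIM('a)) * iexp ((2 * pi / s) * (m \<bullet> a'))
          * (indicator unit_cell v * iexp (2 * pi * (m \<bullet> v)))" for v
    proof -
      have "iexp ((\<eta> + (2 * pi / s) *\<^sub>R l) \<bullet> (a' + s *\<^sub>R v))
          * niexp ((\<eta> + (2 * pi / s) *\<^sub>R l') \<bullet> (a' + s *\<^sub>R v))
        = iexp ((2 * pi / s) * (m \<bullet> a')) * iexp (2 * pi * (m \<bullet> v))"
      proof -
        have "(\<eta> + (2 * pi / s) *\<^sub>R l) \<bullet> (a' + s *\<^sub>R v) - (\<eta> + (2 * pi / s) *\<^sub>R l') \<bullet> (a' + s *\<^sub>R v)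
           = (2 * pi / s) * (m \<bullet> a') + 2 * pi * (m \<bullet> v)"
          using s by (simp add: m_def inner_add_left inner_add_right inner_diff_left field_simps)
        then have "\<i> * complex_of_real ((\<eta> + (2 * pi / s) *\<^sub>R l) \<bullet> (a' + s *\<^sub>R v)) + - (\<i> * complex_of_real ((\<eta> + (2 * pi / s) *\<^sub>R l') \<bullet> (a' + s *\<^sub>R v)))
           = \<i> * complex_of_real ((2 * pi / s) * (m \<bullet> a')) + \<i> * complex_of_real (2 * pi * (m \<bullet> v))"
          by (metis (no_types, lifting) diff_conv_add_uminus distrib_left of_real_add of_real_diff right_diff_distrib)
        then show ?thesis by (simp only: exp_add[symmetric])
      qed
      moreover have "window s (a + s *\<^sub>R k) \<zeta> (a' + s *\<^sub>R v)
          = complex_of_real (1 / sqrt (s ^ DIM('a))) * indicator unit_cell v * iexp (\<zeta> \<bullet> (a' + s *\<^sub>R v))" for \<zeta>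
        using s by (simp add: window_def a'_def)
      moreover have "complex_of_real (1 / sqrt (s ^ DIM('a))) * complex_of_real (1 / sqrt (s ^ DIM('a))) = complex_of_real (1 / s ^ DIM('a))"
        using s by (simp flip: of_real_mult)
      ultimately show ?thesis
        using True by (auto simp: exp_cnj indicator_def)
    qed
    then have "L2_inner ?w ?w' = s ^ DIM('a) *\<^sub>R (LINT v|lborel. complex_of_real (1 / s ^ DIM('a)) * iexp ((2 * pi / s) * (m \<bullet> a'))
          * (indicator unit_cell v * iexp (2 * pi * (m \<bullet> v))))"
      unfolding lb using lborel_integral_rescale[OF s, of "\<lambda>t. ?w t * cnj (?w' t)" a'] by (simp only:)
    also have "\<dots> = iexp ((2 * pi / s) * (m \<bullet> a')) * (if m = 0 then 1 else 0)"
      unfolding integral_mult_right_zero integral_unit_cell_character[OF m]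
      using s by (simp add: scaleR_conv_of_real)
    also have "\<dots> = (if k = k' \<and> l = l' then 1 else 0)"
      using True by (auto simp: m_def)
    finally show ?thesis .
  qed
qed

lemma L2_norm_window_outside:
  fixes a \<eta> :: "'a::euclidean_space"
  assumes s: "s > 0" and [measurable]: "A \<in> sets borel"
  shows "(L2_norm (time_proj (- A) (window s a \<eta>)))\<^sup>2 = outside_mass (indicator unit_cell) A s a"
proof -
  have eq: "(cmod (time_proj (- A) (window s a \<eta>) t))\<^sup>2
      = indicator unit_cell ((1 / s) *\<^sub>R (t - a)) / s ^ DIM('a) * (1 - indicator A t)" for t
    using cmod_window_square[OF s, of a \<eta> t] by (auto simp: time_proj_def indicator_def)
  have "(L2_norm (time_proj (- A) (window s a \<eta>)))\<^sup>2
      = (LINT t|lborel. indicator unit_cell ((1 / s) *\<^sub>R (t - a)) / s ^ DIM('a) * (1 - indicator A t))"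
    unfolding L2_norm_square eq by (rule integral_completion) measurable
  also have "\<dots> = outside_mass (indicator unit_cell) A s a"
    using s by (subst lborel_integral_rescale[OF s, of _ a]) (simp add: outside_mass_def)
  finally show ?thesis .
qed

text \<open>The position \<open>a\<close> contributes only a phase, the modulation
  \<open>\<eta>\<close> a shift in frequency, and the size \<open>s\<close> a dilation.\<close>

lemma cmod_fourier_window_square:
  fixes a \<eta> \<xi> :: "'a::euclidean_space"
  assumes s: "s > 0"
  shows "(cmod (\<F> (window s a \<eta>) \<xi>))\<^sup>2 = s ^ DIM('a) * cell_spectrum (s *\<^sub>R (\<xi> - \<eta>))"
proof -
  define c where "c = complex_of_real ((2 * pi) powr (- real DIM('a) / 2))"
  define q where "q = sqrt (s ^ DIM('a))"
  have q: "q > 0" "q * q = s ^ DIM('a)" using s by (auto simp: q_def)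
  define J where "J = (LINT v|lborel. indicator unit_cell v * niexp ((s *\<^sub>R (\<xi> - \<eta>)) \<bullet> v))"
  have "window s a \<eta> (a + s *\<^sub>R v) * niexp (\<xi> \<bullet> (a + s *\<^sub>R v))
      = of_real (1 / q) * iexp ((\<eta> - \<xi>) \<bullet> a)
        * (indicator unit_cell v * niexp ((s *\<^sub>R (\<xi> - \<eta>)) \<bullet> v))" for v
  proof -
    have "\<eta> \<bullet> (a + s *\<^sub>R v) - \<xi> \<bullet> (a + s *\<^sub>R v) = (\<eta> - \<xi>) \<bullet> a - (s *\<^sub>R (\<xi> - \<eta>)) \<bullet> v"
      by (simp add: inner_add_right inner_diff_left algebra_simps)
    then have "\<i> * of_real (\<eta> \<bullet> (a + s *\<^sub>R v)) + - (\<i> * of_real (\<xi> \<bullet> (a + s *\<^sub>R v)))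
        = \<i> * of_real ((\<eta> - \<xi>) \<bullet> a) + - (\<i> * of_real ((s *\<^sub>R (\<xi> - \<eta>)) \<bullet> v))"
      by (metis (no_types, lifting) diff_conv_add_uminus of_real_diff right_diff_distrib)
    then have "iexp (\<eta> \<bullet> (a + s *\<^sub>R v)) * niexp (\<xi> \<bullet> (a + s *\<^sub>R v))
        = iexp ((\<eta> - \<xi>) \<bullet> a) * niexp ((s *\<^sub>R (\<xi> - \<eta>)) \<bullet> v)"
      by (simp only: exp_add[symmetric])
    then show ?thesis using s by (auto simp: window_def q_def[symmetric] indicator_def)
  qed
  then have "(LINT t|lborel. window s a \<eta> t * niexp (\<xi> \<bullet> t))
      = s ^ DIM('a) *\<^sub>R (LINT v|lborel. complex_of_real (1 / q) * iexp ((\<eta> - \<xi>) \<bullet> a)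
        * (indicator unit_cell v * niexp ((s *\<^sub>R (\<xi> - \<eta>)) \<bullet> v)))"
    using lborel_integral_rescale[OF s, of "\<lambda>t. window s a \<eta> t * niexp (\<xi> \<bullet> t)" a]
    by (simp only:)
  also have "\<dots> = complex_of_real q * iexp ((\<eta> - \<xi>) \<bullet> a) * J"
  proof -
    have "s ^ DIM('a) *\<^sub>R (complex_of_real (1 / q) * z * J) = complex_of_real q * z * J" for z
      unfolding q(2)[symmetric] using q(1) by (simp add: scaleR_conv_of_real)
    then show ?thesis by (simp only: integral_mult_right_zero J_def)
  qed
  finally have "\<F> (window s a \<eta>) \<xi> = c * (complex_of_real q * iexp ((\<eta> - \<xi>) \<bullet> a) * J)"
    by (simp add: fourier_integral_lborel c_def)
  moreover have "\<F> (indicator unit_cell) (s *\<^sub>R (\<xi> - \<eta>)) = c * J"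
    by (subst fourier_integral_lborel) (simp_all add: c_def J_def)
  ultimately have "cmod (\<F> (window s a \<eta>) \<xi>) = q * cmod (\<F> (indicator unit_cell) (s *\<^sub>R (\<xi> - \<eta>)))"
    using q by (simp add: norm_mult)
  then show ?thesis
    using q by (simp add: cell_spectrum_def power_mult_distrib power2_eq_square)
qed

lemma
  shows borel_measurable_cell_spectrum [measurable]: "(cell_spectrum :: 'a::euclidean_space \<Rightarrow> real) \<in> borel_measurable borel"
    and integrable_cell_spectrum: "integrable lborel (cell_spectrum :: 'a::euclidean_space \<Rightarrow> real)"
proof -
  note c = integrable_indicator_complex[OF unit_cell_lmeasurable] indicator_L2[OF unit_cell_lmeasurable]
  have [measurable]: "\<F> (indicator unit_cell :: 'a \<Rightarrow> complex) \<in> borel_measurable borel"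
    by (rule borel_measurable_fourier_integral[OF L2_measurable[OF c(2)]])
  show m: "(cell_spectrum :: 'a \<Rightarrow> real) \<in> borel_measurable borel"
    unfolding cell_spectrum_def[abs_def] by measurable
  have "integrable lebesgue (cell_spectrum :: 'a \<Rightarrow> real)"
    using L2_integrable_square[OF Plancherel(1)[OF c]] by (simp add: cell_spectrum_def[abs_def])
  then show "integrable lborel (cell_spectrum :: 'a \<Rightarrow> real)"
    using m by (simp add: integrable_completion)
qed

lemma L2_norm_fourier_window_outside:
  fixes a \<eta> :: "'a::euclidean_space"
  assumes s: "s > 0" and [measurable]: "\<Omega> \<in> sets borel"
  shows "(L2_norm (time_proj (- \<Omega>) (\<F> (window s a \<eta>))))\<^sup>2 = outside_mass cell_spectrum \<Omega> (1 / s) \<eta>"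
proof -
  have eq: "(cmod (time_proj (- \<Omega>) (\<F> (window s a \<eta>)) \<xi>))\<^sup>2
      = s ^ DIM('a) * cell_spectrum (s *\<^sub>R (\<xi> - \<eta>)) * (1 - indicator \<Omega> \<xi>)" for \<xi>
    using cmod_fourier_window_square[OF s, of a \<eta> \<xi>] by (auto simp: time_proj_def indicator_def)
  have "(L2_norm (time_proj (- \<Omega>) (\<F> (window s a \<eta>))))\<^sup>2
      = (LINT \<xi>|lborel. s ^ DIM('a) * cell_spectrum (s *\<^sub>R (\<xi> - \<eta>)) * (1 - indicator \<Omega> \<xi>))"
    unfolding L2_norm_square eq by (rule integral_completion) measurable
  also have "\<dots> = outside_mass cell_spectrum \<Omega> (1 / s) \<eta>"
    using s by (subst lborel_integral_rescale[of "1 / s" _ \<eta>]) (simp_all add: outside_mass_def power_divide mult.assoc)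
  finally show ?thesis .
qed

text \<open>The transform of \<open>w\<close> splits into the band part, the part at frequencies
  outside \<open>\<Omega>\<close>, and the band-limited transform of the piece of \<open>w\<close>
  outside \<open>A\<close>; Plancherel bounds the last by that piece.\<close>

lemma L2_norm_le_band_part:
  assumes A: "A \<in> lmeasurable" and \<Omega>: "\<Omega> \<in> lmeasurable" and w: "integrable lebesgue w" "w \<in> L2"
  shows "L2_norm w \<le> L2_norm (band_part A \<Omega> w) + L2_norm (time_proj (- \<Omega>) (\<F> w))
    + L2_norm (time_proj (- A) w)"
proof -
  have Al: "A \<in> sets lebesgue" "- A \<in> sets lebesgue" and \<Omega>l: "\<Omega> \<in> sets lebesgue" "- \<Omega> \<in> sets lebesgue"
    using A \<Omega> by (auto simp: Compl_in_sets_lebesgue)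
  define F where "F = \<F> w"
  define G where "G = band_part A \<Omega> w"
  define D where "D = time_proj \<Omega> (\<F> (time_proj (- A) w))"
  note wA = time_proj_integrable[OF A w(2)] time_proj_L2[OF Al(1) w(2)]
  have split: "time_proj (- A) w = (\<lambda>x. w x - time_proj A w x)"
    by (auto simp: time_proj_def indicator_def)
  have wA': "integrable lebesgue (time_proj (- A) w)" "time_proj (- A) w \<in> L2"
    unfolding split using w wA by (auto intro: L2_diff)
  have F: "F \<in> L2" "L2_norm F = L2_norm w" unfolding F_def using Plancherel[OF w] by auto
  have G: "G \<in> L2" unfolding G_def by (rule band_part_L2[OF A \<Omega> w(2)])
  have D: "D \<in> L2" unfolding D_def by (intro time_proj_L2 \<Omega>l Plancherel wA')
  have F': "time_proj (- \<Omega>) F \<in> L2" by (intro time_proj_L2 \<Omega>l F)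
  have "F x = (G x + time_proj (- \<Omega>) F x) + D x" for x
    unfolding G_def D_def F_def band_part_def split fourier_integral_diff[OF w(1) wA(1)]
      time_proj_def[of \<Omega>] time_proj_def[of "- \<Omega>"]
    by (cases "x \<in> \<Omega>") (simp_all add: fourier_integral_diff[OF w(1) wA(1)])
  then have "F = (\<lambda>x. (G x + time_proj (- \<Omega>) F x) + D x)" by (rule ext)
  then have "L2_norm F \<le> L2_norm G + L2_norm (time_proj (- \<Omega>) F) + L2_norm D"
    using L2_norm_triangle[OF L2_add[OF G F'] D] L2_norm_triangle[OF G F'] by simp
  moreover have "L2_norm D \<le> L2_norm (time_proj (- A) w)"
  proof -
    have "(L2_norm D)\<^sup>2 \<le> (L2_norm (\<F> (time_proj (- A) w)))\<^sup>2"
      unfolding D_def using L2_norm_time_proj_split[OF \<Omega>l(1) Plancherel(1)[OF wA']] by simp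
    then have "L2_norm D \<le> L2_norm (\<F> (time_proj (- A) w))"
      using L2_norm_nonneg power2_le_imp_le by blast
    then show ?thesis using Plancherel(2)[OF wA'] by simp
  qed
  ultimately show ?thesis by (simp add: F G_def F_def[symmetric])
qed

text \<open>Each leakage has norm at most \<open>\<theta> / 4\<close>, so the band part has norm at
  least \<open>1 - \<theta> / 2\<close> and squared norm at least \<open>1 - \<theta>\<close>; the
  leakage term in the defect formula only helps.\<close>

lemma window_defect_le:
  fixes a \<eta> :: "'a::euclidean_space"
  assumes s: "s > 0" and A: "A \<in> sets borel" "emeasure lborel A < \<infinity>" and \<Omega>: "\<Omega> \<in> sets borel" "emeasure lborel \<Omega> < \<infinity>"
    and \<theta>: "0 < \<theta>" "\<theta> \<le> 1"
    and out: "outside_mass (indicator unit_cell) A s a \<le> (\<theta> / 4)\<^sup>2" "outside_mass cell_spectrum \<Omega> (1 / s) \<eta> \<le> (\<theta> / 4)\<^sup>2"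
  shows "(L2_norm (loc_defect A \<Omega> (window s a \<eta>)))\<^sup>2 \<le> \<theta>"
proof -
  note Al = lborel_lmeasurable[OF A] and \<Omega>l = lborel_lmeasurable[OF \<Omega>]
  define g where "g = L2_norm (band_part A \<Omega> (window s a \<eta>))"
  have "L2_norm (time_proj (- A) (window s a \<eta>)) \<le> \<theta> / 4"
    by (rule power2_le_imp_le)
      (use out(1) \<theta> L2_norm_window_outside[OF s A(1), of a \<eta>] in auto)
  moreover have "L2_norm (time_proj (- \<Omega>) (\<F> (window s a \<eta>))) \<le> \<theta> / 4"
    by (rule power2_le_imp_le)
      (use out(2) \<theta> L2_norm_fourier_window_outside[OF s \<Omega>(1), of a \<eta>] in auto)
  ultimately have "g \<ge> 1 - \<theta> / 2"
    using L2_norm_le_band_part[OF Al \<Omega>l window_integrable[OF s, of a \<eta>] window_L2[OF s, of a \<eta>]] L2_norm_window[OF s, of a \<eta>]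
    by (simp add: g_def)
  then have "(1 - \<theta> / 2)\<^sup>2 \<le> g\<^sup>2" using \<theta> by (intro power_mono) auto
  moreover have "1 - \<theta> \<le> (1 - \<theta> / 2)\<^sup>2" by (simp add: power2_eq_square algebra_simps)
  ultimately have "1 - \<theta> \<le> g\<^sup>2" by linarith
  moreover have "0 \<le> (L2_norm (time_proj (- A) (band_fun A \<Omega> (window s a \<eta>))))\<^sup>2" by simp
  moreover have "(L2_norm (loc_defect A \<Omega> (window s a \<eta>)))\<^sup>2
      = 1 - g\<^sup>2 - (L2_norm (time_proj (- A) (band_fun A \<Omega> (window s a \<eta>))))\<^sup>2"
    using L2_norm_loc_defect[OF Al \<Omega>l window_L2[OF s, of a \<eta>]] L2_norm_window[OF s, of a \<eta>] by (simp add: g_def)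
  ultimately show ?thesis by linarith
qed

text \<open>The defect never exceeds the norm of the function. Windows used as padding need no
  localization at all.\<close>

lemma window_defect_le_1:
  fixes a \<eta> :: "'a::euclidean_space"
  assumes s: "s > 0" and A: "A \<in> lmeasurable" and \<Omega>: "\<Omega> \<in> lmeasurable"
  shows "(L2_norm (loc_defect A \<Omega> (window s a \<eta>)))\<^sup>2 \<le> 1"
  using L2_norm_loc_defect[OF A \<Omega> window_L2[OF s, of a \<eta>]] L2_norm_window[OF s, of a \<eta>] by simp

text \<open>The windows indexed by \<open>F\<close> and \<open>F'\<close> are good, with defect at
  most \<open>\<theta>\<close>; arbitrary other lattice windows raise the family to size
  \<open>M\<close> at a cost of at most 1 each. The last hypothesis says exactly that this total is
  at most \<open>M\<close> times \<open>\<epsilon>\<close>.\<close>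

lemma eta_ge_lattice:
  fixes A \<Omega> :: "'a::euclidean_space set" and \<theta> \<epsilon> s :: real
  assumes s: "s > 0" and A: "A \<in> sets borel" "emeasure lborel A < \<infinity>" and \<Omega>: "\<Omega> \<in> sets borel" "emeasure lborel \<Omega> < \<infinity>"
    and \<theta>: "0 < \<theta>" "\<theta> \<le> 1"
    and F: "finite F" "F \<subseteq> int_lattice" "\<And>k. k \<in> F \<Longrightarrow> outside_mass (indicator unit_cell) A s (a + s *\<^sub>R k) \<le> (\<theta> / 4)\<^sup>2"
    and F': "finite F'" "F' \<subseteq> int_lattice" "\<And>l. l \<in> F' \<Longrightarrow> outside_mass cell_spectrum \<Omega> (1 / s) (\<eta> + (2 * pi / s) *\<^sub>R l) \<le> (\<theta> / 4)\<^sup>2"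
    and M: "card F * card F' \<le> M" "real M * (1 - \<epsilon>) \<le> real (card F * card F') * (1 - \<theta>)"
  shows "enat M \<le> eta \<epsilon> A \<Omega>"
proof -
  note Al = lborel_lmeasurable[OF A] and \<Omega>l = lborel_lmeasurable[OF \<Omega>]
  define P :: "('a \<times> 'a) set" where "P = int_lattice \<times> int_lattice"
  define S where "S = F \<times> F'"
  have S: "finite S" "S \<subseteq> P" "card S = card F * card F'"
    using F F' by (auto simp: S_def P_def card_cartesian_product)
  have "infinite P"
    using infinite_int_lattice[where 'a='a] by (auto simp: P_def finite_cartesian_product_iff)
  then have "infinite (P - S)" using S by simp
  then obtain B where B: "finite B" "card B = M - card S" "B \<subseteq> P - S"
    using infinite_arbitrarily_large by blast
  define S' where "S' = S \<union> B"
  have S': "finite S'" "S' \<subseteq> P" "S \<inter> B = {}" using S B by (auto simp: S'_def)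
  have cS': "card S' = M" using S B S' M by (simp add: S'_def card_Un_disjoint)
  obtain h where h: "bij_betw h {..<M} S'"
    using ex_bij_betw_nat_finite[OF S'(1)] cS' by (auto simp: atLeast0LessThan)
  define w where "w p = window s (a + s *\<^sub>R fst p) (\<eta> + (2 * pi / s) *\<^sub>R snd p)" for p
  define q where "q p = (L2_norm (loc_defect A \<Omega> (w p)))\<^sup>2" for p
  have "L2_orthonormal M (\<lambda>i. w (h i))"
    unfolding L2_orthonormal_def
  proof (intro conjI allI impI)
    show "w (h i) \<in> L2" for i unfolding w_def by (rule window_L2[OF s])
    fix i j assume ij: "i < M" "j < M"
    then have "h i \<in> P" "h j \<in> P" using h S'(2) by (auto simp: bij_betw_def)
    then have "L2_inner (w (h i)) (w (h j)) = (if h i = h j then 1 else 0)"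
      unfolding w_def P_def using s by (subst L2_inner_window) (auto simp: prod_eq_iff)
    also have "h i = h j \<longleftrightarrow> i = j" using h ij by (auto simp: bij_betw_def inj_on_def)
    finally show "L2_inner (w (h i)) (w (h j)) = (if i = j then 1 else 0)" .
  qed
  moreover have "(\<Sum>i<M. q (h i)) \<le> real M * \<epsilon>"
  proof -
    have "(\<Sum>i<M. q (h i)) = (\<Sum>p\<in>S'. q p)" by (rule sum.reindex_bij_betw[OF h])
    also have "\<dots> = (\<Sum>p\<in>S. q p) + (\<Sum>p\<in>B. q p)"
      unfolding S'_def using S B S' by (intro sum.union_disjoint) auto
    also have "\<dots> \<le> (\<Sum>p\<in>S. \<theta>) + (\<Sum>p\<in>B. 1)"
      using F(3) F'(3) unfolding q_def w_def S_def
      by (intro add_mono sum_mono window_defect_le[OF s A \<Omega> \<theta>] window_defect_le_1[OF s Al \<Omega>l]) auto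
    also have "\<dots> = real M - real (card F * card F') * (1 - \<theta>)"
      using S B M by (simp add: of_nat_diff algebra_simps)
    also have "\<dots> \<le> real M * \<epsilon>" using M(2) by (simp add: algebra_simps)
    finally show ?thesis .
  qed
  ultimately show ?thesis unfolding q_def by (rule eta_ge[OF Al \<Omega>l])
qed

section \<open>The limit\<close>

lemma outside_mass_scaleR:
  assumes "r > 0"
  shows "outside_mass \<rho> (dilate r T) s (r *\<^sub>R x) = outside_mass \<rho> T (s / r) x"
proof -
  have "r *\<^sub>R x + s *\<^sub>R v \<in> dilate r T \<longleftrightarrow> x + (s / r) *\<^sub>R v \<in> T" for v
    using mem_scaleR_image[of r "r *\<^sub>R x + s *\<^sub>R v" T] assms by (simp add: scaleR_right_distrib)
  then show ?thesis by (simp add: outside_mass_def indicator_def)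
qed

lemma emeasure_scaleR_image:
  fixes T :: "'a::euclidean_space set"
  assumes "T \<in> sets borel" "r > 0"
  shows "emeasure lborel (dilate r T) = ennreal (r ^ DIM('a)) * emeasure lborel T"
proof -
  have [measurable]: "dilate r T \<in> sets borel" using assms by (intro sets_borel_scaleR_image) auto
  have "indicator (dilate r T) (0 + r *\<^sub>R x) = (indicator T x :: ennreal)" for x
    using mem_scaleR_image[of r "r *\<^sub>R x" T] assms by (simp add: indicator_def)
  then show ?thesis
    using nn_integral_lborel_affine[of "indicator (dilate r T)" r 0] assms
    by (simp add: nn_integral_indicator)
qed

text \<open>Good windows sit at lattice points where the outside mass is small, in time with respect
  to \<open>T\<close> and in frequency with respect to \<open>\<Omega>\<close>. Their number
  \<open>m\<close> is exposed while \<open>M\<close> and \<open>\<epsilon>\<close> stay free, so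
  that the amount of padding can be chosen later.\<close>

lemma eta_lower_eventually:
  fixes T \<Omega> :: "'a::euclidean_space set" and \<theta> :: real
  assumes T: "T \<in> sets borel" "emeasure lborel T < \<infinity>" and \<Omega>: "\<Omega> \<in> sets borel" "emeasure lborel \<Omega> < \<infinity>"
    and \<theta>: "0 < \<theta>" "\<theta> \<le> 1" "\<theta> \<le> measure lborel T" "\<theta> \<le> measure lborel \<Omega>"
  shows "\<forall>\<^sub>F r in at_top. \<exists>m::nat. r ^ DIM('a) * ((measure lborel T - \<theta>) * (measure lborel \<Omega> - \<theta>) / (2 * pi) ^ DIM('a)) \<le> real m \<and>
    (\<forall>M \<epsilon>. m \<le> M \<longrightarrow> real M * (1 - \<epsilon>) \<le> real m * (1 - \<theta>) \<longrightarrow> enat M \<le> eta \<epsilon> (dilate r T) \<Omega>)"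
proof -
  define d where "d = DIM('a)"
  define \<delta> where "\<delta> = (\<theta> / 4)\<^sup>2"
  have \<delta>: "\<delta> > 0" using \<theta> by (simp add: \<delta>_def)
  \<comment> \<open>The cell size \<open>s\<close> is fixed by \<open>\<Omega>\<close> and
    \<open>\<theta>\<close> before \<open>r\<close> grows. Markov's inequality divides by
    \<open>\<delta>\<close>, so the threshold \<open>\<delta> * \<theta>\<close> costs at most
    \<open>\<theta>\<close> of the measure.\<close>
  have "\<forall>\<^sub>F s in at_top. (LINT v|lborel. cell_spectrum v * shift_diff \<Omega> ((1 / s) *\<^sub>R v)) < \<delta> * \<theta>"
    using \<delta> \<theta> by (intro order_tendstoD[OF shift_diff_average_tendsto_0[OF \<Omega> integrable_cell_spectrum]]) simp
  then have "\<forall>\<^sub>F s in at_top. s > 0 \<and> (LINT v|lborel. cell_spectrum v * shift_diff \<Omega> ((1 / s) *\<^sub>R v)) < \<delta> * \<theta>"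
    using eventually_gt_at_top[of "0::real"] by eventually_elim simp
  then obtain s where s: "s > 0" "(LINT v|lborel. cell_spectrum v * shift_diff \<Omega> ((1 / s) *\<^sub>R v)) < \<delta> * \<theta>"
    using eventually_happens'[OF trivial_limit_at_top_linorder] by blast
  have spos: "0 \<le> cell_spectrum v" for v :: 'a by (simp add: cell_spectrum_def)
  define E\<Omega> where "E\<Omega> = {x \<in> \<Omega>. outside_mass cell_spectrum \<Omega> (1 / s) x \<le> \<delta>}"
  note E\<Omega> = measure_small_outside_mass[OF \<Omega> integrable_cell_spectrum spos \<delta>, of "1 / s", folded E\<Omega>_def]
  have mE\<Omega>: "measure lborel \<Omega> - \<theta> \<le> measure lborel E\<Omega>"
    using E\<Omega>(3) s(2) \<delta> by (smt (verit) divide_less_eq mult.commute)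
  obtain \<eta> F' where F': "finite F'" "F' \<subseteq> int_lattice" "\<And>l. l \<in> F' \<Longrightarrow> \<eta> + (2 * pi / s) *\<^sub>R l \<in> E\<Omega>"
      "measure lborel E\<Omega> \<le> real (card F') * (2 * pi / s) ^ d"
    using lattice_translate_many_points[OF E\<Omega>(1,2), of "2 * pi / s"] s unfolding d_def by auto
  have "\<forall>\<^sub>F r in at_top. (LINT v|lborel. indicator unit_cell v * shift_diff T ((1 / r) *\<^sub>R v)) < \<delta> * \<theta>"
    using \<delta> \<theta> by (intro order_tendstoD[OF shift_diff_average_tendsto_0[OF T integrable_indicator_unit_cell]]) simp
  \<comment> \<open>Relative to \<open>T\<close> the cells have size \<open>s / r\<close>, which
    tends to 0 for the fixed \<open>s\<close>.\<close>
  moreover have "filterlim (\<lambda>r. r / s) at_top at_top"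
    using filterlim_tendsto_pos_mult_at_top[OF tendsto_const[of "1 / s"] _ filterlim_ident] s by simp
  ultimately have "\<forall>\<^sub>F r in at_top. (LINT v|lborel. indicator unit_cell v * shift_diff T ((1 / (r / s)) *\<^sub>R v)) < \<delta> * \<theta>"
    unfolding filterlim_iff by blast
  then show ?thesis
    using eventually_gt_at_top[of "0::real"]
  proof eventually_elim
    case (elim r)
    then have r: "r > 0" by simp
    define E where "E = {x \<in> T. outside_mass (indicator unit_cell) T (s / r) x \<le> \<delta>}"
    have cpos: "0 \<le> (indicator unit_cell v :: real)" for v :: 'a by simp
    note E = measure_small_outside_mass[OF T integrable_indicator_unit_cell cpos \<delta>, of "s / r", folded E_def]
    have mE: "measure lborel T - \<theta> \<le> measure lborel E"
      using E(3) elim(1) \<delta> by simp (smt (verit) divide_less_eq mult.commute)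
    obtain x F where F: "finite F" "F \<subseteq> int_lattice" "\<And>k. k \<in> F \<Longrightarrow> x + (s / r) *\<^sub>R k \<in> E"
        "measure lborel E \<le> real (card F) * (s / r) ^ d"
      using lattice_translate_many_points[OF E(1,2), of "s / r"] s r unfolding d_def by auto
    define A where "A = dilate r T"
    have A: "A \<in> sets borel" "emeasure lborel A < \<infinity>"
      unfolding A_def using T r by (auto intro!: sets_borel_scaleR_image simp: emeasure_scaleR_image ennreal_mult_less_top)
    have outF: "outside_mass (indicator unit_cell) A s (r *\<^sub>R x + s *\<^sub>R k) \<le> (\<theta> / 4)\<^sup>2" if "k \<in> F" for k
    proof -
      have "r *\<^sub>R x + s *\<^sub>R k = r *\<^sub>R (x + (s / r) *\<^sub>R k)" using r by (simp add: scaleR_right_distrib)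
      then show ?thesis
        using F(3)[OF that] outside_mass_scaleR[OF r, of "indicator unit_cell" T s "x + (s / r) *\<^sub>R k"]
        by (simp add: A_def E_def \<delta>_def)
    qed
    have outF': "outside_mass cell_spectrum \<Omega> (1 / s) (\<eta> + (2 * pi / s) *\<^sub>R l) \<le> (\<theta> / 4)\<^sup>2" if "l \<in> F'" for l
      using F'(3)[OF that] by (simp add: E\<Omega>_def \<delta>_def)
    \<comment> \<open>The two lattice cell volumes multiply to \<open>(2 * pi) ^ d / r ^ d\<close>:
      the auxiliary size \<open>s\<close> cancels.\<close>
    have "(measure lborel T - \<theta>) * (measure lborel \<Omega> - \<theta>)
        \<le> (real (card F) * (s / r) ^ d) * (real (card F') * (2 * pi / s) ^ d)"
      using F(4) F'(4) mE mE\<Omega> \<theta> s r by (intro mult_mono) auto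
    also have "\<dots> = real (card F * card F') * ((2 * pi) ^ d / r ^ d)"
      using s r by (simp add: power_divide)
    finally have "r ^ d * ((measure lborel T - \<theta>) * (measure lborel \<Omega> - \<theta>) / (2 * pi) ^ d) \<le> real (card F * card F')"
      using r by (simp add: field_simps)
    moreover have "enat M \<le> eta \<epsilon> A \<Omega>"
      if "card F * card F' \<le> M" "real M * (1 - \<epsilon>) \<le> real (card F * card F') * (1 - \<theta>)" for M \<epsilon>
      by (rule eta_ge_lattice[OF s(1) A \<Omega> \<theta>(1,2) F(1,2) outF F'(1,2) outF' that])
    ultimately show ?case unfolding A_def d_def by blast
  qed
qed

section \<open>Large tolerance, null sets and the exact limit\<close>

text \<open>With tolerance at least 1 padding alone suffices: for empty sets of good windows the
  size condition reads \<open>real M * (1 - \<epsilon>) \<le> 0\<close>.\<close>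

lemma eta_eq_infinity:
  assumes A: "A \<in> sets borel" "emeasure lborel A < \<infinity>" and \<Omega>: "\<Omega> \<in> sets borel" "emeasure lborel \<Omega> < \<infinity>"
    and \<epsilon>: "\<epsilon> \<ge> 1"
  shows "eta \<epsilon> A \<Omega> = \<infinity>"
proof -
  have "enat M \<le> eta \<epsilon> A \<Omega>" for M
    using \<epsilon> by (intro eta_ge_lattice[OF _ A \<Omega>, of 1 1 "{}" _ "{}"]) (auto simp: mult_nonneg_nonpos)
  then show ?thesis
    by (metis enat.exhaust enat_ord_simps(1) infinity_ileE not_less_eq_eq order_refl)
qed

lemma time_proj_cong_AE:
  assumes "AE x in lebesgue. x \<in> A \<longleftrightarrow> x \<in> A'" "AE x in lebesgue. f x = g x"
  shows "AE x in lebesgue. time_proj A f x = time_proj A' g x"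
  using assms by eventually_elim (simp add: time_proj_def indicator_def)

text \<open>Each stage of P depends on the two sets only up to null sets. This allows Lebesgue
  measurable sets to be exchanged for Borel ones.\<close>

lemma eta_cong_AE:
  assumes A: "A \<in> lmeasurable" "A' \<in> lmeasurable" "AE x in lebesgue. x \<in> A \<longleftrightarrow> x \<in> A'"
    and \<Omega>: "\<Omega> \<in> lmeasurable" "\<Omega>' \<in> lmeasurable" "AE x in lebesgue. x \<in> \<Omega> \<longleftrightarrow> x \<in> \<Omega>'"
  shows "eta \<epsilon> A \<Omega> = eta \<epsilon> A' \<Omega>'"
proof -
  have "L2_norm (\<lambda>x. loc_op A \<Omega> f x - f x) = L2_norm (\<lambda>x. loc_op A' \<Omega>' f x - f x)" if f: "f \<in> L2" for f
  proof -
    have "\<F> (time_proj A f) = \<F> (time_proj A' f)"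
      using A f by (intro fourier_integral_cong_AE time_proj_cong_AE L2_measurable time_proj_L2) (auto dest: fmeasurableD)
    then have "AE x in lebesgue. band_part A \<Omega> f x = band_part A' \<Omega>' f x"
      unfolding band_part_def using \<Omega>(3) by (intro time_proj_cong_AE) auto
    then have bf: "band_fun A \<Omega> f = band_fun A' \<Omega>' f"
      unfolding band_fun_def inv_fourier_integral_def[abs_def]
      using fourier_integral_cong_AE[OF L2_measurable[OF band_part_L2(2)[OF A(1) \<Omega>(1) f]] L2_measurable[OF band_part_L2(2)[OF A(2) \<Omega>(2) f]]]
      by simp
    have ae: "AE x in lebesgue. loc_defect A \<Omega> f x = loc_defect A' \<Omega>' f x"
      using A(3) by eventually_elim (simp add: loc_defect_def bf time_proj_def indicator_def)
    have "L2_norm (loc_defect A \<Omega> f) = L2_norm (loc_defect A' \<Omega>' f)"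
      by (rule L2_norm_cong_AE[OF L2_measurable[OF loc_defect_L2[OF A(1) \<Omega>(1) f]] L2_measurable[OF loc_defect_L2[OF A(2) \<Omega>(2) f]] ae])
    then show ?thesis
      using L2_norm_loc_op_defect[OF A(1) \<Omega>(1) f] L2_norm_loc_op_defect[OF A(2) \<Omega>(2) f] by simp
  qed
  then have "L2_orthonormal n f \<and> (\<forall>i<n. (L2_norm (\<lambda>x. loc_op A \<Omega> (f i) x - f i x))\<^sup>2 \<le> \<epsilon>)
      \<longleftrightarrow> L2_orthonormal n f \<and> (\<forall>i<n. (L2_norm (\<lambda>x. loc_op A' \<Omega>' (f i) x - f i x))\<^sup>2 \<le> \<epsilon>)" for n f
    by (auto simp: L2_orthonormal_def)
  then show ?thesis unfolding eta_def by simp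
qed

lemma lmeasurable_scaleR_image:
  fixes T :: "'a::euclidean_space set"
  assumes "T \<in> lmeasurable" "r \<noteq> 0"
  shows "dilate r T \<in> lmeasurable"
proof (rule fmeasurableI)
  have "dilate r T = (\<lambda>x. (1 / r) *\<^sub>R x) -` T \<inter> space lebesgue"
    using mem_scaleR_image[OF assms(2), of _ T] by auto
  then show "dilate r T \<in> sets lebesgue"
    using measurable_sets[OF lebesgue_measurable_scaling[of "1 / r"] fmeasurableD[OF assms(1)]] by simp
  show "emeasure lebesgue (dilate r T) < \<infinity>"
    using emeasure_lebesgue_affine[of r 0 T] fmeasurableD2[OF assms(1)]
    by (simp add: ennreal_mult_less_top less_top power_less_top_ennreal)
qed

lemma lmeasurable_borel_version:
  fixes T :: "'a::euclidean_space set"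
  assumes T: "T \<in> lmeasurable"
  obtains T' where "T' \<in> sets borel" "emeasure lborel T' < \<infinity>" "measure lborel T' = measure lebesgue T"
    "AE x in lborel. x \<in> T \<longleftrightarrow> x \<in> T'"
proof
  have Ts: "T \<in> sets (completion lborel)" using T by auto
  show m: "main_part lborel T \<in> sets borel" using main_part_sets[OF Ts] by simp
  show ae: "AE x in lborel. x \<in> T \<longleftrightarrow> x \<in> main_part lborel T"
    using AE_notin_null_part[OF Ts] by eventually_elim (use main_part_null_part_Un[OF Ts] in blast)
  have e: "emeasure lborel (main_part lborel T) = emeasure lebesgue T"
    using emeasure_completion[OF Ts] by (rule sym)
  show "emeasure lborel (main_part lborel T) < \<infinity>"
    unfolding e using fmeasurableD2[OF T] by (simp add: less_top)
  show "measure lborel (main_part lborel T) = measure lebesgue T"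
    unfolding measure_def e ..
qed

lemma AE_lborel_scale:
  fixes P :: "'a::euclidean_space \<Rightarrow> bool"
  assumes "AE x in lborel. P x" "c \<noteq> 0"
  shows "AE x in lborel. P (c *\<^sub>R x)"
proof -
  obtain N where N: "{x \<in> space lborel. \<not> P x} \<subseteq> N" "emeasure lborel N = 0" "N \<in> sets lborel"
    using assms(1) by (rule AE_E)
  have [measurable]: "N \<in> sets borel" using N by simp
  define N' where "N' = (\<lambda>x. c *\<^sub>R x) -` N \<inter> space lborel"
  have N'[measurable]: "N' \<in> sets borel" unfolding N'_def by measurable
  have "emeasure lborel N = ennreal (\<bar>c\<bar> ^ DIM('a)) * (\<integral>\<^sup>+x. indicator N (0 + c *\<^sub>R x) \<partial>lborel)"
    using nn_integral_lborel_affine[of "indicator N" c 0] assms(2) by simp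
  also have "(\<integral>\<^sup>+x. indicator N (0 + c *\<^sub>R x) \<partial>lborel) = (\<integral>\<^sup>+x. indicator N' x \<partial>lborel)"
    by (intro nn_integral_cong) (auto simp: N'_def indicator_def)
  also have "\<dots> = emeasure lborel N'" by simp
  finally have "emeasure lborel N' = 0" using N(2) assms(2) by simp
  then have "N' \<in> null_sets lborel" by (simp add: null_sets_def)
  then show ?thesis by (rule AE_I') (use N(1) in \<open>auto simp: N'_def\<close>)
qed

text \<open>From above, \<open>eta_le\<close> after rescaling, where the leakage is
  \<open>r ^ d\<close> times a quantity tending to 0. From below, the padded lattice families:
  \<open>\<theta>\<close> is chosen small for a given gap, and then \<open>r\<close> tends to
  infinity.\<close>

lemma eta_limit_borel:
  fixes T \<Omega> :: "'a::euclidean_space set" and \<epsilon> :: real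
  assumes T: "T \<in> sets borel" "emeasure lborel T < \<infinity>" and \<Omega>: "\<Omega> \<in> sets borel" "emeasure lborel \<Omega> < \<infinity>"
    and \<epsilon>: "0 < \<epsilon>" "\<epsilon> < 1"
  shows "((\<lambda>r. ereal_of_enat (eta \<epsilon> (dilate r T) \<Omega>) / ereal (r ^ DIM('a)))
    \<longlongrightarrow> ereal (measure lborel T * measure lborel \<Omega> / (2 * pi) ^ DIM('a) / (1 - \<epsilon>))) at_top"
    (is "(?f \<longlongrightarrow> ereal ?l) at_top")
proof (rule order_tendstoI)
  note \<Omega>l = lborel_lmeasurable[OF \<Omega>]
  define d where "d = DIM('a)"
  have m\<Omega>: "measure lebesgue \<Omega> = measure lborel \<Omega>" using \<Omega> by (simp add: measure_completion)
  define N0 where "N0 = measure lborel T * measure lborel \<Omega> / (2 * pi) ^ d"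
  have N0: "N0 \<ge> 0" by (simp add: N0_def)
  {
    fix a assume a: "ereal ?l < a"
    define g where "g r = (LINT v|lborel. (cmod (band_kernel \<Omega> v))\<^sup>2 * shift_diff T ((1 / r) *\<^sub>R v))" for r
    have "(g \<longlongrightarrow> 0) at_top"
      unfolding g_def[abs_def] by (rule shift_diff_average_tendsto_0[OF T integrable_band_kernel_square[OF \<Omega>l]])
    then have "((\<lambda>r. (N0 + g r) / (1 - \<epsilon>)) \<longlongrightarrow> (N0 + 0) / (1 - \<epsilon>)) at_top"
      using \<epsilon> by (intro tendsto_intros) auto
    then have "((\<lambda>r. ereal ((N0 + g r) / (1 - \<epsilon>))) \<longlongrightarrow> ereal ?l) at_top"
      by (simp add: N0_def d_def)
    then have "\<forall>\<^sub>F r in at_top. ereal ((N0 + g r) / (1 - \<epsilon>)) < a"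
      using a by (rule order_tendstoD)
    then show "\<forall>\<^sub>F r in at_top. ?f r < a"
      using eventually_gt_at_top[of "0::real"]
    proof eventually_elim
      case (elim r)
      then have r: "r > 0" by simp
      define A where "A = dilate r T"
      have A: "A \<in> sets borel" "emeasure lborel A < \<infinity>" "measure lborel A = r ^ d * measure lborel T"
        unfolding A_def d_def using T r
        by (auto intro!: sets_borel_scaleR_image simp: emeasure_scaleR_image ennreal_mult_less_top measure_def enn2real_mult)
      have "ereal_of_enat (eta \<epsilon> A \<Omega>) \<le> ereal ((measure lborel A * measure lebesgue \<Omega> / (2 * pi) ^ d
          + (LINT v|lborel. (cmod (band_kernel \<Omega> v))\<^sup>2 * shift_diff A v)) / (1 - \<epsilon>))"
        unfolding d_def by (rule eta_le[OF A(1,2) \<Omega>l \<epsilon>(2)])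
      also have "(LINT v|lborel. (cmod (band_kernel \<Omega> v))\<^sup>2 * shift_diff A v) = r ^ d * g r"
        unfolding A_def shift_diff_scaleR[OF r] g_def d_def
        by (subst integral_mult_right_zero[symmetric]) (simp add: mult_ac)
      also have "(measure lborel A * measure lebesgue \<Omega> / (2 * pi) ^ d + r ^ d * g r) / (1 - \<epsilon>)
          = (N0 + g r) / (1 - \<epsilon>) * r ^ d"
        unfolding A(3) m\<Omega> N0_def by (simp add: algebra_simps add_divide_distrib)
      finally have "ereal_of_enat (eta \<epsilon> A \<Omega>) / ereal (r ^ d) \<le> ereal ((N0 + g r) / (1 - \<epsilon>) * r ^ d) / ereal (r ^ d)"
        using r by (intro ereal_divide_right_mono) auto
      also have "\<dots> = ereal ((N0 + g r) / (1 - \<epsilon>))" using r by simp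
      also have "\<dots> < a" using elim by simp
      finally show ?case by (simp add: A_def d_def)
    qed
  next
    fix a assume a: "a < ereal ?l"
    show "\<forall>\<^sub>F r in at_top. a < ?f r"
    \<comment> \<open>If \<open>T\<close> or \<open>\<Omega>\<close> is null there is no positive
      \<open>\<theta>\<close> below both measures; the limit is then 0 and nonnegativity of
      \<open>eta\<close> is enough.\<close>
    proof (cases "N0 = 0")
      case True
      have "?l = N0 / (1 - \<epsilon>)" by (simp only: N0_def d_def)
      also have "\<dots> = 0" using True by simp
      finally have "a < 0" using a by (simp only: zero_ereal_def)
      show ?thesis
        using eventually_gt_at_top[of "0::real"]
      proof eventually_elim
        case (elim r)
        then have "0 \<le> ?f r" by (intro zero_le_divide_ereal) auto
        with \<open>a < 0\<close> show ?case by (rule less_le_trans)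
      qed
    next
      case False
      have pos: "measure lborel T > 0" "measure lborel \<Omega> > 0"
        using False by (auto simp: N0_def zero_less_measure_iff)
      \<comment> \<open>\<open>a\<close> may be minus infinity, so a real number takes its
        place.\<close>
      obtain b where b: "a \<le> ereal b" "b < ?l"
        using a that[of "?l - 1"] by (cases a) auto
      \<comment> \<open>The density of good windows times the padding ratio
        \<open>(1 - \<theta>) / (1 - \<epsilon>)\<close>; at \<open>\<theta> = 0\<close> it is the
        claimed limit.\<close>
      define c where "c \<theta> = (measure lborel T - \<theta>) * (measure lborel \<Omega> - \<theta>) / (2 * pi) ^ d * (1 - \<theta>) / (1 - \<epsilon>)" for \<theta>
      have "(c \<longlongrightarrow> c 0) (at_right 0)"
        unfolding c_def using \<epsilon> by (intro tendsto_intros) auto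
      moreover have "b < c 0" using b(2) by (simp add: c_def d_def)
      ultimately have "\<forall>\<^sub>F \<theta> in at_right 0. b < c \<theta>" by (rule order_tendstoD)
      \<comment> \<open>\<open>\<theta> \<le> \<epsilon>\<close> makes the padding ratio at least 1,
        so the padded size \<open>M\<close> is not smaller than \<open>m\<close>.\<close>
      moreover have "\<forall>\<^sub>F \<theta> in at_right 0. \<theta> \<in> {0<..<min (min 1 \<epsilon>) (min (measure lborel T) (measure lborel \<Omega>))}"
        using pos \<epsilon> by (intro eventually_at_right_real) auto
      ultimately have "\<forall>\<^sub>F \<theta> in at_right 0. 0 < \<theta> \<and> b < c \<theta> \<and> \<theta> \<le> 1 \<and> \<theta> \<le> \<epsilon> \<and> \<theta> \<le> measure lborel T \<and> \<theta> \<le> measure lborel \<Omega>"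
        by eventually_elim auto
      then obtain \<theta> where \<theta>: "0 < \<theta>" "b < c \<theta>" "\<theta> \<le> 1" "\<theta> \<le> \<epsilon>" "\<theta> \<le> measure lborel T" "\<theta> \<le> measure lborel \<Omega>"
        using eventually_happens'[OF trivial_limit_at_right_real] by blast
      \<comment> \<open>The term \<open>1 / r ^ d\<close> absorbs the loss from rounding the family
        size down to an integer.\<close>
      have "((\<lambda>r::real. c \<theta> - 1 / r ^ d) \<longlongrightarrow> c \<theta> - 0) at_top"
        unfolding d_def by (intro tendsto_intros tendsto_divide_0[OF tendsto_const] filterlim_at_top_imp_at_infinity filterlim_pow_at_top filterlim_ident) auto
      then have "\<forall>\<^sub>F r::real in at_top. b < c \<theta> - 1 / r ^ d"
        using \<theta>(2) by (intro order_tendstoD) auto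
      then show ?thesis
        using eta_lower_eventually[OF T \<Omega> \<theta>(1,3,5,6)] eventually_gt_at_top[of "0::real"]
      proof eventually_elim
        case (elim r)
        then have r: "r > 0" by simp
        obtain m where m: "r ^ d * ((measure lborel T - \<theta>) * (measure lborel \<Omega> - \<theta>) / (2 * pi) ^ d) \<le> real m"
          "\<And>M \<epsilon>. m \<le> M \<Longrightarrow> real M * (1 - \<epsilon>) \<le> real m * (1 - \<theta>) \<Longrightarrow> enat M \<le> eta \<epsilon> (dilate r T) \<Omega>"
          using elim(2) unfolding d_def by blast
        \<comment> \<open>The largest size that the padding condition permits.\<close>
        define M where "M = nat \<lfloor>real m * (1 - \<theta>) / (1 - \<epsilon>)\<rfloor>"
        have M: "real M \<le> real m * (1 - \<theta>) / (1 - \<epsilon>)" "real m * (1 - \<theta>) / (1 - \<epsilon>) < real M + 1"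
          using \<theta> \<epsilon> by (simp_all add: M_def)
        have "real m \<le> real m * (1 - \<theta>) / (1 - \<epsilon>)"
          using \<theta> \<epsilon> by (simp add: field_simps mult_right_mono)
        then have "m \<le> M" unfolding M_def by (simp add: le_nat_floor)
        moreover have "real M * (1 - \<epsilon>) \<le> real m * (1 - \<theta>)"
          using M(1) \<epsilon> by (simp add: field_simps)
        ultimately have le: "enat M \<le> eta \<epsilon> (dilate r T) \<Omega>" by (rule m(2))
        have "r ^ d * c \<theta> = r ^ d * ((measure lborel T - \<theta>) * (measure lborel \<Omega> - \<theta>) / (2 * pi) ^ d) * ((1 - \<theta>) / (1 - \<epsilon>))"
          by (simp add: c_def)
        also have "\<dots> \<le> real m * ((1 - \<theta>) / (1 - \<epsilon>))"
          using m(1) \<theta> \<epsilon> by (intro mult_right_mono) auto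
        also have "\<dots> < real M + 1" using M(2) by simp
        finally have "c \<theta> < (real M + 1) / r ^ d" using r by (simp add: pos_less_divide_eq mult.commute)
        then have "c \<theta> - 1 / r ^ d < real M / r ^ d" by (simp add: add_divide_distrib)
        then have "b < real M / r ^ d" using elim(1) by simp
        then have "a < ereal (real M / r ^ d)" using b(1) by (meson ereal_less_eq(3) le_less_trans less_ereal.simps(1))
        also have "\<dots> = ereal_of_enat (enat M) / ereal (r ^ d)" using r by simp
        also have "\<dots> \<le> ereal_of_enat (eta \<epsilon> (dilate r T) \<Omega>) / ereal (r ^ d)"
          using r le by (intro ereal_divide_right_mono) (simp_all only: ereal_of_enat_le_iff, simp)
        finally show ?case by (simp add: d_def)
      qed
    qed
  }
qed

text \<open>For \<epsilon> < 1 the bounds are read off the exact limit, using (1 + \<epsilon>)(1 -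
  \<epsilon>) \<le> 1 below and 1 - 2 \<epsilon> \<le> 1 - \<epsilon> above. The limit is an
  \<open>ereal\<close> because \<open>eta\<close> is infinite for \<epsilon> \<ge> 1. The upper
  bound is guarded because \<open>inverse (1 - 2 * \<epsilon>)\<close> is 0 at \<epsilon> = 1/2, by
  the convention for division, and negative beyond.\<close>

theorem theorem1:
  fixes T \<Omega> :: "'a::euclidean_space set" and \<epsilon> :: real
  assumes "T \<in> lmeasurable" and "\<Omega> \<in> lmeasurable" and "\<epsilon> > 0"
  shows "\<exists>L :: ereal.
    ((\<lambda>r :: real. ereal_of_enat (eta \<epsilon> ((\<lambda>t. r *\<^sub>R t) ` T) \<Omega>) / ereal (r ^ DIM('a))) \<longlongrightarrow> L) at_top \<and>
    ereal (measure lebesgue T * measure lebesgue \<Omega> / (2 * pi) ^ DIM('a) * (1 + \<epsilon>)) \<le> L \<and>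
    (\<epsilon> < 1 / 2 \<longrightarrow>
      L \<le> ereal (measure lebesgue T * measure lebesgue \<Omega> / (2 * pi) ^ DIM('a) * inverse (1 - 2 * \<epsilon>)))"
proof -
  obtain T' where T': "T' \<in> sets borel" "emeasure lborel T' < \<infinity>" "measure lborel T' = measure lebesgue T"
    "AE x in lborel. x \<in> T \<longleftrightarrow> x \<in> T'"
    using lmeasurable_borel_version[OF assms(1)] .
  obtain \<Omega>' where \<Omega>': "\<Omega>' \<in> sets borel" "emeasure lborel \<Omega>' < \<infinity>" "measure lborel \<Omega>' = measure lebesgue \<Omega>"
    "AE x in lborel. x \<in> \<Omega> \<longleftrightarrow> x \<in> \<Omega>'"
    using lmeasurable_borel_version[OF assms(2)] .
  define N0 where "N0 = measure lebesgue T * measure lebesgue \<Omega> / (2 * pi) ^ DIM('a)"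
  have N0: "N0 \<ge> 0" by (simp add: N0_def)
  define f where "f S \<Theta> r = ereal_of_enat (eta \<epsilon> (dilate r S) \<Theta>) / ereal (r ^ DIM('a))" for S \<Theta> :: "'a set" and r
  have eq: "eta \<epsilon> (dilate r T) \<Omega> = eta \<epsilon> (dilate r T') \<Omega>'"
    and A': "dilate r T' \<in> sets borel" "emeasure lborel (dilate r T') < \<infinity>"
    if r: "r > 0" for r :: real
  proof -
    show A': "dilate r T' \<in> sets borel" "emeasure lborel (dilate r T') < \<infinity>"
      using T' r by (auto intro!: sets_borel_scaleR_image simp: emeasure_scaleR_image ennreal_mult_less_top)
    have "AE x in lborel. (1 / r) *\<^sub>R x \<in> T \<longleftrightarrow> (1 / r) *\<^sub>R x \<in> T'"
      using AE_lborel_scale[OF T'(4), of "1 / r"] r by simp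
    then have "AE x in lebesgue. x \<in> dilate r T \<longleftrightarrow> x \<in> dilate r T'"
      using r by (simp add: mem_scaleR_image AE_completion)
    moreover have "dilate r T \<in> lmeasurable"
      using r by (intro lmeasurable_scaleR_image assms(1)) simp
    ultimately show "eta \<epsilon> (dilate r T) \<Omega> = eta \<epsilon> (dilate r T') \<Omega>'"
      using A' \<Omega>' assms(2) by (intro eta_cong_AE) (auto simp: lborel_lmeasurable AE_completion)
  qed
  have ev: "\<forall>\<^sub>F r in at_top. f T' \<Omega>' r = f T \<Omega> r"
    using eventually_gt_at_top[of "0::real"] by eventually_elim (simp add: f_def eq)
  show ?thesis
  proof (cases "\<epsilon> < 1")
    case True
    have "(f T' \<Omega>' \<longlongrightarrow> ereal (N0 / (1 - \<epsilon>))) at_top"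
      unfolding f_def[abs_def] N0_def T'(3)[symmetric] \<Omega>'(3)[symmetric]
      by (rule eta_limit_borel[OF T'(1,2) \<Omega>'(1,2) assms(3) True])
    then have lim: "(f T \<Omega> \<longlongrightarrow> ereal (N0 / (1 - \<epsilon>))) at_top"
      using tendsto_cong[OF ev] by blast
    have "(1 + \<epsilon>) * (1 - \<epsilon>) \<le> 1" by (simp add: algebra_simps)
    then have "1 + \<epsilon> \<le> 1 / (1 - \<epsilon>)" using True by (simp add: field_simps)
    then have lower: "N0 * (1 + \<epsilon>) \<le> N0 / (1 - \<epsilon>)"
      using mult_left_mono[OF _ N0, of "1 + \<epsilon>" "1 / (1 - \<epsilon>)"] by simp
    have "N0 / (1 - \<epsilon>) \<le> N0 * inverse (1 - 2 * \<epsilon>)" if "\<epsilon> < 1 / 2"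
      using that N0 assms(3) by (auto simp: inverse_eq_divide intro!: divide_left_mono)
    with lim lower show ?thesis unfolding f_def[abs_def] N0_def[symmetric] by auto
  next
    case False
    have "\<forall>\<^sub>F r in at_top. f T \<Omega> r = \<infinity>"
      using eventually_gt_at_top[of "0::real"]
    proof eventually_elim
      case (elim r)
      then have "eta \<epsilon> (dilate r T) \<Omega> = \<infinity>"
        using eq[OF elim] eta_eq_infinity[OF A'[OF elim] \<Omega>'(1,2)] False by simp
      then show ?case using elim by (simp add: f_def)
    qed
    then have "(f T \<Omega> \<longlongrightarrow> \<infinity>) at_top" by (rule tendsto_eventually)
    with False show ?thesis unfolding f_def[abs_def] by (intro exI[of _ "\<infinity>"]) auto
  qed
qed

end
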